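(* Let $X$ be a topological vector space over $\mathbb K$ belonging to the class $\mathfrak M$. Then for every $k\in\mathbb N$ there exists a uniformly continuous hereditarily hypercyclic (and therefore mixing) operator group $\{T_t\}_{t\in\mathbb K^k}$ on $X$ such that the map $z\mapsto f(T_zx)$ from $\mathbb K^k$ to $\mathbb K$ is analytic for each $x\in X$ and each $f\in X'$.
   Context: $\mathbb K$ is either $\mathbb R$ or $\mathbb C$; all vector spaces are over $\mathbb K$ and all topological spaces are assumed Hausdorff. $\mathbb Z_+=\{0,1,2,\dots\}$, $\mathbb N=\{1,2,\dots\}$. $L(X)$ is the space of continuous linear operators on a topological vector space $X$, and $X'$ is the space of continuous linear functionals on $X$. An $\mathcal F$-space is a complete metrizable topological vector space. A set $A\subset X'$ is equicontinuous if there is a neighborhood $U$ of zero in $X$ with $|f(x)|\le 1$ for all $x\in U$, $f\in A$. Class $\mathfrak M$: $X\in\mathfrak M_0$ if there is a dense linear subspace $Y$ of $X$ admitting a topology $\tau$ stronger than the one inherited from $X$ such that $(Y,\tau)$ is a separable $\mathcal F$-space. $X\in\mathfrak M_1$ if there is a linearly independent equicontinuous sequence $\{f_n\}_{n\in\mathbb Z_+}$ in $X'$. $\mathfrak M=\mathfrak M_0\cap\mathfrak M_1$. An operator group $\{T_t\}_{t\in\mathbb K^k}$ on $X$ is a family in $L(X)$ with $T_0=I$ and $T_{s+t}=T_tT_s$ for all $s,t\in\mathbb K^k$; $|t|$ is the Euclidean norm. It is uniformly continuous if there is a neighborhood $U$ of zero in $X$ such that for every sequence $t_n\to t$ in $\mathbb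 K^k$, $T_{t_n}x\to T_tx$ uniformly for $x\in U$. A family $\{S_a:a\in A\}\subset L(X)$ is universal if there is $x\in X$ such that $\{S_ax:a\in A\}$ is dense in $X$. The group is hereditarily hypercyclic if for every sequence $\{t_n\}_{n\in\mathbb Z_+}$ in $\mathbb K^k$ with $|t_n|\to\infty$ the family $\{T_{t_n}:n\in\mathbb Z_+\}$ is universal. It is mixing if for any non-empty open $U,V\subseteq X$ there is $r>0$ such that $T_t(U)\cap V\ne\varnothing$ whenever $|t|>r$. *)

theory Defs
  imports "HOL-Analysis.Analysis"
begin

text \<open>
  All notions are parametrised by the scalar multiplication
  \<open>scl :: 'k \<Rightarrow> 'a \<Rightarrow> 'a\<close>, so that they apply to real as well as to complex
  topological vector spaces; the space itself is the whole type \<open>'a\<close> with its type class topology.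
\<close>

locale tvs = vector_space scl
  for scl :: "'k::real_normed_field \<Rightarrow> 'a::{topological_ab_group_add, t2_space} \<Rightarrow> 'a" +
  assumes continuous_scale: "continuous_on UNIV (\<lambda>(c, x). scl c x)"

definition cont_operators ::
    "('k::real_normed_field \<Rightarrow> 'a::{ab_group_add, topological_space} \<Rightarrow> 'a) \<Rightarrow> ('a \<Rightarrow> 'a) set"
  where "cont_operators scl = {T. Vector_Spaces.linear scl scl T \<and> continuous_on UNIV T}"

definition cont_dual ::
    "('k::real_normed_field \<Rightarrow> 'a::{ab_group_add, topological_space} \<Rightarrow> 'a) \<Rightarrow> ('a \<Rightarrow> 'k) set"
  where "cont_dual scl = {f. Vector_Spaces.linear scl (*) f \<and> continuous_on UNIV f}"

subsection \<open>The class \<open>\<MM>\<close>\<close>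

text \<open>Completeness is that of the uniformity of the topological vector space
  (every Cauchy filter converges), not completeness of some given metric.\<close>

definition tvs_cauchy_filter :: "'a::ab_group_add topology \<Rightarrow> 'a filter \<Rightarrow> bool"
  where "tvs_cauchy_filter \<tau> F \<longleftrightarrow>
    F \<noteq> bot \<and> F \<le> principal (topspace \<tau>) \<and>
    (\<forall>U. openin \<tau> U \<and> 0 \<in> U \<longrightarrow>
      (\<exists>A. eventually (\<lambda>x. x \<in> A) F \<and> (\<forall>x\<in>A. \<forall>y\<in>A. x - y \<in> U)))"

definition tvs_complete :: "'a::ab_group_add topology \<Rightarrow> bool"
  where "tvs_complete \<tau> \<longleftrightarrow>
    (\<forall>F. tvs_cauchy_filter \<tau> F \<longrightarrow> (\<exists>l. limitin \<tau> (\<lambda>x. x) l F))"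

text \<open>The underlying vector space of the F-space is the linear subspace \<open>topspace \<tau>\<close>.\<close>

definition F_space ::
    "('k::real_normed_field \<Rightarrow> 'a::ab_group_add \<Rightarrow> 'a) \<Rightarrow> 'a topology \<Rightarrow> bool"
  where "F_space scl \<tau> \<longleftrightarrow>
    module.subspace scl (topspace \<tau>) \<and>
    continuous_map (prod_topology \<tau> \<tau>) \<tau> (\<lambda>(x, y). x + y) \<and>
    continuous_map (prod_topology euclidean \<tau>) \<tau> (\<lambda>(c, x). scl c x) \<and>
    metrizable_space \<tau> \<and> tvs_complete \<tau>"

definition class_M0 ::
    "('k::real_normed_field \<Rightarrow> 'a::{ab_group_add, topological_space} \<Rightarrow> 'a) \<Rightarrow> bool"
  where "class_M0 scl \<longleftrightarrow>
    (\<exists>Y \<tau>. module.subspace scl Y \<and> closure Y = UNIV \<and>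
      topspace \<tau> = Y \<and> (\<forall>U. openin (top_of_set Y) U \<longrightarrow> openin \<tau> U) \<and>
      F_space scl \<tau> \<and> separable_space \<tau>)"

definition equicontinuous ::
    "('a::{zero, topological_space} \<Rightarrow> 'k::real_normed_field) set \<Rightarrow> bool"
  where "equicontinuous A \<longleftrightarrow>
    (\<exists>U. open U \<and> 0 \<in> U \<and> (\<forall>f\<in>A. \<forall>x\<in>U. norm (f x) \<le> 1))"

definition lin_indep_seq :: "(nat \<Rightarrow> 'a \<Rightarrow> 'k::real_normed_field) \<Rightarrow> bool"
  where "lin_indep_seq f \<longleftrightarrow>
    (\<forall>I c. finite I \<and> (\<forall>x. (\<Sum>n\<in>I. c n * f n x) = 0) \<longrightarrow> (\<forall>n\<in>I. c n = 0))"

definition class_M1 ::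
    "('k::real_normed_field \<Rightarrow> 'a::{ab_group_add, topological_space} \<Rightarrow> 'a) \<Rightarrow> bool"
  where "class_M1 scl \<longleftrightarrow>
    (\<exists>f. range f \<subseteq> cont_dual scl \<and> lin_indep_seq f \<and> equicontinuous (range f))"

definition class_M ::
    "('k::real_normed_field \<Rightarrow> 'a::{ab_group_add, topological_space} \<Rightarrow> 'a) \<Rightarrow> bool"
  where "class_M scl \<longleftrightarrow> class_M0 scl \<and> class_M1 scl"

subsection \<open>Operator groups\<close>

definition operator_group ::
    "('k::real_normed_field \<Rightarrow> 'a::{ab_group_add, topological_space} \<Rightarrow> 'a) \<Rightarrow>
     ('k ^ 'n \<Rightarrow> 'a \<Rightarrow> 'a) \<Rightarrow> bool"
  where "operator_group scl T \<longleftrightarrow>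
    range T \<subseteq> cont_operators scl \<and> T 0 = id \<and> (\<forall>s t. T (s + t) = T t \<circ> T s)"

definition uniformly_continuous_group ::
    "('k::real_normed_field ^ 'n \<Rightarrow> 'a::{ab_group_add, topological_space} \<Rightarrow> 'a) \<Rightarrow> bool"
  where "uniformly_continuous_group T \<longleftrightarrow>
    (\<exists>U. open U \<and> 0 \<in> U \<and>
      (\<forall>s t. s \<longlonglongrightarrow> t \<longrightarrow>
        (\<forall>W. open W \<and> 0 \<in> W \<longrightarrow>
          (\<forall>\<^sub>F n in sequentially. \<forall>x\<in>U. T (s n) x - T t x \<in> W))))"

definition universal_family :: "('i \<Rightarrow> 'a::topological_space \<Rightarrow> 'a) \<Rightarrow> 'i set \<Rightarrow> bool"
  where "universal_family S A \<longleftrightarrow> (\<exists>x. closure ((\<lambda>a. S a x) ` A) = UNIV)"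

definition hereditarily_hypercyclic ::
    "('k::real_normed_field ^ 'n \<Rightarrow> 'a::topological_space \<Rightarrow> 'a) \<Rightarrow> bool"
  where "hereditarily_hypercyclic T \<longleftrightarrow>
    (\<forall>t :: nat \<Rightarrow> 'k ^ 'n. filterlim (\<lambda>n. norm (t n)) at_top sequentially \<longrightarrow>
      universal_family (\<lambda>n. T (t n)) UNIV)"

definition mixing ::
    "('k::real_normed_field ^ 'n \<Rightarrow> 'a::topological_space \<Rightarrow> 'a) \<Rightarrow> bool"
  where "mixing T \<longleftrightarrow>
    (\<forall>U V. open U \<and> U \<noteq> {} \<and> open V \<and> V \<noteq> {} \<longrightarrow>
      (\<exists>r>0. \<forall>t. norm t > r \<longrightarrow> T t ` U \<inter> V \<noteq> {}))"

text \<open>Analyticity in several variables: near every point the function is the (unconditional) sum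
  of a power series, indexed by multi-indices \<open>\<alpha> :: 'n \<Rightarrow> nat\<close>. Over the reals this is real
  analyticity, over the complex numbers it is holomorphy.\<close>

definition analytic_map :: "('k::real_normed_field ^ 'n \<Rightarrow> 'k) \<Rightarrow> bool"
  where "analytic_map g \<longleftrightarrow>
    (\<forall>w. \<exists>r>0. \<exists>c :: ('n \<Rightarrow> nat) \<Rightarrow> 'k. \<forall>z. norm (z - w) < r \<longrightarrow>
      ((\<lambda>\<alpha>. c \<alpha> * (\<Prod>i\<in>UNIV. (z $ i - w $ i) ^ \<alpha> i)) has_sum g z) UNIV)"

end

theory Submission
  imports Defs "HOL-Library.Function_Algebras"
begin

text \<open>
  Index Taylor coefficients \<open>d\<^sub>\<alpha> = \<partial>\<^sup>\<alpha> h(0)\<close> by multi-indices and let \<open>z\<close> act by translation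
  \<open>h \<mapsto> h(\<cdot> + z)\<close>, i.e. \<open>(S\<^sub>z d)\<^sub>\<alpha> = \<Sum>\<^sub>\<gamma> z\<^sup>\<gamma>/\<gamma>! d\<^sub>\<alpha>\<^sub>+\<^sub>\<gamma>\<close>. In \<open>X\<close> there are biorthogonal \<open>y\<^sub>\<alpha> \<in> X\<close>,
  \<open>\<phi>\<^sub>\<alpha> \<in> X'\<close>, with the \<open>y\<^sub>\<alpha>\<close> spanning a dense subspace and the \<open>\<phi>\<^sub>\<alpha>\<close> decreasing so fast, uniformly
  on a neighbourhood of zero, that \<open>T\<^sub>z x = x + \<Sum>\<^sub>\<alpha> ((S\<^sub>z - I) \<phi>(x))\<^sub>\<alpha> y\<^sub>\<alpha>\<close> is an operator group on \<open>X\<close>.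
  It is intertwined with \<open>S\<close> by the synthesis map \<open>d \<mapsto> \<Sum>\<^sub>\<alpha> d\<^sub>\<alpha> y\<^sub>\<alpha>\<close>, which is continuous with dense
  range, so mixing and universality need only be proved for \<open>S\<close>.

  For \<open>S\<close> the point is that a polynomial \<open>h\<close> of degree \<open>m\<close> is approximated by
  \<open>h(s) (1 - s\<^sub>j/z\<^sub>j)\<^sup>m\<^sup>+\<^sup>1\<close>, where \<open>\<bar>z\<^sub>j\<bar>\<close> is maximal: as \<open>\<bar>z\<bar> \<rightarrow> \<infinity>\<close> this tends to \<open>h\<close>, while its
  translate by \<open>z\<close>, namely \<open>h(s + z) (- s\<^sub>j/z\<^sub>j)\<^sup>m\<^sup>+\<^sup>1\<close>, has coefficients of order \<open>\<bar>z\<bar>\<^sup>-\<^sup>1\<close>.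
  Universal vectors then come from Baire's theorem on a compact polydisc of coefficient sequences.
\<close>

subsection \<open>Translation of Taylor coefficients\<close>

text \<open>\<open>X\<close> need not be Baire or complete, so mixing alone need not give universal
  vectors, and series cannot be summed by completeness of \<open>X\<close>. Series converge in the
  \<open>F\<close>-space inside \<open>X\<close> instead, and Baire's theorem is applied to
  coefficient sequences, before the synthesis map. Two weights govern the estimates. A series with
  coefficients \<open>d\<close> converges when \<open>\<kappa> \<alpha> * norm (d \<alpha>)\<close>
  is bounded, while the coordinates of a vector in \<open>U\<close> are only bounded by
  \<open>\<eta> \<alpha>\<close>. Since \<open>\<kappa> \<alpha> * \<eta> \<alpha> \<ge> 1\<close>,
  a vector need not have a coordinate series, and only the difference between its translated and its
  original coordinates is synthesised. That difference involves
  \<open>\<eta> (\<alpha> + \<gamma>)\<close> for nonzero \<open>\<gamma>\<close> alone. Rescaling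
  \<open>y\<close> by \<open>\<kappa>\<close> and \<open>\<phi>\<close> by
  \<open>1 / \<kappa>\<close> keeps biorthogonality and leaves the growth of \<open>\<kappa>\<close>
  free; as \<open>\<alpha> + \<gamma>\<close> has larger total degree than \<open>\<alpha>\<close>,
  fast growth in the degree makes \<open>\<kappa> \<alpha> * \<eta> (\<alpha> + \<gamma>)\<close>
  summable. The monomials \<open>z^\<gamma> / \<gamma>!\<close> are bounded in
  \<open>\<gamma>\<close>, so one choice of weights serves every \<open>z\<close>.\<close>

definition divided_mon :: "'k::real_normed_field ^ 'n \<Rightarrow> ('n \<Rightarrow> nat) \<Rightarrow> 'k"
  where "divided_mon z \<gamma> = (\<Prod>i\<in>UNIV. z $ i ^ \<gamma> i / fact (\<gamma> i))"

lemma divided_mon_0 [simp]: "divided_mon z 0 = 1"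
  by (simp add: divided_mon_def)

lemma divided_mon_at_0:
  assumes "\<gamma> \<noteq> 0"
  shows "divided_mon 0 \<gamma> = 0"
proof -
  obtain i where "\<gamma> i \<noteq> 0"
    using assms by (auto simp: fun_eq_iff)
  then show ?thesis
    by (auto simp: divided_mon_def intro!: bexI[of _ i])
qed

lemma norm_divided_mon: "norm (divided_mon z \<gamma>) = divided_mon (\<chi> i. norm (z $ i)) \<gamma>"
  by (simp add: divided_mon_def prod_norm[symmetric] norm_divide norm_power)

text \<open>Each factor is a single term of the exponential series of \<open>norm (z $ i)\<close>.
  The bound is uniform in \<open>\<gamma>\<close>, which is why the weights can be chosen without
  reference to \<open>z\<close>.\<close>

lemma norm_divided_mon_le_exp: "norm (divided_mon z \<gamma>) \<le> exp (\<Sum>i\<in>UNIV. norm (z $ i))"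
proof -
  have "(\<Prod>i\<in>UNIV. norm (z $ i) ^ \<gamma> i / fact (\<gamma> i)) \<le> (\<Prod>i\<in>UNIV. exp (norm (z $ i)))"
  proof (rule prod_mono, intro conjI)
    fix i
    have "norm (z $ i) ^ \<gamma> i / fact (\<gamma> i) = (\<Sum>n\<in>{\<gamma> i}. norm (z $ i) ^ n /\<^sub>R fact n)"
      by (simp add: divide_inverse)
    also have "\<dots> \<le> (\<Sum>n. norm (z $ i) ^ n /\<^sub>R fact n)"
      by (rule sum_le_suminf) (use summable_exp[of "norm (z $ i)"] in \<open>auto simp: divide_inverse\<close>)
    finally show "norm (z $ i) ^ \<gamma> i / fact (\<gamma> i) \<le> exp (norm (z $ i))"
      by (simp add: exp_def)
  qed auto
  then show ?thesis
    by (simp add: norm_divided_mon exp_sum) (simp add: divided_mon_def)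
qed

text \<open>A nonzero multi-index contributes at least one coordinate of \<open>z\<close>, and all
  other factors are at most 1. This gives the rate \<open>norm z\<close> behind uniform
  continuity.\<close>

lemma norm_divided_mon_le_norm:
  assumes "norm z \<le> 1" "\<gamma> \<noteq> 0"
  shows "norm (divided_mon z \<gamma>) \<le> norm z"
proof -
  obtain i where i: "\<gamma> i \<noteq> 0"
    using assms by (auto simp: fun_eq_iff)
  have le: "norm (z $ j) \<le> norm z" for j
    by (rule Finite_Cartesian_Product.norm_nth_le)
  have fact: "norm (z $ j) ^ \<gamma> j / fact (\<gamma> j) \<le> norm (z $ j) ^ \<gamma> j" for j
    using mult_right_mono[OF fact_ge_1, of "norm (z $ j) ^ \<gamma> j" "\<gamma> j"] by (simp add: field_simps)
  have one: "norm (z $ j) ^ \<gamma> j / fact (\<gamma> j) \<le> 1" for j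
    using le[of j] assms(1) by (intro order_trans[OF fact] power_le_one) auto
  have "norm (z $ i) ^ \<gamma> i \<le> norm (z $ i) ^ 1"
    using le[of i] assms(1) i by (intro power_decreasing) auto
  then have "norm (z $ i) ^ \<gamma> i / fact (\<gamma> i) \<le> norm z"
    using fact[of i] le[of i] by simp
  moreover have "(\<Prod>j\<in>UNIV-{i}. norm (z $ j) ^ \<gamma> j / fact (\<gamma> j)) \<le> 1"
    using one by (intro prod_le_1) auto
  ultimately have "norm (z $ i) ^ \<gamma> i / fact (\<gamma> i) *
      (\<Prod>j\<in>UNIV-{i}. norm (z $ j) ^ \<gamma> j / fact (\<gamma> j)) \<le> norm z * 1"
    by (intro mult_mono) (auto intro: prod_nonneg)
  then show ?thesis
    unfolding norm_divided_mon by (simp add: divided_mon_def prod.remove[of UNIV i])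
qed

lemma finite_multi_index_le [simp, intro]: "finite {\<gamma>. \<gamma> \<le> (\<epsilon> :: 'n::finite \<Rightarrow> nat)}"
proof -
  have "{\<gamma>. \<gamma> \<le> \<epsilon>} = PiE UNIV (\<lambda>i. {..\<epsilon> i})"
    by (auto simp: le_fun_def PiE_def)
  then show ?thesis by (simp add: finite_PiE)
qed

text \<open>This is the binomial theorem in every coordinate, read off from the multiplication law
  of the exponential series and multiplied out.\<close>

lemma divided_mon_add:
  fixes s t :: "'k::{real_normed_field,banach} ^ 'n"
  shows "(\<Sum>\<gamma> | \<gamma> \<le> \<epsilon>. divided_mon s \<gamma> * divided_mon t (\<epsilon> - \<gamma>)) = divided_mon (s + t) \<epsilon>"
proof -
  have eq: "{\<gamma>. \<gamma> \<le> \<epsilon>} = PiE UNIV (\<lambda>i. {..\<epsilon> i})"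
    by (auto simp: le_fun_def PiE_def)
  have scale: "x ^ n / fact n = x ^ n /\<^sub>R fact n" for x :: 'k and n
    by (simp add: scaleR_conv_of_real divide_inverse)
  have "divided_mon (s + t) \<epsilon> =
      (\<Prod>i\<in>UNIV. \<Sum>n\<le>\<epsilon> i. (s $ i ^ n / fact n) * (t $ i ^ (\<epsilon> i - n) / fact (\<epsilon> i - n)))"
    unfolding divided_mon_def scale
    by (intro prod.cong refl) (simp add: exp_series_add_commuting mult.commute)
  also have "\<dots> = (\<Sum>\<gamma> | \<gamma> \<le> \<epsilon>. divided_mon s \<gamma> * divided_mon t (\<epsilon> - \<gamma>))"
    unfolding divided_mon_def eq
    by (subst prod_sum_PiE) (auto simp del: times_divide_times_eq simp flip: prod.distrib)
  finally show ?thesis by simp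
qed

text \<open>An infinite sum takes the value 0 when it does not converge, so the expected identities
  are proved only for dominated sequences or for sequences of bounded degree.\<close>

definition taylor_shift ::
    "'k::real_normed_field ^ 'n \<Rightarrow> (('n \<Rightarrow> nat) \<Rightarrow> 'k) \<Rightarrow> ('n \<Rightarrow> nat) \<Rightarrow> 'k"
  where "taylor_shift z d \<alpha> = (\<Sum>\<^sub>\<infinity>\<gamma>. divided_mon z \<gamma> * d (\<alpha> + \<gamma>))"

lemma taylor_shift_0 [simp]: "taylor_shift 0 d = d"
proof
  fix \<alpha>
  have "taylor_shift 0 d \<alpha> = (\<Sum>\<^sub>\<infinity>\<gamma>\<in>{0}. divided_mon 0 \<gamma> * d (\<alpha> + \<gamma>))"
    unfolding taylor_shift_def by (rule infsum_cong_neutral) (auto simp: divided_mon_at_0)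
  then show "taylor_shift 0 d \<alpha> = d \<alpha>" by simp
qed

lemma insert_compl_zero: "insert 0 (-{0}) = (UNIV :: ('n \<Rightarrow> nat) set)"
  by auto

locale shift_weights =
  fixes \<kappa> \<eta> :: "('n::finite \<Rightarrow> nat) \<Rightarrow> real"
  assumes kappa_ge1: "1 \<le> \<kappa> \<alpha>"
    and kappa_eta: "1 \<le> \<kappa> \<alpha> * \<eta> \<alpha>"
    and tails_summable: "(\<lambda>(\<alpha>, \<gamma>). \<kappa> \<alpha> * \<eta> (\<alpha> + \<gamma>)) summable_on (UNIV \<times> -{0})"
begin

definition dominated :: "real \<Rightarrow> (('n \<Rightarrow> nat) \<Rightarrow> 'k::real_normed_vector) \<Rightarrow> bool"
  where "dominated p d \<longleftrightarrow> (\<forall>\<beta>. norm (d \<beta>) \<le> p * \<eta> \<beta>)"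

definition tail :: "('n \<Rightarrow> nat) \<Rightarrow> real"
  where "tail \<alpha> = \<kappa> \<alpha> * (\<Sum>\<^sub>\<infinity>\<gamma>\<in>-{0}. \<eta> (\<alpha> + \<gamma>))"

lemma kappa_pos: "0 < \<kappa> \<alpha>"
  using kappa_ge1[of \<alpha>] by linarith

lemma eta_pos: "0 < \<eta> \<alpha>"
  using kappa_eta[of \<alpha>] kappa_pos[of \<alpha>] by (smt (verit) mult_nonneg_nonpos)

lemma eta_tail_summable: "(\<lambda>\<gamma>. \<eta> (\<alpha> + \<gamma>)) summable_on -{0}"
proof -
  have "(\<lambda>\<gamma>. \<kappa> \<alpha> * \<eta> (\<alpha> + \<gamma>)) summable_on -{0}"
    using tails_summable by (rule summable_on_SigmaD1) auto
  then show ?thesis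
    using kappa_pos[of \<alpha>] by (simp add: summable_on_cmult_right')
qed

lemma eta_summable: "(\<lambda>\<gamma>. \<eta> (\<alpha> + \<gamma>)) summable_on UNIV"
  using summable_on_insert_iff[of "\<lambda>\<gamma>. \<eta> (\<alpha> + \<gamma>)" 0 "-{0}"] eta_tail_summable[of \<alpha>]
by (simp add: insert_compl_zero)

lemma tail_summable: "tail summable_on UNIV"
proof -
  have "(\<lambda>\<alpha>. \<Sum>\<^sub>\<infinity>\<gamma>\<in>-{0}. \<kappa> \<alpha> * \<eta> (\<alpha> + \<gamma>)) summable_on UNIV"
    by (rule summable_on_Sigma_banach) (rule tails_summable)
  then show ?thesis
    unfolding tail_def by (simp add: infsum_cmult_right')
qed

lemma tail_nonneg: "0 \<le> tail \<alpha>"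
  unfolding tail_def using kappa_pos[of \<alpha>] eta_pos by (intro mult_nonneg_nonneg infsum_nonneg) (auto intro: less_imp_le)

lemma dominated_nonneg: "dominated p d \<Longrightarrow> 0 \<le> p"
  unfolding dominated_def using eta_pos by (metis norm_ge_zero order_trans zero_le_mult_iff less_le_not_le)

lemma abs_summable_shift:
  fixes d :: "('n \<Rightarrow> nat) \<Rightarrow> 'k::real_normed_field"
  assumes "dominated p d"
  shows "(\<lambda>\<gamma>. norm (divided_mon z \<gamma> * d (\<alpha> + \<gamma>))) summable_on A"
proof -
  let ?E = "exp (\<Sum>i\<in>UNIV. norm (z $ i))"
  have "(\<lambda>\<gamma>. ?E * (p * \<eta> (\<alpha> + \<gamma>))) summable_on A"
    by (intro summable_on_cmult_right summable_on_subset[OF eta_summable subset_UNIV])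
  then show ?thesis
  proof (rule Infinite_Sum.abs_summable_on_comparison_test')
    show "norm (divided_mon z \<gamma> * d (\<alpha> + \<gamma>)) \<le> ?E * (p * \<eta> (\<alpha> + \<gamma>))" for \<gamma>
      unfolding norm_mult using assms
      by (intro mult_mono norm_divided_mon_le_exp) (auto simp: dominated_def)
  qed
qed

lemma taylor_shift_diff:
  fixes d :: "('n \<Rightarrow> nat) \<Rightarrow> 'k::{real_normed_field,banach}"
  assumes "dominated p d"
  shows "taylor_shift z d \<alpha> - d \<alpha> = (\<Sum>\<^sub>\<infinity>\<gamma>\<in>-{0}. divided_mon z \<gamma> * d (\<alpha> + \<gamma>))"
proof -
  have "taylor_shift z d \<alpha> = (\<Sum>\<^sub>\<infinity>\<gamma>\<in>insert 0 (-{0}). divided_mon z \<gamma> * d (\<alpha> + \<gamma>))"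
    unfolding taylor_shift_def by (simp add: insert_compl_zero)
  also have "\<dots> = d \<alpha> + (\<Sum>\<^sub>\<infinity>\<gamma>\<in>-{0}. divided_mon z \<gamma> * d (\<alpha> + \<gamma>))"
    by (subst infsum_insert) (auto intro: abs_summable_summable abs_summable_shift[OF assms])
  finally show ?thesis by simp
qed

text \<open>The central estimate: removing the identity turns growth \<open>\<eta>\<close> into
  decay against \<open>\<kappa>\<close>. It is applied with an exponential \<open>e\<close> for
  arbitrary \<open>z\<close>, and with \<open>e = norm z\<close> for small \<open>z\<close>.\<close>

lemma taylor_shift_diff_le:
  fixes d :: "('n \<Rightarrow> nat) \<Rightarrow> 'k::{real_normed_field,banach}"
  assumes d: "dominated p d" and e: "\<And>\<gamma>. \<gamma> \<noteq> 0 \<Longrightarrow> norm (divided_mon z \<gamma>) \<le> e"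
  shows "\<kappa> \<alpha> * norm (taylor_shift z d \<alpha> - d \<alpha>) \<le> e * p * tail \<alpha>"
proof -
  have "norm (taylor_shift z d \<alpha> - d \<alpha>) \<le> (\<Sum>\<^sub>\<infinity>\<gamma>\<in>-{0}. e * p * \<eta> (\<alpha> + \<gamma>))"
    unfolding taylor_shift_diff[OF d]
  proof (rule norm_infsum_le[OF has_sum_infsum has_sum_infsum])
    show "(\<lambda>\<gamma>. divided_mon z \<gamma> * d (\<alpha> + \<gamma>)) summable_on - {0}"
      by (rule abs_summable_summable[OF abs_summable_shift[OF d]])
    show "(\<lambda>\<gamma>. e * p * \<eta> (\<alpha> + \<gamma>)) summable_on - {0}"
      by (intro summable_on_cmult_right eta_tail_summable)
    fix \<gamma> :: "'n \<Rightarrow> nat" assume "\<gamma> \<in> -{0}"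
    then have "norm (divided_mon z \<gamma>) * norm (d (\<alpha> + \<gamma>)) \<le> e * (p * \<eta> (\<alpha> + \<gamma>))"
      using d by (intro mult_mono e) (auto simp: dominated_def intro: order_trans[OF norm_ge_zero e])
    then show "norm (divided_mon z \<gamma> * d (\<alpha> + \<gamma>)) \<le> e * p * \<eta> (\<alpha> + \<gamma>)"
      by (simp add: norm_mult mult.assoc)
  qed
  also have "\<dots> = e * p * (\<Sum>\<^sub>\<infinity>\<gamma>\<in>-{0}. \<eta> (\<alpha> + \<gamma>))"
    by (rule infsum_cmult_right')
  finally show ?thesis
    using mult_left_mono[OF _ less_imp_le[OF kappa_pos[of \<alpha>]]] unfolding tail_def
    by (metis mult.left_commute)
qed

lemma tail_bounded: "\<exists>B>0. \<forall>\<alpha>. tail \<alpha> \<le> B"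
proof -
  have "tail \<alpha> \<le> infsum tail UNIV" for \<alpha>
    using finite_sum_le_infsum[OF tail_summable, of "{\<alpha>}"] tail_nonneg by auto
  then show ?thesis
    by (intro exI[of _ "infsum tail UNIV + 1"]) (smt (verit) tail_nonneg)
qed

text \<open>The correction is at most a constant over \<open>\<kappa> \<alpha>\<close>, and
  \<open>1 / \<kappa> \<alpha> \<le> \<eta> \<alpha>\<close> by \<open>kappa_eta\<close>, so it
  stays within growth \<open>\<eta>\<close>.\<close>

lemma dominated_taylor_shift:
  fixes d :: "('n \<Rightarrow> nat) \<Rightarrow> 'k::{real_normed_field,banach}"
  assumes "dominated p d"
  shows "\<exists>q. dominated q (taylor_shift z d)"
proof -
  define e where "e = exp (\<Sum>i\<in>UNIV. norm (z $ i))"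
  obtain B where B: "B > 0" "\<And>\<alpha>. tail \<alpha> \<le> B"
    using tail_bounded by blast
  have "norm (taylor_shift z d \<alpha>) \<le> (p + e * p * B) * \<eta> \<alpha>" for \<alpha>
  proof -
    have "\<kappa> \<alpha> * norm (taylor_shift z d \<alpha> - d \<alpha>) \<le> e * p * tail \<alpha>"
      unfolding e_def by (rule taylor_shift_diff_le[OF assms norm_divided_mon_le_exp])
    also have "\<dots> \<le> e * p * B"
      using B dominated_nonneg[OF assms] by (intro mult_left_mono) (auto simp: e_def)
    also have "\<dots> \<le> e * p * B * (\<kappa> \<alpha> * \<eta> \<alpha>)"
      using kappa_eta[of \<alpha>] B dominated_nonneg[OF assms] mult_left_mono[of 1 "\<kappa> \<alpha> * \<eta> \<alpha>" "e * p * B"]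
      by (auto simp: e_def)
    finally have "norm (taylor_shift z d \<alpha> - d \<alpha>) \<le> e * p * B * \<eta> \<alpha>"
      using kappa_pos[of \<alpha>] by (simp add: ac_simps)
    moreover have "norm (d \<alpha>) \<le> p * \<eta> \<alpha>"
      using assms by (simp add: dominated_def)
    ultimately show ?thesis
      using norm_triangle_sub[of "taylor_shift z d \<alpha>" "d \<alpha>"] by (simp add: algebra_simps)
  qed
  then show ?thesis unfolding dominated_def by blast
qed

text \<open>The double sum over \<open>\<gamma>\<close> and \<open>\<delta>\<close> is regrouped
  along \<open>\<epsilon> = \<gamma> + \<delta>\<close>, and each group collapses by the binomial
  identity. Absolute convergence of the regrouped family justifies the exchange.\<close>

lemma taylor_shift_add:
  fixes d :: "('n \<Rightarrow> nat) \<Rightarrow> 'k::{real_normed_field,banach}"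
  assumes d: "dominated p d"
  shows "taylor_shift s (taylor_shift t d) = taylor_shift (s + t) d"
proof
  fix \<alpha>
  define f where "f = (\<lambda>(\<epsilon>, \<gamma>). divided_mon s \<gamma> * divided_mon t (\<epsilon> - \<gamma>) * d (\<alpha> + \<epsilon>))"
  define g where "g = (\<lambda>(\<gamma>, \<delta>). divided_mon s \<gamma> * (divided_mon t \<delta> * d (\<alpha> + \<gamma> + \<delta>)))"
  let ?S = "SIGMA \<epsilon>:UNIV. {\<gamma>. \<gamma> \<le> \<epsilon>}"
  have "(\<lambda>x. norm (f x)) summable_on ?S"
    unfolding Infinite_Sum.abs_summable_on_Sigma_iff
  proof (intro conjI ballI)
    \<comment> \<open>The binomial identity for the real vectors of moduli sums the absolute values
      of a group exactly. The resulting series converges by the earlier summability result for the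
      real sequence of norms of \<open>d\<close>, which is dominated as well.\<close>
    let ?u = "(\<chi> i. norm (s $ i)) + (\<chi> i. norm (t $ i)) :: real ^ 'n"
    have "(\<Sum>\<^sub>\<infinity>\<gamma>\<in>{\<gamma>. \<gamma> \<le> \<epsilon>}. norm (f (\<epsilon>, \<gamma>))) = norm (divided_mon ?u \<epsilon> * norm (d (\<alpha> + \<epsilon>)))" for \<epsilon>
    proof -
      have "(\<Sum>\<gamma> | \<gamma> \<le> \<epsilon>. norm (f (\<epsilon>, \<gamma>))) = divided_mon ?u \<epsilon> * norm (d (\<alpha> + \<epsilon>))"
        unfolding divided_mon_add[symmetric] sum_distrib_right f_def
        by (simp add: norm_mult norm_divided_mon)
      moreover have "0 \<le> (\<Sum>\<gamma> | \<gamma> \<le> \<epsilon>. norm (f (\<epsilon>, \<gamma>)))"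
        by (intro sum_nonneg) auto
      ultimately show ?thesis by simp
    qed
    moreover have "(\<lambda>\<epsilon>. norm (divided_mon ?u \<epsilon> * norm (d (\<alpha> + \<epsilon>)))) summable_on UNIV"
      using d by (intro abs_summable_shift[of p]) (auto simp: dominated_def)
    ultimately show "(\<lambda>\<epsilon>. norm (\<Sum>\<^sub>\<infinity>\<gamma>\<in>{\<gamma>. \<gamma> \<le> \<epsilon>}. norm (f (\<epsilon>, \<gamma>)))) summable_on UNIV"
      by simp
  qed auto
  then have f: "f summable_on ?S"
    by (rule abs_summable_summable)
  have bij: "infsum g (UNIV \<times> UNIV) = infsum f ?S" "g summable_on UNIV \<times> UNIV \<longleftrightarrow> f summable_on ?S"
     apply (rule infsum_reindex_bij_witness[where j = "\<lambda>(\<gamma>, \<delta>). (\<gamma> + \<delta>, \<gamma>)" and i = "\<lambda>(\<epsilon>, \<gamma>). (\<gamma>, \<epsilon> - \<gamma>)"];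
       force simp: f_def g_def le_fun_def fun_eq_iff add.assoc)
    apply (rule summable_on_reindex_bij_witness[where j = "\<lambda>(\<gamma>, \<delta>). (\<gamma> + \<delta>, \<gamma>)" and i = "\<lambda>(\<epsilon>, \<gamma>). (\<gamma>, \<epsilon> - \<gamma>)"];
       force simp: f_def g_def le_fun_def fun_eq_iff add.assoc)
    done
  have "taylor_shift s (taylor_shift t d) \<alpha> = (\<Sum>\<^sub>\<infinity>\<gamma>. \<Sum>\<^sub>\<infinity>\<delta>. g (\<gamma>, \<delta>))"
    by (simp add: taylor_shift_def g_def infsum_cmult_right')
  also have "\<dots> = infsum f ?S"
    using f bij infsum_Sigma_banach[of g UNIV "\<lambda>_. UNIV"] by simp
  also have "\<dots> = (\<Sum>\<^sub>\<infinity>\<epsilon>. \<Sum>\<gamma> | \<gamma> \<le> \<epsilon>. f (\<epsilon>, \<gamma>))"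
    using f by (simp flip: infsum_Sigma_banach)
  also have "\<dots> = taylor_shift (s + t) d \<alpha>"
    by (simp add: taylor_shift_def f_def divided_mon_add flip: sum_distrib_right)
  finally show "taylor_shift s (taylor_shift t d) \<alpha> = taylor_shift (s + t) d \<alpha>" .
qed

end

subsection \<open>Mixing of the translations\<close>

definition total_degree :: "('n::finite \<Rightarrow> nat) \<Rightarrow> nat"
  where "total_degree \<alpha> = (\<Sum>i\<in>UNIV. \<alpha> i)"

lemma total_degree_add: "total_degree (\<alpha> + \<beta>) = total_degree \<alpha> + total_degree \<beta>"
  by (simp add: total_degree_def sum.distrib)

lemma le_total_degree: "\<alpha> i \<le> total_degree \<alpha>"
  unfolding total_degree_def by (rule member_le_sum) auto

lemma finite_total_degree_le [simp, intro]: "finite {\<alpha> :: 'n::finite \<Rightarrow> nat. total_degree \<alpha> \<le> M}"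
proof (rule finite_subset)
  show "{\<alpha>. total_degree \<alpha> \<le> M} \<subseteq> {\<alpha>. \<alpha> \<le> (\<lambda>_::'n. M)}"
    using le_total_degree order_trans by (fastforce simp: le_fun_def)
qed auto

definition degree_le :: "nat \<Rightarrow> (('n::finite \<Rightarrow> nat) \<Rightarrow> 'k::zero) \<Rightarrow> bool"
  where "degree_le M d \<longleftrightarrow> (\<forall>\<alpha>. M < total_degree \<alpha> \<longrightarrow> d \<alpha> = 0)"

lemma degree_leD: "degree_le M d \<Longrightarrow> M < total_degree \<alpha> \<Longrightarrow> d \<alpha> = 0"
  by (simp add: degree_le_def)

lemma degree_le_mono: "degree_le M d \<Longrightarrow> M \<le> N \<Longrightarrow> degree_le N d"
  by (auto simp: degree_le_def)

lemma degree_le_add: "degree_le M c \<Longrightarrow> degree_le M d \<Longrightarrow> degree_le M (\<lambda>\<alpha>. c \<alpha> + d \<alpha> :: 'k::monoid_add)"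
  by (auto simp: degree_le_def)

lemma finite_support_imp_degree_le:
  fixes d :: "('n::finite \<Rightarrow> nat) \<Rightarrow> 'k::zero"
  assumes "finite {\<alpha>. d \<alpha> \<noteq> 0}"
  shows "\<exists>M. degree_le M d"
proof -
  have "finite (total_degree ` {\<alpha>. d \<alpha> \<noteq> 0})" using assms by simp
  then obtain M where "\<forall>n \<in> total_degree ` {\<alpha>. d \<alpha> \<noteq> 0}. n \<le> M"
    using finite_nat_set_iff_bounded_le by blast
  then show ?thesis
    by (intro exI[of _ M]) (force simp: degree_le_def)
qed

lemma degree_le_bounded:
  fixes d :: "('n::finite \<Rightarrow> nat) \<Rightarrow> 'k::real_normed_vector"
  assumes "degree_le M d"
  shows "\<exists>K\<ge>0. \<forall>\<alpha>. norm (d \<alpha>) \<le> K"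
proof (intro exI conjI allI)
  let ?K = "\<Sum>\<alpha> | total_degree \<alpha> \<le> M. norm (d \<alpha>)"
  show "0 \<le> ?K" by (simp add: sum_nonneg)
  show "norm (d \<alpha>) \<le> ?K" for \<alpha>
  proof (cases "total_degree \<alpha> \<le> M")
    case True
    then show ?thesis by (intro member_le_sum) auto
  next
    case False
    then show ?thesis using degree_leD[OF assms, of \<alpha>] by (simp add: sum_nonneg)
  qed
qed

lemma degree_le_taylor_shift:
  assumes "degree_le M d"
  shows "degree_le M (taylor_shift z d)"
  unfolding degree_le_def taylor_shift_def
  by (auto intro!: infsum_0 degree_leD[OF assms] simp: total_degree_add)

lemma taylor_shift_eq_sum:
  assumes "degree_le M d"
  shows "taylor_shift z d \<alpha> = (\<Sum>\<gamma> | total_degree \<gamma> \<le> M. divided_mon z \<gamma> * d (\<alpha> + \<gamma>))"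
proof -
  have "taylor_shift z d \<alpha> = (\<Sum>\<^sub>\<infinity>\<gamma> | total_degree \<gamma> \<le> M. divided_mon z \<gamma> * d (\<alpha> + \<gamma>))"
    unfolding taylor_shift_def
    by (rule infsum_cong_neutral) (auto simp: degree_leD[OF assms] total_degree_add)
  then show ?thesis by simp
qed

lemma taylor_shift_plus:
  assumes "degree_le M c" "degree_le M d"
  shows "taylor_shift z (\<lambda>\<alpha>. c \<alpha> + d \<alpha>) = (\<lambda>\<alpha>. taylor_shift z c \<alpha> + taylor_shift z d \<alpha>)"
  using assms by (simp add: fun_eq_iff taylor_shift_eq_sum[of M] degree_le_add sum.distrib distrib_left)

section \<open>Multiplication by a coordinate and its commutation with translation\<close>

definition unit_index :: "'n \<Rightarrow> 'n \<Rightarrow> nat"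
  where "unit_index j = (\<lambda>i. if i = j then 1 else 0)"

lemma total_degree_unit_index [simp]: "total_degree (unit_index j) = 1"
  by (simp add: total_degree_def unit_index_def)

lemma unit_index_cancel: "\<alpha> j \<noteq> 0 \<Longrightarrow> \<alpha> - unit_index j + unit_index j = \<alpha>"
  by (auto simp: fun_eq_iff unit_index_def)

lemma divided_mon_unit:
  "of_nat (Suc (\<gamma> j)) * divided_mon z (\<gamma> + unit_index j) = z $ j * divided_mon z \<gamma>"
proof -
  have rest: "(\<Prod>i\<in>UNIV - {j}. z $ i ^ (\<gamma> + unit_index j) i / fact ((\<gamma> + unit_index j) i)) =
      (\<Prod>i\<in>UNIV - {j}. z $ i ^ \<gamma> i / fact (\<gamma> i))" (is "?P' = ?P")
    by (intro prod.cong) (auto simp: unit_index_def)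
  have j: "(\<gamma> + unit_index j) j = Suc (\<gamma> j)"
    by (simp add: unit_index_def)
  have factor: "of_nat (Suc (\<gamma> j)) * (z $ j ^ Suc (\<gamma> j) / fact (Suc (\<gamma> j))) = z $ j * (z $ j ^ \<gamma> j / fact (\<gamma> j))"
    unfolding fact_Suc by (simp del: of_nat_Suc)
  have "of_nat (Suc (\<gamma> j)) * divided_mon z (\<gamma> + unit_index j) =
      of_nat (Suc (\<gamma> j)) * (z $ j ^ Suc (\<gamma> j) / fact (Suc (\<gamma> j))) * ?P"
    unfolding divided_mon_def prod.remove[of UNIV j, OF finite UNIV_I] rest j by (rule mult.assoc[symmetric])
  also have "\<dots> = z $ j * divided_mon z \<gamma>"
    unfolding divided_mon_def prod.remove[of UNIV j, OF finite UNIV_I] factor by (rule mult.assoc)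
  finally show ?thesis .
qed

text \<open>In terms of the function with Taylor coefficients \<open>d\<close> this is multiplication by the
  coordinate with index \<open>j\<close>.\<close>

definition mult_coord :: "'n \<Rightarrow> (('n \<Rightarrow> nat) \<Rightarrow> 'k::real_normed_field) \<Rightarrow> ('n \<Rightarrow> nat) \<Rightarrow> 'k"
  where "mult_coord j d \<alpha> = of_nat (\<alpha> j) * d (\<alpha> - unit_index j)"

lemma degree_le_mult_coord:
  assumes "degree_le M d"
  shows "degree_le (Suc M) (mult_coord j d)"
  unfolding degree_le_def
proof (intro allI impI)
  fix \<alpha> :: "'a \<Rightarrow> nat" assume *: "Suc M < total_degree \<alpha>"
  show "mult_coord j d \<alpha> = 0"
  proof (cases "\<alpha> j = 0")
    case False
    then have "total_degree \<alpha> = total_degree (\<alpha> - unit_index j) + 1"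
      using total_degree_add[of "\<alpha> - unit_index j" "unit_index j"] by (simp add: unit_index_cancel)
    then show ?thesis
      using * degree_leD[OF assms] by (simp add: mult_coord_def)
  qed (simp add: mult_coord_def)
qed

lemma norm_mult_coord_le:
  assumes "degree_le M d" "\<And>\<alpha>. norm (d \<alpha>) \<le> K"
  shows "norm (mult_coord j d \<alpha>) \<le> real (Suc M) * K"
proof (cases "total_degree \<alpha> \<le> Suc M")
  case True
  then have "real (\<alpha> j) \<le> real (Suc M)"
    using le_total_degree[of \<alpha> j] by linarith
  then have "real (\<alpha> j) * norm (d (\<alpha> - unit_index j)) \<le> real (Suc M) * K"
    using assms(2) by (intro mult_mono) auto
  then show ?thesis
    by (simp add: mult_coord_def norm_mult)
next
  case False
  then show ?thesis
    using degree_leD[OF degree_le_mult_coord[OF assms(1)], of \<alpha> j] order_trans[OF norm_ge_zero assms(2)] by simp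
qed

text \<open>The coefficient form of \<open>(s + z)_j h(s + z) = s_j h(s + z) + z_j h(s + z)\<close>.
  The factor \<open>(\<alpha> + \<gamma>) j\<close> splits into \<open>\<alpha> j\<close>, which
  gives the first term, and \<open>\<gamma> j\<close>, which gives the second.\<close>

lemma taylor_shift_mult_coord:
  fixes d :: "('n::finite \<Rightarrow> nat) \<Rightarrow> 'k::real_normed_field"
  assumes "degree_le M d"
  shows "taylor_shift z (mult_coord j d) \<alpha> = mult_coord j (taylor_shift z d) \<alpha> + z $ j * taylor_shift z d \<alpha>"
proof -
  let ?D = "{\<gamma>. total_degree \<gamma> \<le> Suc M}" and ?u = "unit_index j"
  have "taylor_shift z (mult_coord j d) \<alpha> =
      (\<Sum>\<gamma>\<in>?D. divided_mon z \<gamma> * mult_coord j d (\<alpha> + \<gamma>))"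
    by (rule taylor_shift_eq_sum[OF degree_le_mult_coord[OF assms]])
  also have "\<dots> = (\<Sum>\<gamma>\<in>?D. divided_mon z \<gamma> * (of_nat (\<alpha> j) * d (\<alpha> + \<gamma> - ?u))) +
      (\<Sum>\<gamma>\<in>?D. divided_mon z \<gamma> * (of_nat (\<gamma> j) * d (\<alpha> + \<gamma> - ?u)))"
    by (simp add: mult_coord_def algebra_simps sum.distrib)
  also have "(\<Sum>\<gamma>\<in>?D. divided_mon z \<gamma> * (of_nat (\<alpha> j) * d (\<alpha> + \<gamma> - ?u))) = mult_coord j (taylor_shift z d) \<alpha>"
  proof (cases "\<alpha> j = 0")
    case False
    have "\<alpha> + \<gamma> - ?u = \<alpha> - ?u + \<gamma>" for \<gamma>
      using False by (auto simp: fun_eq_iff unit_index_def)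
    then show ?thesis
      unfolding mult_coord_def taylor_shift_eq_sum[OF degree_le_mono[OF assms le_SucI[OF order_refl]]]
      by (simp add: sum_distrib_left mult.left_commute)
  qed (simp add: mult_coord_def)
  \<comment> \<open>Terms with \<open>\<gamma> j = 0\<close> vanish; on the others the index is
    lowered by one in direction \<open>j\<close>, where the factor \<open>\<gamma> j\<close> cancels
    against the factorial and a factor \<open>z $ j\<close> comes out.\<close>
  also have "(\<Sum>\<gamma>\<in>?D. divided_mon z \<gamma> * (of_nat (\<gamma> j) * d (\<alpha> + \<gamma> - ?u))) =
      (\<Sum>\<gamma>\<in>{\<gamma>\<in>?D. \<gamma> j \<noteq> 0}. divided_mon z \<gamma> * (of_nat (\<gamma> j) * d (\<alpha> + \<gamma> - ?u)))"
    by (rule sum.mono_neutral_right) auto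
  also have "\<dots> = (\<Sum>\<gamma> | total_degree \<gamma> \<le> M. z $ j * (divided_mon z \<gamma> * d (\<alpha> + \<gamma>)))"
  proof (rule sum.reindex_bij_witness[where i = "\<lambda>\<gamma>. \<gamma> + ?u" and j = "\<lambda>\<gamma>. \<gamma> - ?u"])
    fix \<gamma> assume \<gamma>: "\<gamma> \<in> {\<gamma>\<in>?D. \<gamma> j \<noteq> 0}"
    then show cancel: "\<gamma> - ?u + ?u = \<gamma>"
      by (simp add: unit_index_cancel)
    have "total_degree \<gamma> = total_degree (\<gamma> - ?u) + 1"
      using total_degree_add[of "\<gamma> - ?u" ?u] cancel by simp
    then show "\<gamma> - ?u \<in> {\<gamma>. total_degree \<gamma> \<le> M}"
      using \<gamma> by simp
    have "of_nat (\<gamma> j) * divided_mon z \<gamma> = z $ j * divided_mon z (\<gamma> - ?u)"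
      using divided_mon_unit[of "\<gamma> - ?u" j z] \<gamma> cancel by (simp add: unit_index_def del: of_nat_Suc)
    moreover have "\<alpha> + \<gamma> - ?u = \<alpha> + (\<gamma> - ?u)"
      using \<gamma> by (auto simp: fun_eq_iff unit_index_def)
    ultimately show "z $ j * (divided_mon z (\<gamma> - ?u) * d (\<alpha> + (\<gamma> - ?u))) =
        divided_mon z \<gamma> * (of_nat (\<gamma> j) * d (\<alpha> + \<gamma> - ?u))"
      by (metis mult.assoc mult.commute)
  next
    fix \<gamma> :: "'n \<Rightarrow> nat" assume "\<gamma> \<in> {\<gamma>. total_degree \<gamma> \<le> M}"
    then show "\<gamma> + ?u \<in> {\<gamma>\<in>?D. \<gamma> j \<noteq> 0}"
      by (simp add: total_degree_add) (simp add: unit_index_def)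
    show "\<gamma> + ?u - ?u = \<gamma>"
      by (rule add_diff_cancel_right')
  qed
  also have "\<dots> = z $ j * taylor_shift z d \<alpha>"
    by (simp add: taylor_shift_eq_sum[OF assms] sum_distrib_left)
  finally show ?thesis .
qed

lemma norm_divided_mon_le_power:
  assumes "1 \<le> \<zeta>" "\<And>i. norm (z $ i) \<le> \<zeta>"
  shows "norm (divided_mon z \<gamma>) \<le> \<zeta> ^ total_degree \<gamma>"
proof -
  have "norm (z $ i) ^ \<gamma> i / fact (\<gamma> i) \<le> \<zeta> ^ \<gamma> i" for i
  proof -
    have "norm (z $ i) ^ \<gamma> i * 1 \<le> \<zeta> ^ \<gamma> i * fact (\<gamma> i)"
      using assms by (intro mult_mono power_mono) (auto simp: fact_ge_1)
    then show ?thesis by (simp add: field_simps)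
  qed
  then have "(\<Prod>i\<in>UNIV. norm (z $ i) ^ \<gamma> i / fact (\<gamma> i)) \<le> (\<Prod>i\<in>UNIV. \<zeta> ^ \<gamma> i)"
    by (intro prod_mono) auto
  then show ?thesis
    unfolding norm_divided_mon by (simp add: divided_mon_def total_degree_def power_sum)
qed

text \<open>For a polynomial the translate grows only like a power of \<open>\<zeta>\<close> given
  by its degree; this replaces the exponential bound, which no fixed number of cutoff factors could
  beat.\<close>

lemma norm_taylor_shift_le:
  fixes d :: "('n::finite \<Rightarrow> nat) \<Rightarrow> 'k::real_normed_field"
  assumes "degree_le M d" "\<And>\<alpha>. norm (d \<alpha>) \<le> K" "1 \<le> \<zeta>" "\<And>i. norm (z $ i) \<le> \<zeta>"
  shows "norm (taylor_shift z d \<alpha>) \<le> real (card {\<gamma> :: 'n \<Rightarrow> nat. total_degree \<gamma> \<le> M}) * (\<zeta> ^ M * K)"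
  unfolding taylor_shift_eq_sum[OF assms(1)]
proof (rule sum_norm_bound)
  fix \<gamma> :: "'n \<Rightarrow> nat" assume "\<gamma> \<in> {\<gamma>. total_degree \<gamma> \<le> M}"
  then have "norm (divided_mon z \<gamma>) \<le> \<zeta> ^ M"
    using norm_divided_mon_le_power[OF assms(3,4), where \<gamma>=\<gamma>] power_increasing[OF _ assms(3), of "total_degree \<gamma>" M]
    by (force intro: order_trans)
  then show "norm (divided_mon z \<gamma> * d (\<alpha> + \<gamma>)) \<le> \<zeta> ^ M * K"
    unfolding norm_mult using assms(2,3) by (intro mult_mono) auto
qed

text \<open>With \<open>\<lambda>(s) = s\<^sub>j / z\<^sub>j\<close>, these are multiplication by \<open>-\<lambda>\<close> and by \<open>1 - \<lambda>\<close>.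
  Translation by \<open>z\<close> turns \<open>1 - \<lambda>\<close> into \<open>-\<lambda>\<close>.\<close>

definition small_factor :: "'n \<Rightarrow> 'k::real_normed_field \<Rightarrow> (('n \<Rightarrow> nat) \<Rightarrow> 'k) \<Rightarrow> ('n \<Rightarrow> nat) \<Rightarrow> 'k"
  where "small_factor j c d \<alpha> = - (mult_coord j d \<alpha> / c)"

definition cutoff_factor :: "'n \<Rightarrow> 'k::real_normed_field \<Rightarrow> (('n \<Rightarrow> nat) \<Rightarrow> 'k) \<Rightarrow> ('n \<Rightarrow> nat) \<Rightarrow> 'k"
  where "cutoff_factor j c d \<alpha> = d \<alpha> + small_factor j c d \<alpha>"

lemma degree_le_small_factor: "degree_le M d \<Longrightarrow> degree_le (Suc M) (small_factor j c d)"
  using degree_le_mult_coord[of M d j] by (auto simp: degree_le_def small_factor_def)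

lemma degree_le_cutoff_factor: "degree_le M d \<Longrightarrow> degree_le (Suc M) (cutoff_factor j c d)"
  unfolding cutoff_factor_def by (intro degree_le_add degree_le_small_factor) (auto elim: degree_le_mono)

lemma norm_small_factor_le:
  assumes "degree_le M d" "\<And>\<alpha>. norm (d \<alpha>) \<le> K"
  shows "norm (small_factor j c d \<alpha>) \<le> real (Suc M) * K / norm c"
  using norm_mult_coord_le[OF assms, of j \<alpha>]
  by (simp add: small_factor_def norm_divide divide_right_mono)

lemma taylor_shift_cutoff_factor:
  fixes d :: "('n::finite \<Rightarrow> nat) \<Rightarrow> 'k::real_normed_field"
  assumes "degree_le M d" "z $ j \<noteq> 0"
  shows "taylor_shift z (cutoff_factor j (z $ j) d) = small_factor j (z $ j) (taylor_shift z d)"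
proof
  fix \<alpha>
  have "taylor_shift z (cutoff_factor j (z $ j) d) \<alpha> =
      taylor_shift z d \<alpha> + taylor_shift z (small_factor j (z $ j) d) \<alpha>"
    unfolding cutoff_factor_def
    by (subst taylor_shift_plus[of "Suc M"])
      (auto intro: degree_le_small_factor assms degree_le_mono[OF assms(1)])
  also have "taylor_shift z (small_factor j (z $ j) d) \<alpha> = - (taylor_shift z (mult_coord j d) \<alpha> / z $ j)"
    by (simp add: taylor_shift_eq_sum[OF degree_le_small_factor[OF assms(1)]]
      taylor_shift_eq_sum[OF degree_le_mult_coord[OF assms(1)]] small_factor_def sum_negf sum_divide_distrib)
  also have "taylor_shift z d \<alpha> + \<dots> = small_factor j (z $ j) (taylor_shift z d) \<alpha>"
    using assms(2) by (simp add: taylor_shift_mult_coord[OF assms(1)] small_factor_def add_divide_distrib)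
  finally show "taylor_shift z (cutoff_factor j (z $ j) d) \<alpha> = small_factor j (z $ j) (taylor_shift z d) \<alpha>" .
qed

section \<open>Size of iterated cutoffs\<close>

lemma degree_le_cutoff_power: "degree_le M d \<Longrightarrow> degree_le (M + n) ((cutoff_factor j c ^^ n) d)"
  by (induction n) (auto intro: degree_le_cutoff_factor)

lemma degree_le_small_power: "degree_le M d \<Longrightarrow> degree_le (M + n) ((small_factor j c ^^ n) d)"
  by (induction n) (auto intro: degree_le_small_factor)

lemma taylor_shift_cutoff_power:
  fixes d :: "('n::finite \<Rightarrow> nat) \<Rightarrow> 'k::real_normed_field"
  assumes "degree_le M d" "z $ j \<noteq> 0"
  shows "taylor_shift z ((cutoff_factor j (z $ j) ^^ n) d) = (small_factor j (z $ j) ^^ n) (taylor_shift z d)"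
  by (induction n) (simp_all add: taylor_shift_cutoff_factor[OF degree_le_cutoff_power[OF assms(1)] assms(2)])

lemma norm_small_power_le:
  assumes "degree_le M d" "\<And>\<alpha>. norm (d \<alpha>) \<le> K"
  shows "norm ((small_factor j c ^^ n) d \<alpha>) \<le> real (M + n) ^ n * K / norm c ^ n"
proof -
  have K: "0 \<le> K" by (rule order_trans[OF norm_ge_zero assms(2)])
  \<comment> \<open>With the final \<open>n\<close> fixed, every intermediate degree is at most
    \<open>M + n\<close>, so each of the \<open>m\<close> steps costs the same factor
    \<open>(M + n) / norm c\<close>.\<close>
  have "norm ((small_factor j c ^^ m) d \<alpha>) \<le> real (M + n) ^ m * K / norm c ^ m" if "m \<le> n" for m \<alpha>
    using that
  proof (induction m arbitrary: \<alpha>)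
    case 0
    then show ?case using assms by simp
  next
    case (Suc m)
    have "norm ((small_factor j c ^^ Suc m) d \<alpha>) \<le>
        real (Suc (M + m)) * (real (M + n) ^ m * K / norm c ^ m) / norm c"
      using norm_small_factor_le[OF degree_le_small_power[OF assms(1)] Suc.IH] Suc.prems by simp
    also have "\<dots> \<le> real (M + n) * (real (M + n) ^ m * K / norm c ^ m) / norm c"
      using Suc.prems K by (intro divide_right_mono mult_right_mono) auto
    finally show ?case by (simp add: mult_ac)
  qed
  then show ?thesis by blast
qed

text \<open>Each factor changes the sequence by its size times \<open>O(1 / norm c)\<close>, and
  \<open>1 \<le> norm c\<close> keeps all iterates bounded. The constant must not depend on
  \<open>j\<close>, \<open>c\<close> or \<open>\<alpha>\<close>, since \<open>c\<close> will be a
  coordinate of \<open>z\<close>.\<close>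

lemma cutoff_power_close:
  fixes d :: "('n::finite \<Rightarrow> nat) \<Rightarrow> 'k::real_normed_field"
  assumes "degree_le M d"
  shows "\<exists>C\<ge>0. \<forall>j c \<alpha>. 1 \<le> norm c \<longrightarrow> norm ((cutoff_factor j c ^^ n) d \<alpha> - d \<alpha>) \<le> C / norm c"
proof (induction n)
  case 0
  show ?case by (intro exI[of _ 0]) simp
next
  case (Suc n)
  then obtain C where C: "0 \<le> C"
      "\<And>j c \<alpha>. 1 \<le> norm c \<Longrightarrow> norm ((cutoff_factor j c ^^ n) d \<alpha> - d \<alpha>) \<le> C / norm c" by blast
  obtain K where K: "0 \<le> K" "\<And>\<alpha>. norm (d \<alpha>) \<le> K"
    using degree_le_bounded[OF assms] by blast
  have "norm ((cutoff_factor j c ^^ Suc n) d \<alpha> - d \<alpha>) \<le> (C + real (Suc (M + n)) * (K + C)) / norm c"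
    if c: "1 \<le> norm c" for j \<alpha> and c :: 'k
  proof -
    let ?g = "(cutoff_factor j c ^^ n) d"
    have "norm (?g \<alpha>) \<le> K + C" for \<alpha>
    proof -
      have "C / norm c \<le> C" using c C(1) by (simp add: divide_le_eq mult_left_mono[of 1 "norm c" C, simplified])
      then show ?thesis
        using C(2)[OF c, of j \<alpha>] K(2)[of \<alpha>] norm_triangle_sub[of "?g \<alpha>" "d \<alpha>"] by linarith
    qed
    then have "norm (small_factor j c ?g \<alpha>) \<le> real (Suc (M + n)) * (K + C) / norm c"
      by (rule norm_small_factor_le[OF degree_le_cutoff_power[OF assms]])
    moreover have eq: "(cutoff_factor j c ^^ Suc n) d \<alpha> - d \<alpha> = (?g \<alpha> - d \<alpha>) + small_factor j c ?g \<alpha>"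
      by (simp add: cutoff_factor_def)
    ultimately show ?thesis
      unfolding eq add_divide_distrib
      using C(2)[OF c, of j \<alpha>] norm_triangle_ineq[of "?g \<alpha> - d \<alpha>" "small_factor j c ?g \<alpha>"]
      by linarith
  qed
  then show ?case
    using C(1) K(1) by (intro exI[of _ "C + real (Suc (M + n)) * (K + C)"]) auto
qed

text \<open>The degree bound and the constant are chosen before \<open>z\<close>. Thus only finitely
  many values of \<open>\<kappa>\<close> matter later, however large \<open>z\<close>
  becomes.\<close>

lemma exists_cutoff:
  fixes d :: "('n::finite \<Rightarrow> nat) \<Rightarrow> 'k::real_normed_field"
  assumes d: "degree_le m d"
  shows "\<exists>M C. 0 \<le> C \<and> (\<forall>z j. 1 \<le> norm (z $ j) \<longrightarrow> (\<forall>i. norm (z $ i) \<le> norm (z $ j)) \<longrightarrow>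
    (\<exists>F. degree_le M F \<and> (\<forall>\<alpha>. norm (F \<alpha> - d \<alpha>) \<le> C / norm (z $ j)) \<and>
      (\<forall>\<alpha>. norm (taylor_shift z F \<alpha>) \<le> C / norm (z $ j))))"
proof -
  obtain C where C: "0 \<le> C" "\<And>j c \<alpha>. 1 \<le> norm c \<Longrightarrow>
      norm ((cutoff_factor j c ^^ Suc m) d \<alpha> - d \<alpha>) \<le> C / norm c"
    using cutoff_power_close[OF d] by blast
  obtain K where K: "0 \<le> K" "\<And>\<alpha>. norm (d \<alpha>) \<le> K"
    using degree_le_bounded[OF d] by blast
  define N where "N = real (card {\<gamma> :: 'n \<Rightarrow> nat. total_degree \<gamma> \<le> m})"
  define C' where "C' = real (m + Suc m) ^ Suc m * (N * K)"
  have C': "0 \<le> C'" using K by (simp add: C'_def N_def)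
  have "norm (taylor_shift z ((cutoff_factor j (z $ j) ^^ Suc m) d) \<alpha>) \<le> C' / norm (z $ j)"
    if z: "1 \<le> norm (z $ j)" "\<And>i. norm (z $ i) \<le> norm (z $ j)" for z :: "'k ^ 'n" and j \<alpha>
  proof -
    have "z $ j \<noteq> 0" using z(1) by auto
    then have "norm (taylor_shift z ((cutoff_factor j (z $ j) ^^ Suc m) d) \<alpha>) \<le>
        real (m + Suc m) ^ Suc m * (N * (norm (z $ j) ^ m * K)) / norm (z $ j) ^ Suc m"
      unfolding taylor_shift_cutoff_power[OF d \<open>z $ j \<noteq> 0\<close>] N_def
      by (intro norm_small_power_le degree_le_taylor_shift d norm_taylor_shift_le K z)
    \<comment> \<open>Of the \<open>m + 1\<close> divisions by \<open>z $ j\<close>,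
      \<open>m\<close> compensate the growth of the translate of a polynomial of degree
      \<open>m\<close>, and one is left over.\<close>
    also have "\<dots> = C' / norm (z $ j)"
      using \<open>z $ j \<noteq> 0\<close> by (simp add: C'_def)
    finally show ?thesis .
  qed
  note shift = this
  show ?thesis
  proof (intro exI[of _ "m + Suc m"] exI[of _ "C + C'"] conjI allI impI)
    show "0 \<le> C + C'" using C(1) C' by simp
    fix z :: "'k ^ 'n" and j
    assume z: "1 \<le> norm (z $ j)" "\<forall>i. norm (z $ i) \<le> norm (z $ j)"
    have mono: "C / norm (z $ j) \<le> (C + C') / norm (z $ j)" "C' / norm (z $ j) \<le> (C + C') / norm (z $ j)"
      using C(1) C' by (simp_all add: divide_right_mono)
    show "\<exists>F. degree_le (m + Suc m) F \<and> (\<forall>\<alpha>. norm (F \<alpha> - d \<alpha>) \<le> (C + C') / norm (z $ j)) \<and>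
      (\<forall>\<alpha>. norm (taylor_shift z F \<alpha>) \<le> (C + C') / norm (z $ j))"
      using z by (intro exI[of _ "(cutoff_factor j (z $ j) ^^ Suc m) d"] conjI allI degree_le_cutoff_power d
        order_trans[OF C(2) mono(1)] order_trans[OF shift mono(2)]) auto
  qed
qed

lemma exists_max_coord:
  fixes z :: "'k::real_normed_field ^ 'n"
  shows "\<exists>j. (\<forall>i. norm (z $ i) \<le> norm (z $ j)) \<and> norm z \<le> CARD('n) * norm (z $ j)"
proof -
  have fin: "finite (range (\<lambda>i. norm (z $ i)))" by simp
  then have "Max (range (\<lambda>i. norm (z $ i))) \<in> range (\<lambda>i. norm (z $ i))"
    by (rule Max_in) simp
  then obtain j where "norm (z $ j) = Max (range (\<lambda>i. norm (z $ i)))" by (metis (mono_tags) imageE)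
  then have j: "norm (z $ i) \<le> norm (z $ j)" for i
    using fin by simp
  have "norm z \<le> (\<Sum>i\<in>UNIV. norm (z $ i))"
    unfolding norm_vec_def by (rule L2_set_le_sum) simp
  also have "\<dots> \<le> CARD('n) * norm (z $ j)"
    using j by (intro sum_bounded_above[of UNIV "\<lambda>i. norm (z $ i)"]) auto
  finally show ?thesis using j by blast
qed

context shift_weights
begin

lemma degree_le_dominated:
  fixes d :: "('n \<Rightarrow> nat) \<Rightarrow> 'k::real_normed_vector"
  assumes "degree_le M d"
  shows "\<exists>p. dominated p d"
proof -
  have "degree_le M (\<lambda>\<alpha>. norm (d \<alpha>) / \<eta> \<alpha>)"
    using assms by (auto simp: degree_le_def)
  from degree_le_bounded[OF this] obtain K where K: "\<And>\<alpha>. norm (norm (d \<alpha>) / \<eta> \<alpha>) \<le> K"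
    by blast
  have "norm (d \<alpha>) \<le> K * \<eta> \<alpha>" for \<alpha>
    using K[of \<alpha>] eta_pos[of \<alpha>] by (simp add: pos_divide_le_eq)
  then show ?thesis unfolding dominated_def by blast
qed

text \<open>The witness is \<open>F + S_(-z) G\<close> for cutoffs \<open>F\<close> of
  \<open>p\<close> at \<open>z\<close> and \<open>G\<close> of \<open>q\<close> at
  \<open>-z\<close>. Near zero translation the second summand is negligible, and after translation
  by \<open>z\<close> the first is, while \<open>S_z S_(-z) G = G\<close>. The degree
  \<open>M\<close> precedes \<open>\<epsilon>\<close>, so unweighted closeness can later be upgraded
  to weighted closeness.\<close>

lemma taylor_shift_mixing:
  fixes p q :: "('n \<Rightarrow> nat) \<Rightarrow> 'k::{real_normed_field,banach}"
  assumes "finite {\<alpha>. p \<alpha> \<noteq> 0}" "finite {\<alpha>. q \<alpha> \<noteq> 0}"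
  shows "\<exists>M. degree_le M p \<and> degree_le M q \<and> (\<forall>\<epsilon>>0. \<exists>r>0. \<forall>z. r < norm z \<longrightarrow>
    (\<exists>w. degree_le M w \<and> (\<forall>\<alpha>. norm (w \<alpha> - p \<alpha>) < \<epsilon>) \<and> (\<forall>\<alpha>. norm (taylor_shift z w \<alpha> - q \<alpha>) < \<epsilon>)))"
proof -
  obtain m1 m2 where m: "degree_le m1 p" "degree_le m2 q"
    using assms finite_support_imp_degree_le by metis
  obtain M1 C1 where 1: "0 \<le> C1" "\<And>z j. 1 \<le> norm (z $ j) \<Longrightarrow> (\<And>i. norm (z $ i) \<le> norm (z $ j)) \<Longrightarrow>
    (\<exists>F. degree_le M1 F \<and> (\<forall>\<alpha>. norm (F \<alpha> - p \<alpha>) \<le> C1 / norm (z $ j)) \<and>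
      (\<forall>\<alpha>. norm (taylor_shift z F \<alpha>) \<le> C1 / norm (z $ j)))"
    using exists_cutoff[OF m(1)] by metis
  obtain M2 C2 where 2: "0 \<le> C2" "\<And>z j. 1 \<le> norm (z $ j) \<Longrightarrow> (\<And>i. norm (z $ i) \<le> norm (z $ j)) \<Longrightarrow>
    (\<exists>F. degree_le M2 F \<and> (\<forall>\<alpha>. norm (F \<alpha> - q \<alpha>) \<le> C2 / norm (z $ j)) \<and>
      (\<forall>\<alpha>. norm (taylor_shift z F \<alpha>) \<le> C2 / norm (z $ j)))"
    using exists_cutoff[OF m(2)] by metis
  define M where "M = Max {m1, m2, M1, M2}"
  have M: "m1 \<le> M" "m2 \<le> M" "M1 \<le> M" "M2 \<le> M" by (auto simp: M_def)
  have main: "\<exists>r>0. \<forall>z. r < norm z \<longrightarrow>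
    (\<exists>w. degree_le M w \<and> (\<forall>\<alpha>. norm (w \<alpha> - p \<alpha>) < \<epsilon>) \<and> (\<forall>\<alpha>. norm (taylor_shift z w \<alpha> - q \<alpha>) < \<epsilon>))"
    if "0 < \<epsilon>" for \<epsilon> :: real
  \<comment> \<open>Beyond this radius the largest coordinate exceeds
    \<open>1 + (C1 + C2) / \<epsilon>\<close>, so the cutoffs apply and their two errors together
    stay below \<open>\<epsilon>\<close>.\<close>
  proof (intro exI[of _ "CARD('n) * (1 + (C1 + C2) / \<epsilon>)"] conjI allI impI)
    show "0 < CARD('n) * (1 + (C1 + C2) / \<epsilon>)"
      using 1(1) 2(1) that by (simp add: add_pos_nonneg)
    fix z :: "'k ^ 'n" assume z: "CARD('n) * (1 + (C1 + C2) / \<epsilon>) < norm z"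
    obtain j where j: "\<And>i. norm (z $ i) \<le> norm (z $ j)" "norm z \<le> CARD('n) * norm (z $ j)"
      using exists_max_coord by blast
    have "real CARD('n) * (1 + (C1 + C2) / \<epsilon>) < real CARD('n) * norm (z $ j)"
      using z j(2) by linarith
    then have big: "1 + (C1 + C2) / \<epsilon> < norm (z $ j)"
      by simp
    have "0 \<le> (C1 + C2) / \<epsilon>" using 1(1) 2(1) that by simp
    then have ge1: "1 \<le> norm (z $ j)" using big by linarith
    have "C1 + C2 < norm (z $ j) * \<epsilon>"
      using big pos_divide_less_eq[OF that, of "C1 + C2" "norm (z $ j)"] by linarith
    moreover have "0 < norm (z $ j)" using ge1 by linarith
    ultimately have small: "C1 / norm (z $ j) + C2 / norm (z $ j) < \<epsilon>"
      unfolding add_divide_distrib[symmetric] by (subst pos_divide_less_eq) (simp_all add: mult.commute)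
    obtain F where F: "degree_le M1 F" "\<And>\<alpha>. norm (F \<alpha> - p \<alpha>) \<le> C1 / norm (z $ j)"
        "\<And>\<alpha>. norm (taylor_shift z F \<alpha>) \<le> C1 / norm (z $ j)"
      using 1(2)[OF ge1 j(1)] by blast
    obtain G where G: "degree_le M2 G" "\<And>\<alpha>. norm (G \<alpha> - q \<alpha>) \<le> C2 / norm (z $ j)"
        "\<And>\<alpha>. norm (taylor_shift (- z) G \<alpha>) \<le> C2 / norm (z $ j)"
      using 2(2)[of "- z" j] ge1 j(1) by auto
    have FG: "degree_le M F" "degree_le M (taylor_shift (- z) G)"
      using F(1) G(1) M by (auto intro: degree_le_taylor_shift degree_le_mono)
    obtain b where "dominated b G"
      using degree_le_dominated[OF G(1)] by blast
    then have inv: "taylor_shift z (taylor_shift (- z) G) = G"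
      by (simp add: taylor_shift_add)
    show "\<exists>w. degree_le M w \<and> (\<forall>\<alpha>. norm (w \<alpha> - p \<alpha>) < \<epsilon>) \<and> (\<forall>\<alpha>. norm (taylor_shift z w \<alpha> - q \<alpha>) < \<epsilon>)"
    proof (intro exI[of _ "\<lambda>\<alpha>. F \<alpha> + taylor_shift (- z) G \<alpha>"] conjI allI)
      fix \<alpha>
      have "norm ((F \<alpha> - p \<alpha>) + taylor_shift (- z) G \<alpha>) < \<epsilon>"
        using F(2)[of \<alpha>] G(3)[of \<alpha>] small norm_triangle_ineq[of "F \<alpha> - p \<alpha>" "taylor_shift (- z) G \<alpha>"] by linarith
      then show "norm (F \<alpha> + taylor_shift (- z) G \<alpha> - p \<alpha>) < \<epsilon>"
        by (simp add: algebra_simps)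
      have "norm (taylor_shift z F \<alpha> + (G \<alpha> - q \<alpha>)) < \<epsilon>"
        using F(3)[of \<alpha>] G(2)[of \<alpha>] small norm_triangle_ineq[of "taylor_shift z F \<alpha>" "G \<alpha> - q \<alpha>"] by linarith
      then show "norm (taylor_shift z (\<lambda>\<alpha>. F \<alpha> + taylor_shift (- z) G \<alpha>) \<alpha> - q \<alpha>) < \<epsilon>"
        by (simp add: taylor_shift_plus[OF FG] inv add_diff_eq)
    qed (intro degree_le_add FG)
  qed
  show ?thesis
    by (rule exI[of _ M]) (use m M main in \<open>auto elim: degree_le_mono\<close>)
qed

end

subsection \<open>Universal coefficient sequences\<close>

lemma finite_uniform_pos:
  assumes "finite D" "\<And>x. x \<in> D \<Longrightarrow> 0 < (f x :: real)"
  shows "\<exists>e>0. \<forall>x\<in>D. e \<le> f x"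
  using assms by (intro exI[of _ "Min (insert 1 (f ` D))"]) auto

lemma summable_on_imp_finite_ge:
  fixes g :: "'i \<Rightarrow> real"
  assumes "g summable_on UNIV" "\<And>x. 0 \<le> g x" "0 < e"
  shows "finite {x. e \<le> g x}"
proof (rule ccontr)
  assume "infinite {x. e \<le> g x}"
  obtain n :: nat where n: "infsum g UNIV < real n * e"
    using reals_Archimedean3[OF assms(3)] by blast
  obtain F where F: "F \<subseteq> {x. e \<le> g x}" "finite F" "card F = n"
    using infinite_arbitrarily_large[OF \<open>infinite _\<close>] by metis
  have "real n * e \<le> sum g F"
    using sum_bounded_below[of F e g] F by auto
  also have "\<dots> \<le> infsum g UNIV"
    using assms F by (intro finite_sum_le_infsum) auto
  finally show False using n by simp
qed

text \<open>Finite association lists with values in a countable dense set are countable. The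
  approximation vanishes wherever \<open>q\<close> does, so the tolerance may depend on the index
  and tend to 0, as the weights will require.\<close>

lemma countable_approx_finite_support:
  obtains Q :: "('i::countable \<Rightarrow> 'k::{real_normed_vector,second_countable_topology}) set"
  where "countable Q" "\<And>q. q \<in> Q \<Longrightarrow> finite {i. q i \<noteq> 0}"
    "\<And>q e. finite {i. q i \<noteq> 0} \<Longrightarrow> (\<And>i. 0 < e i) \<Longrightarrow> \<exists>q'\<in>Q. \<forall>i. norm (q' i - q i) < e i"
proof -
  obtain D :: "'k set" where D: "countable D" "\<And>X. open X \<Longrightarrow> X \<noteq> {} \<Longrightarrow> \<exists>d\<in>D. d \<in> X"
    using countable_dense_setE by metis
  define list_fun where "list_fun = (\<lambda>(l :: ('i \<times> 'k) list) i. case map_of l i of None \<Rightarrow> 0 | Some c \<Rightarrow> c)"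
  define Q where "Q = list_fun ` lists (UNIV \<times> D)"
  show ?thesis
  proof (rule that)
    show "countable Q" unfolding Q_def using D(1) by (intro countable_image countable_lists) auto
    show "finite {i. q i \<noteq> 0}" if q: "q \<in> Q" for q
    proof -
      obtain l where "q = list_fun l" using q unfolding Q_def by blast
      then have "{i. q i \<noteq> 0} \<subseteq> dom (map_of l)"
        by (auto simp: list_fun_def split: option.splits)
      then show ?thesis using finite_dom_map_of finite_subset by blast
    qed
    fix q :: "'i \<Rightarrow> 'k" and e :: "'i \<Rightarrow> real"
    assume fin: "finite {i. q i \<noteq> 0}" and e: "\<And>i. 0 < e i"
    have "\<exists>d\<in>D. d \<in> ball (q i) (e i)" for i
      using D(2)[of "ball (q i) (e i)"] e[of i] by auto
    then obtain d where d: "\<And>i. d i \<in> D" "\<And>i. dist (q i) (d i) < e i"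
      by (metis mem_ball)
    obtain l where l: "set l = {i. q i \<noteq> 0}" using fin finite_list by metis
    have "list_fun (map (\<lambda>i. (i, d i)) l) i = (if q i \<noteq> 0 then d i else 0)" for i
      using l by (auto simp: list_fun_def map_of_map_restrict restrict_map_def)
    moreover have "list_fun (map (\<lambda>i. (i, d i)) l) \<in> Q"
      unfolding Q_def using d(1) by (intro imageI) (auto simp: in_lists_conv_set)
    ultimately show "\<exists>q'\<in>Q. \<forall>i. norm (q' i - q i) < e i"
      using d(2) e by (intro bexI[of _ "list_fun (map (\<lambda>i. (i, d i)) l)"]) (auto simp: dist_norm norm_minus_commute)
  qed
qed

lemma compact_polydisc: "compact {a :: 'i \<Rightarrow> 'k::{real_normed_vector,heine_borel}. \<forall>i. norm (a i) \<le> \<theta> i}"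
proof -
  have eq: "{a :: 'i \<Rightarrow> 'k. \<forall>i. norm (a i) \<le> \<theta> i} = PiE UNIV (\<lambda>i. cball 0 (\<theta> i))"
    by (auto simp: PiE_def)
  have "compactin (product_topology (\<lambda>i. euclidean) UNIV) (PiE UNIV (\<lambda>i. cball (0::'k) (\<theta> i :: real)))"
    unfolding compactin_PiE by simp
  then show ?thesis
    unfolding eq euclidean_product_topology compactin_euclidean_iff .
qed

text \<open>A closed polydisc is compact and Hausdorff in the product topology, so Baire's theorem
  holds there whatever the target space is. Density is phrased with ambient open sets
  \<open>V\<close>, the form in which it gets verified.\<close>

lemma polydisc_Baire:
  fixes \<theta> :: "'i \<Rightarrow> real"
  defines "C \<equiv> {a :: 'i \<Rightarrow> 'k::{real_normed_vector,heine_borel}. \<forall>i. norm (a i) \<le> \<theta> i}"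
  assumes "\<And>i. 0 \<le> \<theta> i" "countable \<G>"
    and "\<And>G. G \<in> \<G> \<Longrightarrow> openin (top_of_set C) G"
    and "\<And>G V. G \<in> \<G> \<Longrightarrow> open V \<Longrightarrow> C \<inter> V \<noteq> {} \<Longrightarrow> G \<inter> V \<noteq> {}"
  shows "\<exists>a\<in>C. \<forall>G\<in>\<G>. a \<in> G"
proof -
  have compact: "compact_space (top_of_set C)"
    unfolding C_def by (rule compact_space_subtopology) (simp add: compactin_euclidean_iff compact_polydisc)
  then have "regular_space (top_of_set C)"
    by (rule compact_Hausdorff_imp_regular_space)
      (metis Hausdorff_space_euclidean Hausdorff_space_product_topology Hausdorff_space_subtopology euclidean_product_topology)
  moreover have "top_of_set C closure_of G = topspace (top_of_set C)" if G: "G \<in> \<G>" for G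
    unfolding dense_intersects_open
  proof (intro allI impI)
    fix T assume T: "openin (top_of_set C) T \<and> T \<noteq> {}"
    then obtain V where V: "open V" "T = C \<inter> V" by (auto simp: openin_open)
    have "G \<subseteq> C" using assms(4)[OF G] openin_subset by fastforce
    then show "G \<inter> T \<noteq> {}" using assms(5)[OF G V(1)] V(2) T by auto
  qed
  ultimately have dense: "top_of_set C closure_of \<Inter>\<G> = topspace (top_of_set C)"
    using compact assms by (intro Baire_category) (auto intro: compact_imp_locally_compact_space)
  \<comment> \<open>Density of the intersection yields a point only if the polydisc is
    nonempty.\<close>
  have "(\<lambda>_. 0) \<in> C" using assms by (simp add: C_def)
  then have "topspace (top_of_set C) \<noteq> {}" by auto
  then have "top_of_set C closure_of \<Inter>\<G> \<inter> topspace (top_of_set C) \<noteq> {}"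
    using dense by simp
  then have "C \<inter> \<Inter>\<G> \<noteq> {}"
    by (metis closure_of_empty closure_of_restrict inf.idem inf_bot_left topspace_euclidean_subtopology)
  then show ?thesis by auto
qed

section \<open>Open and dense approximation conditions on a polydisc\<close>

context shift_weights
begin

text \<open>The product topology controls finitely many coordinates only; the common bound by
  \<open>p * \<eta>\<close> makes the partial sums converge uniformly on \<open>C\<close>, so the
  limit is continuous.\<close>

lemma continuous_on_taylor_shift:
  fixes C :: "(('n \<Rightarrow> nat) \<Rightarrow> 'k::{real_normed_field,banach}) set"
  assumes "\<And>a. a \<in> C \<Longrightarrow> dominated p a"
  shows "continuous_on C (\<lambda>a. taylor_shift z a \<alpha>)"
proof (rule uniform_limit_theorem)
  let ?E = "exp (\<Sum>i\<in>UNIV. norm (z $ i))"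
  show "uniform_limit C (\<lambda>X a. \<Sum>\<gamma>\<in>X. divided_mon z \<gamma> * a (\<alpha> + \<gamma>)) (\<lambda>a. taylor_shift z a \<alpha>)
      (finite_subsets_at_top UNIV)"
    unfolding taylor_shift_def
  proof (rule Weierstrass_m_test_general)
    show "(\<lambda>\<gamma>. ?E * (p * \<eta> (\<alpha> + \<gamma>))) summable_on UNIV"
      by (intro summable_on_cmult_right eta_summable)
    show "norm (divided_mon z \<gamma> * a (\<alpha> + \<gamma>)) \<le> ?E * (p * \<eta> (\<alpha> + \<gamma>))" if "a \<in> C" for \<gamma> a
      unfolding norm_mult using assms[OF that]
      by (intro mult_mono norm_divided_mon_le_exp) (auto simp: dominated_def)
  qed
  show "\<forall>\<^sub>F X in finite_subsets_at_top UNIV. continuous_on C (\<lambda>a. \<Sum>\<gamma>\<in>X. divided_mon z \<gamma> * a (\<alpha> + \<gamma>))"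
    by (intro always_eventually allI continuous_intros)
      (rule continuous_on_subset[OF continuous_on_product_coordinates subset_UNIV])
qed simp

text \<open>Infinitely many conditions are imposed, one for each \<open>\<alpha>\<close>, yet the
  set is open: a summable majorant makes all but finitely many of them automatic throughout
  \<open>C\<close>. This is why the polydisc is cut out with a summable \<open>b\<close>.\<close>

lemma openin_shift_close:
  fixes C :: "(('n \<Rightarrow> nat) \<Rightarrow> 'k::{real_normed_field,banach}) set"
  assumes C: "\<And>a \<alpha>. a \<in> C \<Longrightarrow> \<kappa> \<alpha> * norm (a \<alpha>) \<le> b \<alpha>"
    and b: "b summable_on UNIV" "\<And>\<alpha>. b \<alpha> \<le> 1"
    and q: "finite {\<alpha>. q \<alpha> \<noteq> 0}" and \<epsilon>: "0 < \<epsilon>"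
  shows "openin (top_of_set C) {a \<in> C. \<forall>\<alpha>. \<kappa> \<alpha> * norm (taylor_shift z a \<alpha> - q \<alpha>) < \<epsilon>}"
proof (cases "C = {}")
  case False
  define E where "E = exp (\<Sum>i\<in>UNIV. norm (z $ i))"
  \<comment> \<open>Bounds \<open>\<kappa> \<alpha> * norm (taylor_shift z a \<alpha>)\<close> for
    all \<open>a\<close> in \<open>C\<close>: the tail covers the correction, with domination
    constant 1, and \<open>b\<close> covers \<open>a\<close> itself.\<close>
  define g where "g \<alpha> = E * 1 * tail \<alpha> + b \<alpha>" for \<alpha>
  have "0 \<le> b \<alpha>" for \<alpha>
  proof -
    obtain a where "a \<in> C" using False by blast
    then show ?thesis
      using C[of a \<alpha>] kappa_pos[of \<alpha>] by (smt (verit) mult_nonneg_nonneg norm_ge_zero)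
  qed
  then have g: "g summable_on UNIV" "0 \<le> g \<alpha>" for \<alpha>
    unfolding g_def by (auto intro!: summable_on_add summable_on_cmult_right tail_summable b add_nonneg_nonneg
      mult_nonneg_nonneg tail_nonneg simp: E_def)
  define D where "D = {\<alpha>. \<epsilon> \<le> g \<alpha>} \<union> {\<alpha>. q \<alpha> \<noteq> 0}"
  have "finite D"
    unfolding D_def using summable_on_imp_finite_ge[OF g \<epsilon>] q by auto
  have dom: "dominated 1 a" if "a \<in> C" for a
    unfolding dominated_def
  proof
    fix \<alpha>
    have "\<kappa> \<alpha> * norm (a \<alpha>) \<le> \<kappa> \<alpha> * \<eta> \<alpha>"
      using C[OF that, of \<alpha>] b(2)[of \<alpha>] kappa_eta[of \<alpha>] by linarith
    then show "norm (a \<alpha>) \<le> 1 * \<eta> \<alpha>" using kappa_pos[of \<alpha>] by simp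
  qed
  have out: "\<kappa> \<alpha> * norm (taylor_shift z a \<alpha> - q \<alpha>) < \<epsilon>" if "a \<in> C" "\<alpha> \<notin> D" for a \<alpha>
  proof -
    have tri: "\<kappa> \<alpha> * norm (taylor_shift z a \<alpha>) \<le> \<kappa> \<alpha> * (norm (taylor_shift z a \<alpha> - a \<alpha>) + norm (a \<alpha>))"
      using kappa_pos[of \<alpha>] norm_triangle_sub[of "taylor_shift z a \<alpha>" "a \<alpha>"]
      by (intro mult_left_mono) (auto simp: add.commute)
    have "\<kappa> \<alpha> * norm (taylor_shift z a \<alpha> - a \<alpha>) \<le> E * 1 * tail \<alpha>"
      unfolding E_def by (rule taylor_shift_diff_le[OF dom[OF that(1)] norm_divided_mon_le_exp])
    then have "\<kappa> \<alpha> * (norm (taylor_shift z a \<alpha> - a \<alpha>) + norm (a \<alpha>)) \<le> g \<alpha>"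
      using C[OF that(1), of \<alpha>] by (simp add: g_def distrib_left)
    moreover have "g \<alpha> < \<epsilon>" "q \<alpha> = 0" using that(2) by (auto simp: D_def)
    ultimately show ?thesis using tri by simp
  qed
  have "openin (top_of_set C) {a \<in> C. \<kappa> \<alpha> * norm (taylor_shift z a \<alpha> - q \<alpha>) < \<epsilon>}" for \<alpha>
  proof -
    have "continuous_on C (\<lambda>a. \<kappa> \<alpha> * norm (taylor_shift z a \<alpha> - q \<alpha>))"
      using continuous_on_taylor_shift[OF dom] by (intro continuous_intros)
    from continuous_openin_preimage_gen[OF this open_lessThan[of \<epsilon>]]
    show ?thesis by (simp add: vimage_def Int_def)
  qed
  then have "openin (top_of_set C) (topspace (top_of_set C) \<inter> (\<Inter>\<alpha>\<in>D. {a \<in> C. \<kappa> \<alpha> * norm (taylor_shift z a \<alpha> - q \<alpha>) < \<epsilon>}))"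
    using \<open>finite D\<close> by (intro openin_Int_Inter) auto
  also have "topspace (top_of_set C) \<inter> (\<Inter>\<alpha>\<in>D. {a \<in> C. \<kappa> \<alpha> * norm (taylor_shift z a \<alpha> - q \<alpha>) < \<epsilon>}) =
      {a \<in> C. \<forall>\<alpha>. \<kappa> \<alpha> * norm (taylor_shift z a \<alpha> - q \<alpha>) < \<epsilon>}"
    using out by auto
  finally show ?thesis .
qed simp

text \<open>Density of the approximation sets: a point of \<open>C \<inter> V\<close> is replaced by
  a finitely supported one with room around it, to which mixing of the translations applies.\<close>

lemma exists_shift_close:
  fixes C :: "(('n \<Rightarrow> nat) \<Rightarrow> 'k::{real_normed_field,banach}) set"
  assumes C: "C = {a. \<forall>\<alpha>. norm (a \<alpha>) \<le> \<theta> \<alpha>}" and \<theta>: "\<And>\<alpha>. 0 < \<theta> \<alpha>"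
    and V: "open V" "C \<inter> V \<noteq> {}" and q: "finite {\<alpha>. q \<alpha> \<noteq> 0}" and \<epsilon>: "0 < \<epsilon>"
  shows "\<exists>r. \<forall>z. r < norm z \<longrightarrow>
    (\<exists>w \<in> C \<inter> V. \<forall>\<alpha>. \<kappa> \<alpha> * norm (taylor_shift z w \<alpha> - q \<alpha>) < \<epsilon>)"
proof -
  obtain b where b: "b \<in> C" "b \<in> V" using V(2) by blast
  have "openin (product_topology (\<lambda>i. euclidean) UNIV) V"
    using V(1) by (simp add: euclidean_product_topology)
  from product_topology_open_contains_basis[OF this b(2)]
  obtain X where X: "b \<in> PiE UNIV X" "\<And>\<alpha>. open (X \<alpha>)" "finite {\<alpha>. X \<alpha> \<noteq> UNIV}" "PiE UNIV X \<subseteq> V"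
    by auto
  \<comment> \<open>The given point may lie on the boundary of the polydisc. Moving each coordinate
    to the open disc leaves space for the perturbation \<open>w\<close> to stay in
    \<open>C\<close>.\<close>
  have "\<exists>c. c \<in> X \<alpha> \<inter> ball 0 (\<theta> \<alpha>)" for \<alpha>
  proof -
    have "b \<alpha> \<in> closure (ball 0 (\<theta> \<alpha>))"
      using b(1) \<theta>[of \<alpha>] by (simp add: C)
    moreover have "b \<alpha> \<in> X \<alpha>" using X(1) by auto
    ultimately have "X \<alpha> \<inter> ball 0 (\<theta> \<alpha>) \<noteq> {}"
      using open_Int_closure_eq_empty[OF X(2)] by blast
    then show ?thesis by blast
  qed
  then obtain c where c: "\<And>\<alpha>. c \<alpha> \<in> X \<alpha> \<inter> ball 0 (\<theta> \<alpha>)" by metis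
  define p where "p \<alpha> = (if X \<alpha> \<noteq> UNIV then c \<alpha> else 0)" for \<alpha>
  have p: "p \<alpha> \<in> X \<alpha> \<inter> ball 0 (\<theta> \<alpha>)" for \<alpha>
    using c[of \<alpha>] \<theta>[of \<alpha>] by (auto simp: p_def)
  have "finite {\<alpha>. p \<alpha> \<noteq> 0}"
    by (rule finite_subset[OF _ X(3)]) (auto simp: p_def)
  from taylor_shift_mixing[OF this q]
  obtain M where M: "degree_le M p" "degree_le M q" "\<And>e. e > 0 \<Longrightarrow> \<exists>r>0. \<forall>z. r < norm z \<longrightarrow>
    (\<exists>w. degree_le M w \<and> (\<forall>\<alpha>. norm (w \<alpha> - p \<alpha>) < e) \<and> (\<forall>\<alpha>. norm (taylor_shift z w \<alpha> - q \<alpha>) < e))"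
    by metis
  have "\<exists>e>0. ball (p \<alpha>) e \<subseteq> X \<alpha> \<inter> ball 0 (\<theta> \<alpha>)" for \<alpha>
    using p[of \<alpha>] X(2)[of \<alpha>] open_contains_ball[of "X \<alpha> \<inter> ball 0 (\<theta> \<alpha>)"] by auto
  then obtain \<rho> where \<rho>: "\<And>\<alpha>. 0 < \<rho> \<alpha>" "\<And>\<alpha>. ball (p \<alpha>) (\<rho> \<alpha>) \<subseteq> X \<alpha> \<inter> ball 0 (\<theta> \<alpha>)"
    by metis
  \<comment> \<open>Outside this finite set \<open>w\<close> vanishes and \<open>V\<close> imposes
    nothing, so \<open>e\<close> has to meet only finitely many radii and weights.\<close>
  define D where "D = {\<alpha>. X \<alpha> \<noteq> UNIV} \<union> {\<alpha>. total_degree \<alpha> \<le> M}"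
  have "\<exists>e>0. \<forall>\<alpha>\<in>D. e \<le> min (\<rho> \<alpha>) (\<epsilon> / \<kappa> \<alpha>)"
    using X(3) \<rho>(1) \<epsilon> kappa_pos by (intro finite_uniform_pos) (auto simp: D_def)
  then obtain e where e: "0 < e" "\<And>\<alpha>. \<alpha> \<in> D \<Longrightarrow> e \<le> \<rho> \<alpha>" "\<And>\<alpha>. \<alpha> \<in> D \<Longrightarrow> e \<le> \<epsilon> / \<kappa> \<alpha>"
    by auto
  obtain r where r: "\<And>z. r < norm z \<Longrightarrow>
    (\<exists>w. degree_le M w \<and> (\<forall>\<alpha>. norm (w \<alpha> - p \<alpha>) < e) \<and> (\<forall>\<alpha>. norm (taylor_shift z w \<alpha> - q \<alpha>) < e))"
    using M(3)[OF e(1)] by blast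
  show ?thesis
  proof (intro exI[of _ r] allI impI)
    fix z :: "'k ^ 'n" assume "r < norm z"
    then obtain w where w: "degree_le M w" "\<And>\<alpha>. norm (w \<alpha> - p \<alpha>) < e"
        "\<And>\<alpha>. norm (taylor_shift z w \<alpha> - q \<alpha>) < e"
      using r by blast
    have wX: "w \<alpha> \<in> X \<alpha> \<inter> ball 0 (\<theta> \<alpha>)" for \<alpha>
    proof (cases "\<alpha> \<in> D")
      case True
      then have "w \<alpha> \<in> ball (p \<alpha>) (\<rho> \<alpha>)"
        using w(2)[of \<alpha>] e(2)[of \<alpha>] by (simp add: dist_norm norm_minus_commute)
      then show ?thesis using \<rho>(2) by blast
    next
      case False
      then show ?thesis
        using \<theta>[of \<alpha>] degree_leD[OF w(1), of \<alpha>] by (auto simp: D_def)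
    qed
    have "w \<in> C \<inter> V"
      using wX X(4) by (fastforce simp: C intro: less_imp_le)
    moreover have "\<kappa> \<alpha> * norm (taylor_shift z w \<alpha> - q \<alpha>) < \<epsilon>" for \<alpha>
    proof (cases "total_degree \<alpha> \<le> M")
      case True
      then have "norm (taylor_shift z w \<alpha> - q \<alpha>) < \<epsilon> / \<kappa> \<alpha>"
        using w(3)[of \<alpha>] e(3)[of \<alpha>] by (simp add: D_def)
      then show ?thesis
        using kappa_pos[of \<alpha>] by (simp add: pos_less_divide_eq mult.commute)
    next
      case False
      then show ?thesis
        using degree_leD[OF M(2), of \<alpha>] degree_leD[OF degree_le_taylor_shift[OF w(1)], of \<alpha>] \<epsilon> by simp
    qed
    ultimately show "\<exists>w \<in> C \<inter> V. \<forall>\<alpha>. \<kappa> \<alpha> * norm (taylor_shift z w \<alpha> - q \<alpha>) < \<epsilon>"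
      by blast
  qed
qed

text \<open>Baire's theorem is applied to the sets of sequences whose translates along
  \<open>t\<close> come within \<open>1 / (m + 1)\<close> of \<open>q\<close>, for countably many
  \<open>q\<close>. Closeness is weighted by \<open>\<kappa>\<close>, so that the synthesis map can
  transport it.\<close>

lemma exists_universal_sequence:
  fixes t :: "nat \<Rightarrow> 'k::{real_normed_field,banach,heine_borel,second_countable_topology} ^ 'n"
  assumes t: "filterlim (\<lambda>n. norm (t n)) at_top sequentially"
  shows "\<exists>a. (\<forall>\<alpha>. \<kappa> \<alpha> * norm (a \<alpha>) \<le> 1) \<and> (\<forall>q \<epsilon>. finite {\<alpha>. q \<alpha> \<noteq> 0} \<longrightarrow> 0 < \<epsilon> \<longrightarrow>
    (\<exists>n. \<forall>\<alpha>. \<kappa> \<alpha> * norm (taylor_shift (t n) a \<alpha> - q \<alpha>) < \<epsilon>))"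
proof -
  define b :: "('n \<Rightarrow> nat) \<Rightarrow> real" where "b \<alpha> = (1/2) ^ to_nat \<alpha>" for \<alpha>
  have b: "0 < b \<alpha>" "b \<alpha> \<le> 1" for \<alpha>
    by (auto simp: b_def power_le_one)
  have "(\<lambda>n. (1/2 :: real) ^ n) summable_on UNIV"
    by (subst summable_on_UNIV_nonneg_real_iff) auto
  then have "(\<lambda>n. (1/2 :: real) ^ n) summable_on range (to_nat :: ('n \<Rightarrow> nat) \<Rightarrow> nat)"
    by (rule summable_on_subset) simp
  then have "b summable_on UNIV"
    by (subst (asm) summable_on_reindex) (auto simp: b_def[abs_def] o_def)
  \<comment> \<open>With this radius
    \<open>\<kappa> \<alpha> * norm (a \<alpha>) \<le> b \<alpha>\<close> on the polydisc:
    \<open>b \<le> 1\<close> keeps its elements admissible for synthesis and summability of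
    \<open>b\<close> gives openness.\<close>
  define \<theta> where "\<theta> \<alpha> = b \<alpha> / \<kappa> \<alpha>" for \<alpha>
  have \<theta>: "0 < \<theta> \<alpha>" for \<alpha> using b(1) kappa_pos by (simp add: \<theta>_def)
  define C where "C = {a :: ('n \<Rightarrow> nat) \<Rightarrow> 'k. \<forall>\<alpha>. norm (a \<alpha>) \<le> \<theta> \<alpha>}"
  have C: "\<kappa> \<alpha> * norm (a \<alpha>) \<le> b \<alpha>" if "a \<in> C" for a \<alpha>
    using that kappa_pos[of \<alpha>] pos_le_divide_eq[of "\<kappa> \<alpha>" "norm (a \<alpha>)" "b \<alpha>"]
    by (simp add: C_def \<theta>_def mult.commute)
  obtain Q :: "(('n \<Rightarrow> nat) \<Rightarrow> 'k) set" where Q: "countable Q" "\<And>q. q \<in> Q \<Longrightarrow> finite {i. q i \<noteq> 0}"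
    "\<And>q e. finite {i. q i \<noteq> 0} \<Longrightarrow> (\<And>i. 0 < e i) \<Longrightarrow> \<exists>q'\<in>Q. \<forall>i. norm (q' i - q i) < e i"
    using countable_approx_finite_support by metis
  define G where "G = (\<lambda>(q, m :: nat). \<Union>n. {a \<in> C. \<forall>\<alpha>. \<kappa> \<alpha> * norm (taylor_shift (t n) a \<alpha> - q \<alpha>) < 1 / real (Suc m)})"
  have "\<exists>a\<in>C. \<forall>S\<in>G ` (Q \<times> UNIV). a \<in> S"
    unfolding C_def
  proof (rule polydisc_Baire, unfold C_def[symmetric])
    show "0 \<le> \<theta> \<alpha>" for \<alpha> using \<theta>[of \<alpha>] by simp
    show "countable (G ` (Q \<times> UNIV))" using Q(1) by auto
    show "openin (top_of_set C) S" if "S \<in> G ` (Q \<times> UNIV)" for S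
      using that Q(2) C b \<open>b summable_on UNIV\<close>
      by (auto simp: G_def intro!: openin_Union openin_shift_close[where b=b])
    fix S V assume S: "S \<in> G ` (Q \<times> UNIV)" and V: "open V" "C \<inter> V \<noteq> {}"
    obtain q m where q: "q \<in> Q" "S = G (q, m)" using S by auto
    obtain r where r: "\<And>z. r < norm z \<Longrightarrow>
        (\<exists>w \<in> C \<inter> V. \<forall>\<alpha>. \<kappa> \<alpha> * norm (taylor_shift z w \<alpha> - q \<alpha>) < 1 / real (Suc m))"
      using exists_shift_close[OF C_def \<theta> V Q(2)[OF q(1)], of "1 / real (Suc m)"] by auto
    have "\<forall>\<^sub>F n in sequentially. r < norm (t n)"
      using t by (rule filterlim_at_top_dense[THEN iffD1, rule_format])
    then obtain n where "r < norm (t n)"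
      using eventually_happens' sequentially_bot by blast
    then show "S \<inter> V \<noteq> {}" using r[of "t n"] by (auto simp: q(2) G_def)
  qed
  then obtain a where a: "a \<in> C" "\<And>q m. q \<in> Q \<Longrightarrow> a \<in> G (q, m)" by auto
  show ?thesis
  proof (intro exI[of _ a] conjI allI impI)
    show "\<kappa> \<alpha> * norm (a \<alpha>) \<le> 1" for \<alpha>
      using C[OF a(1), of \<alpha>] b(2)[of \<alpha>] by simp
    fix q :: "('n \<Rightarrow> nat) \<Rightarrow> 'k" and \<epsilon> :: real
    assume q: "finite {\<alpha>. q \<alpha> \<noteq> 0}" and \<epsilon>: "0 < \<epsilon>"
    obtain q' where q': "q' \<in> Q" "\<And>\<alpha>. norm (q' \<alpha> - q \<alpha>) < \<epsilon> / 2 / \<kappa> \<alpha>"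
      using Q(3)[OF q, of "\<lambda>\<alpha>. \<epsilon> / 2 / \<kappa> \<alpha>"] \<epsilon> kappa_pos by (metis divide_pos_pos zero_less_numeral)
    obtain m where m: "1 / real (Suc m) < \<epsilon> / 2"
      using \<epsilon> by (meson nat_approx_posE half_gt_zero)
    obtain n where n: "\<And>\<alpha>. \<kappa> \<alpha> * norm (taylor_shift (t n) a \<alpha> - q' \<alpha>) < 1 / real (Suc m)"
      using a(2)[OF q'(1), of m] by (auto simp: G_def)
    have "\<kappa> \<alpha> * norm (taylor_shift (t n) a \<alpha> - q \<alpha>) < \<epsilon>" for \<alpha>
    proof -
      have "\<kappa> \<alpha> * norm (taylor_shift (t n) a \<alpha> - q \<alpha>) \<le>
          \<kappa> \<alpha> * (norm (taylor_shift (t n) a \<alpha> - q' \<alpha>) + norm (q' \<alpha> - q \<alpha>))"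
        using kappa_pos[of \<alpha>] norm_triangle_ineq[of "taylor_shift (t n) a \<alpha> - q' \<alpha>" "q' \<alpha> - q \<alpha>"]
        by (intro mult_left_mono) auto
      moreover have "\<kappa> \<alpha> * norm (q' \<alpha> - q \<alpha>) < \<epsilon> / 2"
        using q'(2)[of \<alpha>] kappa_pos[of \<alpha>] by (simp add: pos_less_divide_eq mult.commute)
      ultimately show ?thesis using n[of \<alpha>] m by (simp add: distrib_left)
    qed
    then show "\<exists>n. \<forall>\<alpha>. \<kappa> \<alpha> * norm (taylor_shift (t n) a \<alpha> - q \<alpha>) < \<epsilon>" by blast
  qed
qed

end

subsection \<open>The operator group on a topological vector space\<close>

lemma open_translation_vimage:
  fixes S :: "'a::topological_ab_group_add set"
  assumes "open S"
  shows "open {w. a + w \<in> S}" "open {w. w - a \<in> S}" "open {w. a - w \<in> S}"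
  using assms by (auto intro!: open_vimage[of S, unfolded vimage_def] continuous_intros)

lemma zero_nhd_add:
  fixes W :: "'a::topological_ab_group_add set"
  assumes "open W" "0 \<in> W"
  obtains V where "open V" "0 \<in> V" "\<And>x y. x \<in> V \<Longrightarrow> y \<in> V \<Longrightarrow> x + y \<in> W"
proof -
  have "\<forall>\<^sub>F x in nhds 0 \<times>\<^sub>F nhds (0::'a). fst x + snd x \<in> W"
    using tendsto_add_Pair[of 0 "0::'a"] assms by (auto simp: tendsto_def)
  then obtain P Q where PQ: "\<forall>\<^sub>F x in nhds 0. P x" "\<forall>\<^sub>F x in nhds (0::'a). Q x"
      "\<And>x y. P x \<Longrightarrow> Q y \<Longrightarrow> x + y \<in> W"
    unfolding eventually_prod_filter by auto
  then have "\<forall>\<^sub>F x in nhds 0. P x \<and> Q x" by (simp add: eventually_conj)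
  then obtain V where "open V" "0 \<in> V" "\<And>x. x \<in> V \<Longrightarrow> P x \<and> Q x"
    unfolding eventually_nhds by auto
  then show ?thesis using that PQ(3) by blast
qed

lemma additive_continuous_on:
  fixes f :: "'a::topological_ab_group_add \<Rightarrow> 'b::topological_ab_group_add"
  assumes add: "\<And>x y. f (x + y) = f x + f y"
    and zero: "\<And>W. open W \<Longrightarrow> 0 \<in> W \<Longrightarrow> \<exists>V. open V \<and> 0 \<in> V \<and> (\<forall>x\<in>V. f x \<in> W)"
  shows "continuous_on UNIV f"
  unfolding continuous_on_def
proof (intro ballI topological_tendstoI)
  fix x S assume S: "open S" "f x \<in> S"
  obtain V where V: "open V" "0 \<in> V" "\<And>v. v \<in> V \<Longrightarrow> f x + f v \<in> S"
    using zero[OF open_translation_vimage(1)[OF S(1), of "f x"]] S(2) by auto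
  have "f x' \<in> S" if "x' - x \<in> V" for x'
    using V(3)[OF that] add[of x "x' - x"] by simp
  then show "\<forall>\<^sub>F x' in at x. f x' \<in> S"
    unfolding eventually_at_topological using V(2) open_translation_vimage(2)[OF V(1), of x]
    by (intro exI[of _ "{w. w - x \<in> V}"]) auto
qed

context tvs
begin

lemma continuous_on_scale_right: "continuous_on A (scl c)"
proof -
  have "continuous_on UNIV ((\<lambda>(c, x). scl c x) \<circ> (\<lambda>x. (c, x)))"
    by (rule continuous_on_compose) (auto intro!: continuous_intros continuous_on_subset[OF continuous_scale])
  then show ?thesis by (auto simp: o_def intro: continuous_on_subset)
qed

lemma continuous_on_scale_left: "continuous_on A (\<lambda>c. scl c x)"
proof -
  have "continuous_on UNIV ((\<lambda>(c, x). scl c x) \<circ> (\<lambda>c. (c, x)))"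
    by (rule continuous_on_compose) (auto intro!: continuous_intros continuous_on_subset[OF continuous_scale])
  then show ?thesis by (auto simp: o_def intro: continuous_on_subset)
qed

lemma eventually_scale_in:
  assumes "open W" "0 \<in> W"
  shows "\<exists>\<delta>>0. \<forall>c. norm c < \<delta> \<longrightarrow> scl c x \<in> W"
proof -
  have "open ((\<lambda>c. scl c x) -` W)"
    using assms(1) continuous_on_scale_left by (rule open_vimage)
  moreover have "0 \<in> (\<lambda>c. scl c x) -` W" using assms(2) by simp
  ultimately obtain \<delta> where "\<delta> > 0" "ball 0 \<delta> \<subseteq> (\<lambda>c. scl c x) -` W"
    using open_contains_ball by blast
  then show ?thesis by (intro exI[of _ \<delta>]) (auto simp: dist_norm subset_iff)
qed

lemma has_sum_scale: "(f has_sum s) A \<Longrightarrow> ((\<lambda>i. scl c (f i)) has_sum scl c s) A"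
proof -
  assume "(f has_sum s) A"
  then have "((scl c \<circ> f) has_sum scl c s) A"
    using continuous_on_scale_right[of UNIV c]
    by (intro has_sum_comm_additive_general) (auto simp: scale_sum_right continuous_on_def o_def)
  then show ?thesis by (simp add: o_def)
qed

lemma
  assumes "f \<in> cont_dual scl"
  shows cont_dual_add: "f (x + y) = f x + f y"
    and cont_dual_scale: "f (scl c x) = c * f x"
    and cont_dual_0: "f 0 = 0"
    and cont_dual_diff: "f (x - y) = f x - f y"
    and cont_dual_sum: "f (sum g I) = (\<Sum>i\<in>I. f (g i))"
proof -
  interpret f: Vector_Spaces.linear scl "(*)" f
    using assms by (simp add: cont_dual_def)
  show "f (x + y) = f x + f y" by (rule f.add)
  show "f (scl c x) = c * f x" by (rule f.scale)
  show "f 0 = 0" by (rule f.zero)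
  show "f (x - y) = f x - f y" by (rule f.diff)
  show "f (sum g I) = (\<Sum>i\<in>I. f (g i))" by (rule f.sum)
qed

lemma has_sum_cont_dual:
  assumes "f \<in> cont_dual scl" "(g has_sum s) A"
  shows "((\<lambda>i. f (g i)) has_sum f s) A"
proof -
  have "((f \<circ> g) has_sum f s) A"
    using assms by (intro has_sum_comm_additive_general)
      (auto simp: cont_dual_sum o_def cont_dual_def continuous_on_def)
  then show ?thesis by (simp add: o_def)
qed

end

section \<open>Transport of the translations to the space\<close>

text \<open>The last three conditions say that synthesis is defined on the sequences bounded in the
  weight \<open>\<kappa>\<close>, is continuous at zero there, and has dense range. The set
  \<open>U\<close> is common to all functionals, which is where equicontinuity enters.\<close>

locale shift_system = tvs scl + shift_weights \<kappa> \<eta>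
  for scl :: "'k::{real_normed_field,banach,heine_borel,second_countable_topology} \<Rightarrow> 'a::{topological_ab_group_add,t2_space} \<Rightarrow> 'a"
    and \<kappa> \<eta> :: "('n::finite \<Rightarrow> nat) \<Rightarrow> real" +
  fixes y :: "('n \<Rightarrow> nat) \<Rightarrow> 'a" and \<phi> :: "('n \<Rightarrow> nat) \<Rightarrow> 'a \<Rightarrow> 'k" and U :: "'a set"
  assumes dual: "\<phi> \<alpha> \<in> cont_dual scl"
    and biorthogonal: "\<phi> \<alpha> (y \<beta>) = (if \<alpha> = \<beta> then 1 else 0)"
    and U: "open U" "0 \<in> U"
    and phi_le: "x \<in> U \<Longrightarrow> norm (\<phi> \<alpha> x) \<le> \<eta> \<alpha>"
    and summable: "(\<And>\<alpha>. \<kappa> \<alpha> * norm (d \<alpha>) \<le> R) \<Longrightarrow> (\<lambda>\<alpha>. scl (d \<alpha>) (y \<alpha>)) summable_on UNIV"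
    and small: "open W \<Longrightarrow> 0 \<in> W \<Longrightarrow>
      \<exists>\<epsilon>>0. \<forall>d. (\<forall>\<alpha>. \<kappa> \<alpha> * norm (d \<alpha>) \<le> \<epsilon>) \<longrightarrow> (\<Sum>\<^sub>\<infinity>\<alpha>. scl (d \<alpha>) (y \<alpha>)) \<in> W"
    and dense: "closure (span (range y)) = UNIV"
begin

definition synth :: "(('n \<Rightarrow> nat) \<Rightarrow> 'k) \<Rightarrow> 'a"
  where "synth d = (\<Sum>\<^sub>\<infinity>\<alpha>. scl (d \<alpha>) (y \<alpha>))"

definition weighted_bounded :: "(('n \<Rightarrow> nat) \<Rightarrow> 'k) \<Rightarrow> bool"
  where "weighted_bounded d \<longleftrightarrow> (\<exists>R. \<forall>\<alpha>. \<kappa> \<alpha> * norm (d \<alpha>) \<le> R)"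

definition coords :: "'a \<Rightarrow> ('n \<Rightarrow> nat) \<Rightarrow> 'k"
  where "coords x = (\<lambda>\<alpha>. \<phi> \<alpha> x)"

text \<open>\<open>coords x\<close> is only dominated by \<open>\<eta>\<close> and may have no
  synthesis, but its change under translation is bounded in the weight \<open>\<kappa>\<close>. When
  \<open>x\<close> is itself a synthesis, the formula reduces to synthesis of the translated
  coefficients.\<close>

definition shift_op :: "'k ^ 'n \<Rightarrow> 'a \<Rightarrow> 'a"
  where "shift_op z x = x + synth (\<lambda>\<alpha>. taylor_shift z (coords x) \<alpha> - coords x \<alpha>)"

lemma has_sum_synth:
  assumes "weighted_bounded d"
  shows "((\<lambda>\<alpha>. scl (d \<alpha>) (y \<alpha>)) has_sum synth d) UNIV"
proof -
  obtain R where "\<And>\<alpha>. \<kappa> \<alpha> * norm (d \<alpha>) \<le> R"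
    using assms unfolding weighted_bounded_def by blast
  then show ?thesis
    unfolding synth_def by (intro has_sum_infsum) (rule summable)
qed

lemma synth_eqI: "((\<lambda>\<alpha>. scl (d \<alpha>) (y \<alpha>)) has_sum x) UNIV \<Longrightarrow> synth d = x"
  unfolding synth_def by (rule infsumI)

lemma synth_small:
  assumes "open W" "0 \<in> W"
  obtains \<epsilon> where "\<epsilon> > 0" "\<And>d. (\<And>\<alpha>. \<kappa> \<alpha> * norm (d \<alpha>) \<le> \<epsilon>) \<Longrightarrow> synth d \<in> W"
proof -
  obtain \<epsilon> where "\<epsilon> > 0" "\<forall>d. (\<forall>\<alpha>. \<kappa> \<alpha> * norm (d \<alpha>) \<le> \<epsilon>) \<longrightarrow> synth d \<in> W"
    using small[OF assms] unfolding synth_def by (elim exE conjE)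
  then show ?thesis by (intro that[of \<epsilon>]) auto
qed

lemma synth_add:
  assumes "weighted_bounded c" "weighted_bounded d"
  shows "synth (\<lambda>\<alpha>. c \<alpha> + d \<alpha>) = synth c + synth d"
  using has_sum_add[OF has_sum_synth[OF assms(1)] has_sum_synth[OF assms(2)]]
  by (intro synth_eqI) (simp add: scale_left_distrib)

lemma synth_scale:
  assumes "weighted_bounded d"
  shows "synth (\<lambda>\<alpha>. c * d \<alpha>) = scl c (synth d)"
  using has_sum_scale[OF has_sum_synth[OF assms], of c]
  by (intro synth_eqI) simp

lemma weighted_bounded_add:
  assumes "weighted_bounded c" "weighted_bounded d"
  shows "weighted_bounded (\<lambda>\<alpha>. c \<alpha> + d \<alpha>)"
proof -
  obtain R S where RS: "\<And>\<alpha>. \<kappa> \<alpha> * norm (c \<alpha>) \<le> R" "\<And>\<alpha>. \<kappa> \<alpha> * norm (d \<alpha>) \<le> S"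
    using assms unfolding weighted_bounded_def by auto
  have "\<kappa> \<alpha> * norm (c \<alpha> + d \<alpha>) \<le> R + S" for \<alpha>
    using RS[of \<alpha>] mult_left_mono[OF norm_triangle_ineq less_imp_le[OF kappa_pos], of \<alpha> "c \<alpha>" "d \<alpha>"]
    by (simp add: distrib_left)
  then show ?thesis unfolding weighted_bounded_def by blast
qed

lemma weighted_bounded_scale:
  assumes "weighted_bounded d"
  shows "weighted_bounded (\<lambda>\<alpha>. c * d \<alpha>)"
proof -
  obtain R where R: "\<And>\<alpha>. \<kappa> \<alpha> * norm (d \<alpha>) \<le> R"
    using assms unfolding weighted_bounded_def by auto
  have "\<kappa> \<alpha> * norm (c * d \<alpha>) \<le> norm c * R" for \<alpha>
    using mult_left_mono[OF R norm_ge_zero, of c \<alpha>] by (simp add: norm_mult mult.left_commute)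
  then show ?thesis unfolding weighted_bounded_def by blast
qed

lemma weighted_bounded_finite:
  assumes "finite {\<alpha>. q \<alpha> \<noteq> 0}"
  shows "weighted_bounded q"
  unfolding weighted_bounded_def
proof (intro exI allI)
  fix \<alpha>
  have "0 \<le> (\<Sum>\<beta> | q \<beta> \<noteq> 0. \<kappa> \<beta> * norm (q \<beta>))"
    using kappa_pos by (intro sum_nonneg) (simp add: less_imp_le)
  moreover have "\<kappa> \<alpha> * norm (q \<alpha>) \<le> (\<Sum>\<beta> | q \<beta> \<noteq> 0. \<kappa> \<beta> * norm (q \<beta>))" if "q \<alpha> \<noteq> 0"
    using that assms kappa_pos by (intro member_le_sum) (auto simp: less_imp_le)
  ultimately show "\<kappa> \<alpha> * norm (q \<alpha>) \<le> (\<Sum>\<beta> | q \<beta> \<noteq> 0. \<kappa> \<beta> * norm (q \<beta>))"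
    by (cases "q \<alpha> = 0") auto
qed

lemma weighted_bounded_dominated:
  assumes "weighted_bounded d"
  shows "\<exists>p. dominated p d"
proof -
  obtain R where R: "\<And>\<alpha>. \<kappa> \<alpha> * norm (d \<alpha>) \<le> R"
    using assms unfolding weighted_bounded_def by auto
  have "norm (d \<alpha>) \<le> R * \<eta> \<alpha>" for \<alpha>
  proof -
    have "0 \<le> R" using R[of \<alpha>] kappa_pos[of \<alpha>] by (smt (verit) mult_nonneg_nonneg norm_ge_zero)
    then have "R * 1 \<le> R * (\<kappa> \<alpha> * \<eta> \<alpha>)" by (intro mult_left_mono kappa_eta)
    then have "\<kappa> \<alpha> * norm (d \<alpha>) \<le> \<kappa> \<alpha> * (R * \<eta> \<alpha>)" using R[of \<alpha>] by (simp add: ac_simps)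
    then show ?thesis using kappa_pos[of \<alpha>] by simp
  qed
  then show ?thesis unfolding dominated_def by blast
qed

lemma weighted_bounded_shift_diff:
  fixes d :: "('n \<Rightarrow> nat) \<Rightarrow> 'k"
  assumes "dominated p d"
  shows "weighted_bounded (\<lambda>\<alpha>. taylor_shift z d \<alpha> - d \<alpha>)"
proof -
  obtain B where B: "B > 0" "\<And>\<alpha>. tail \<alpha> \<le> B" using tail_bounded by blast
  let ?E = "exp (\<Sum>i\<in>UNIV. norm (z $ i))"
  have "\<kappa> \<alpha> * norm (taylor_shift z d \<alpha> - d \<alpha>) \<le> ?E * p * B" for \<alpha>
  proof -
    have "\<kappa> \<alpha> * norm (taylor_shift z d \<alpha> - d \<alpha>) \<le> ?E * p * tail \<alpha>"
      by (rule taylor_shift_diff_le[OF assms norm_divided_mon_le_exp])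
    also have "\<dots> \<le> ?E * p * B"
      using B(2) dominated_nonneg[OF assms] by (intro mult_left_mono) auto
    finally show ?thesis .
  qed
  then show ?thesis unfolding weighted_bounded_def by blast
qed

lemma weighted_bounded_shift:
  assumes "weighted_bounded d"
  shows "weighted_bounded (taylor_shift z d)"
proof -
  obtain p where "dominated p d" using weighted_bounded_dominated[OF assms] by blast
  from weighted_bounded_add[OF weighted_bounded_shift_diff[OF this, of z] assms] show ?thesis by simp
qed

lemma coords_synth: "weighted_bounded d \<Longrightarrow> coords (synth d) = d"
proof
  fix \<alpha> assume "weighted_bounded d"
  from has_sum_cont_dual[OF dual[of \<alpha>] has_sum_synth[OF this]]
  have "((\<lambda>\<beta>. d \<beta> * \<phi> \<alpha> (y \<beta>)) has_sum \<phi> \<alpha> (synth d)) UNIV"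
    by (simp add: cont_dual_scale[OF dual])
  moreover have "((\<lambda>\<beta>. d \<beta> * \<phi> \<alpha> (y \<beta>)) has_sum d \<alpha>) UNIV"
    by (rule has_sum_finite_neutralI[of "{\<alpha>}"]) (auto simp: biorthogonal)
  ultimately show "coords (synth d) \<alpha> = d \<alpha>"
    unfolding coords_def by (rule has_sum_unique)
qed

lemma coords_add: "coords (x + x') = (\<lambda>\<alpha>. coords x \<alpha> + coords x' \<alpha>)"
  and coords_scale: "coords (scl c x) = (\<lambda>\<alpha>. c * coords x \<alpha>)"
  by (simp_all add: coords_def cont_dual_add[OF dual] cont_dual_scale[OF dual])

lemma dominated_coords_scale:
  assumes "\<delta> \<noteq> 0" "scl (inverse \<delta>) x \<in> U"
  shows "dominated (norm \<delta>) (coords x)"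
  unfolding dominated_def
proof
  fix \<alpha>
  have "inverse (norm \<delta>) * norm (\<phi> \<alpha> x) \<le> \<eta> \<alpha>"
    using phi_le[OF assms(2), of \<alpha>] by (simp only: cont_dual_scale[OF dual] norm_mult norm_inverse)
  then show "norm (coords x \<alpha>) \<le> norm \<delta> * \<eta> \<alpha>"
    using assms(1) by (simp add: coords_def field_simps)
qed

lemma dominated_coords: "\<exists>p. dominated p (coords x)"
proof -
  obtain \<delta> where \<delta>: "\<delta> > 0" "\<And>c. norm c < \<delta> \<Longrightarrow> scl c x \<in> U"
    using eventually_scale_in[OF U] by blast
  \<comment> \<open>The scalar is \<open>\<delta> / 2\<close>, strictly inside the range in which
    multiples of \<open>x\<close> lie in \<open>U\<close>.\<close>
  have "scl (inverse (of_real (2 / \<delta>))) x \<in> U"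
    using \<delta>(1) by (intro \<delta>(2)) (simp add: norm_inverse norm_divide)
  then show ?thesis using dominated_coords_scale[of "of_real (2 / \<delta>)" x] \<delta>(1) by auto
qed

lemma coords_shift_op: "coords (shift_op z x) = taylor_shift z (coords x)"
proof -
  obtain p where "dominated p (coords x)" using dominated_coords by blast
  then show ?thesis
    by (simp add: shift_op_def coords_add coords_synth weighted_bounded_shift_diff)
qed

lemma shift_op_synth:
  assumes "weighted_bounded d"
  shows "shift_op z (synth d) = synth (taylor_shift z d)"
proof -
  obtain p where p: "dominated p d" using weighted_bounded_dominated[OF assms] by blast
  show ?thesis
    using synth_add[OF assms weighted_bounded_shift_diff[OF p, of z]]
    by (simp add: shift_op_def coords_synth[OF assms])
qed

lemma shift_op_0 [simp]: "shift_op 0 x = x"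
  by (simp add: shift_op_def synth_def)

text \<open>Telescoping \<open>S_(s+t) - I = (S_t - I) + (S_s - I) S_t\<close>, where both
  differences can be synthesised although the sequences themselves perhaps cannot.\<close>

lemma shift_op_shift_op: "shift_op s (shift_op t x) = shift_op (s + t) x"
proof -
  obtain p where p: "dominated p (coords x)" using dominated_coords by blast
  obtain q where q: "dominated q (taylor_shift t (coords x))" using dominated_taylor_shift[OF p] by blast
  have "synth (\<lambda>\<alpha>. taylor_shift (s + t) (coords x) \<alpha> - coords x \<alpha>) =
      synth (\<lambda>\<alpha>. taylor_shift t (coords x) \<alpha> - coords x \<alpha>) +
      synth (\<lambda>\<alpha>. taylor_shift s (taylor_shift t (coords x)) \<alpha> - taylor_shift t (coords x) \<alpha>)"
    unfolding synth_add[OF weighted_bounded_shift_diff[OF p, of t] weighted_bounded_shift_diff[OF q, of s], symmetric]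
    by (simp add: taylor_shift_add[OF p])
  then show ?thesis
    unfolding shift_op_def[of s] coords_shift_op by (simp add: shift_op_def add.assoc)
qed

lemma taylor_shift_linear:
  fixes c d :: "('n \<Rightarrow> nat) \<Rightarrow> 'k"
  assumes c: "dominated p c" and d: "dominated q d"
  shows "taylor_shift z (\<lambda>\<alpha>. c \<alpha> + d \<alpha>) \<alpha> = taylor_shift z c \<alpha> + taylor_shift z d \<alpha>"
    and "taylor_shift z (\<lambda>\<alpha>. b * d \<alpha>) \<alpha> = b * taylor_shift z d \<alpha>"
  unfolding taylor_shift_def
  using infsum_add[OF abs_summable_summable[OF abs_summable_shift[OF c, of z \<alpha> UNIV]]
    abs_summable_summable[OF abs_summable_shift[OF d, of z \<alpha> UNIV]]]
  by (simp_all add: distrib_left mult.left_commute[of _ b] infsum_cmult_right')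

lemma shift_op_add: "shift_op z (x + x') = shift_op z x + shift_op z x'"
proof -
  obtain p q where p: "dominated p (coords x)" and q: "dominated q (coords x')"
    using dominated_coords by blast
  have "synth (\<lambda>\<alpha>. taylor_shift z (coords (x + x')) \<alpha> - coords (x + x') \<alpha>) =
      synth (\<lambda>\<alpha>. taylor_shift z (coords x) \<alpha> - coords x \<alpha>) +
      synth (\<lambda>\<alpha>. taylor_shift z (coords x') \<alpha> - coords x' \<alpha>)"
    unfolding synth_add[OF weighted_bounded_shift_diff[OF p, of z] weighted_bounded_shift_diff[OF q, of z], symmetric]
    by (simp add: coords_add taylor_shift_linear(1)[OF p q] algebra_simps)
  then show ?thesis by (simp add: shift_op_def)
qed

lemma shift_op_scale: "shift_op z (scl c x) = scl c (shift_op z x)"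
proof -
  obtain p where p: "dominated p (coords x)" using dominated_coords by blast
  have "synth (\<lambda>\<alpha>. taylor_shift z (coords (scl c x)) \<alpha> - coords (scl c x) \<alpha>) =
      scl c (synth (\<lambda>\<alpha>. taylor_shift z (coords x) \<alpha> - coords x \<alpha>))"
    unfolding synth_scale[OF weighted_bounded_shift_diff[OF p, of z], symmetric]
    by (simp add: coords_scale taylor_shift_linear(2)[OF p p] algebra_simps)
  then show ?thesis by (simp add: shift_op_def scale_right_distrib)
qed

lemma shift_op_diff: "shift_op z (x - x') = shift_op z x - shift_op z x'"
  using shift_op_add[of z "x - x'" x'] by (simp add: algebra_simps)

lemma continuous_on_shift_op: "continuous_on UNIV (shift_op z)"
proof (rule additive_continuous_on)
  show "shift_op z (x + y) = shift_op z x + shift_op z y" for x y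
    by (rule shift_op_add)
  fix W :: "'a set" assume W: "open W" "0 \<in> W"
  obtain V where V: "open V" "0 \<in> V" "\<And>x y. x \<in> V \<Longrightarrow> y \<in> V \<Longrightarrow> x + y \<in> W"
    using zero_nhd_add[OF W] by blast
  obtain \<epsilon> where \<epsilon>: "\<epsilon> > 0" "\<And>d. (\<And>\<alpha>. \<kappa> \<alpha> * norm (d \<alpha>) \<le> \<epsilon>) \<Longrightarrow> synth d \<in> V"
    using synth_small[OF V(1,2)] by blast
  obtain B where B: "B > 0" "\<And>\<alpha>. tail \<alpha> \<le> B" using tail_bounded by blast
  define E where "E = exp (\<Sum>i\<in>UNIV. norm (z $ i))"
  have E: "E > 0" by (simp add: E_def)
  \<comment> \<open>Solves \<open>E * \<delta> * B = \<epsilon>\<close>: for \<open>x\<close> in the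
    \<open>\<delta>\<close>-multiple of \<open>U\<close> the correction then has weighted size at
    most \<open>\<epsilon>\<close>.\<close>
  define \<delta> where "\<delta> = \<epsilon> / (E * B)"
  have \<delta>: "\<delta> > 0" using \<epsilon>(1) E B(1) by (simp add: \<delta>_def)
  have "shift_op z x \<in> W" if x: "x \<in> V" "scl (inverse (of_real \<delta>)) x \<in> U" for x
  proof -
    have dom: "dominated \<delta> (coords x)"
      using dominated_coords_scale[OF _ x(2)] \<delta> by simp
    have "\<kappa> \<alpha> * norm (taylor_shift z (coords x) \<alpha> - coords x \<alpha>) \<le> \<epsilon>" for \<alpha>
    proof -
      have "\<kappa> \<alpha> * norm (taylor_shift z (coords x) \<alpha> - coords x \<alpha>) \<le> E * \<delta> * tail \<alpha>"
        unfolding E_def by (rule taylor_shift_diff_le[OF dom norm_divided_mon_le_exp])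
      also have "\<dots> \<le> E * \<delta> * B"
        using E \<delta> B(2) by (intro mult_left_mono) auto
      also have "\<dots> = \<epsilon>" using E B(1) by (simp add: \<delta>_def)
      finally show ?thesis .
    qed
    then show ?thesis unfolding shift_op_def by (intro V(3) x(1) \<epsilon>(2))
  qed
  moreover have "open (V \<inter> scl (inverse (of_real \<delta>)) -` U)"
    using V(1) U(1) by (intro open_Int open_vimage continuous_on_scale_right)
  ultimately show "\<exists>V. open V \<and> 0 \<in> V \<and> (\<forall>x\<in>V. shift_op z x \<in> W)"
    using V(2) U(2) by (intro exI[of _ "V \<inter> scl (inverse (of_real \<delta>)) -` U"]) auto
qed

lemma linear_shift_op: "Vector_Spaces.linear scl scl (shift_op z)"
  by (intro linear_iff_module_hom[THEN iffD2]) (simp add: module_hom_iff module_axioms shift_op_add shift_op_scale)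

lemma operator_group_shift_op: "operator_group scl shift_op"
  unfolding operator_group_def cont_operators_def
  by (auto simp: continuous_on_shift_op shift_op_add shift_op_scale shift_op_shift_op fun_eq_iff add.commute
    linear_shift_op)

text \<open>With \<open>h = s n - t\<close> the difference is \<open>T_t (T_h - I)\<close>. On
  \<open>U\<close> the inner factor has coefficients of weighted size \<open>O(norm h)\<close>, and
  \<open>T_t\<close> is absorbed by pulling \<open>W\<close> back, so the same \<open>U\<close>
  serves every \<open>t\<close> and \<open>W\<close>.\<close>

lemma uniformly_continuous_shift_op: "uniformly_continuous_group shift_op"
  unfolding uniformly_continuous_group_def
proof (intro exI[of _ U] conjI allI impI U)
  fix s :: "nat \<Rightarrow> 'k ^ 'n" and t and W :: "'a set" assume st: "s \<longlonglongrightarrow> t" and "open W \<and> 0 \<in> W"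
  then have W: "open W" "0 \<in> W" by auto
  have V: "open (shift_op t -` W)" "0 \<in> shift_op t -` W"
    using W shift_op_scale[of t 0 0] by (auto intro!: open_vimage continuous_on_shift_op)
  obtain \<epsilon> where \<epsilon>: "\<epsilon> > 0" "\<And>d. (\<And>\<alpha>. \<kappa> \<alpha> * norm (d \<alpha>) \<le> \<epsilon>) \<Longrightarrow> synth d \<in> shift_op t -` W"
    using synth_small[OF V] by blast
  obtain B where B: "B > 0" "\<And>\<alpha>. tail \<alpha> \<le> B" using tail_bounded by blast
  have "\<forall>\<^sub>F n in sequentially. dist (s n) t < min 1 (\<epsilon> / B)"
    using tendstoD[OF st, of "min 1 (\<epsilon> / B)"] \<epsilon>(1) B(1) by simp
  then show "\<forall>\<^sub>F n in sequentially. \<forall>x\<in>U. shift_op (s n) x - shift_op t x \<in> W"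
  proof eventually_elim
    case (elim n)
    define h where "h = s n - t"
    have h: "norm h \<le> 1" "norm h \<le> \<epsilon> / B" using elim by (auto simp: h_def dist_norm)
    show ?case
    proof
      fix x assume "x \<in> U"
      then have dom: "dominated 1 (coords x)" using dominated_coords_scale[of 1 x] by simp
      have "\<kappa> \<alpha> * norm (taylor_shift h (coords x) \<alpha> - coords x \<alpha>) \<le> \<epsilon>" for \<alpha>
      proof -
        have "\<kappa> \<alpha> * norm (taylor_shift h (coords x) \<alpha> - coords x \<alpha>) \<le> norm h * 1 * tail \<alpha>"
          by (rule taylor_shift_diff_le[OF dom norm_divided_mon_le_norm[OF h(1)]])
        also have "\<dots> \<le> \<epsilon> / B * 1 * B"
          using h(2) B \<epsilon>(1) by (intro mult_mono tail_nonneg) auto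
        finally show ?thesis using B(1) by simp
      qed
      then have "shift_op t (shift_op h x - x) \<in> W"
        using \<epsilon>(2) unfolding shift_op_def[of h] by simp
      then show "shift_op (s n) x - shift_op t x \<in> W"
        by (simp add: shift_op_diff shift_op_shift_op h_def)
    qed
  qed
qed

section \<open>Mixing, universality and analyticity of the group\<close>

lemma span_imp_synth:
  assumes "v \<in> span (range y)"
  shows "\<exists>q. finite {\<alpha>. q \<alpha> \<noteq> 0} \<and> v = synth q"
proof -
  let ?S = "{synth q |q. finite {\<alpha>. q \<alpha> \<noteq> 0}}"
  have "subspace ?S"
  proof (rule subspaceI)
    show "0 \<in> ?S"
      by (rule CollectI, rule exI[of _ "\<lambda>_. 0"]) (simp add: synth_def)
    show "v + w \<in> ?S" if vw: "v \<in> ?S" "w \<in> ?S" for v w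
    proof -
      obtain c d where cd: "v = synth c" "finite {\<alpha>. c \<alpha> \<noteq> 0}" "w = synth d" "finite {\<alpha>. d \<alpha> \<noteq> 0}"
        using vw by blast
      have "finite {\<alpha>. c \<alpha> + d \<alpha> \<noteq> 0}"
        by (rule finite_subset[OF _ finite_UnI[OF cd(2,4)]]) auto
      then show ?thesis
        using cd synth_add[of c d] weighted_bounded_finite by (auto intro!: exI[of _ "\<lambda>\<alpha>. c \<alpha> + d \<alpha>"])
    qed
    show "scl b v \<in> ?S" if v: "v \<in> ?S" for b v
    proof -
      obtain c where c: "v = synth c" "finite {\<alpha>. c \<alpha> \<noteq> 0}"
        using v by blast
      have "finite {\<alpha>. b * c \<alpha> \<noteq> 0}"
        by (rule finite_subset[OF _ c(2)]) auto
      then show ?thesis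
        using c synth_scale[of c b] weighted_bounded_finite by (auto intro!: exI[of _ "\<lambda>\<alpha>. b * c \<alpha>"])
    qed
  qed
  moreover have "range y \<subseteq> ?S"
  proof clarify
    fix \<beta>
    have "synth (\<lambda>\<alpha>. if \<alpha> = \<beta> then 1 else 0) = y \<beta>"
      by (rule synth_eqI, rule has_sum_finite_neutralI[of "{\<beta>}"]) auto
    then show "\<exists>q. y \<beta> = synth q \<and> finite {\<alpha>. q \<alpha> \<noteq> 0}"
      by (intro exI[of _ "\<lambda>\<alpha>. if \<alpha> = \<beta> then 1 else 0"]) auto
  qed
  ultimately show ?thesis using span_minimal[of "range y" ?S] assms by blast
qed

lemma synth_near:
  assumes "open W" "0 \<in> W"
  obtains \<epsilon> where "\<epsilon> > 0" "\<And>c d. weighted_bounded c \<Longrightarrow> weighted_bounded d \<Longrightarrow>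
    (\<And>\<alpha>. \<kappa> \<alpha> * norm (c \<alpha> - d \<alpha>) \<le> \<epsilon>) \<Longrightarrow> synth c - synth d \<in> W"
proof -
  obtain \<epsilon> where \<epsilon>: "\<epsilon> > 0" "\<And>d. (\<And>\<alpha>. \<kappa> \<alpha> * norm (d \<alpha>) \<le> \<epsilon>) \<Longrightarrow> synth d \<in> W"
    using synth_small[OF assms] by blast
  show ?thesis
  proof (rule that[OF \<epsilon>(1)])
    fix c d assume *: "weighted_bounded c" "weighted_bounded d" "\<And>\<alpha>. \<kappa> \<alpha> * norm (c \<alpha> - d \<alpha>) \<le> \<epsilon>"
    have "synth (\<lambda>\<alpha>. c \<alpha> + (-1) * d \<alpha>) = synth c - synth d"
      using synth_add[OF *(1) weighted_bounded_scale[OF *(2), of "-1"]] synth_scale[OF *(2), of "-1"] by simp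
    then show "synth c - synth d \<in> W" using \<epsilon>(2)[OF *(3)] by simp
  qed
qed

lemma mixing_shift_op: "mixing shift_op"
  unfolding mixing_def
proof (intro allI impI)
  fix U V :: "'a set" assume UV: "open U \<and> U \<noteq> {} \<and> open V \<and> V \<noteq> {}"
  then have "U \<inter> span (range y) \<noteq> {}" "V \<inter> span (range y) \<noteq> {}"
    using dense open_Int_closure_eq_empty[of U "span (range y)"] open_Int_closure_eq_empty[of V "span (range y)"]
    by auto
  then obtain p q where p: "finite {\<alpha>. p \<alpha> \<noteq> 0}" "synth p \<in> U" and q: "finite {\<alpha>. q \<alpha> \<noteq> 0}" "synth q \<in> V"
    using span_imp_synth by blast
  have nhd: "open {w. synth p + w \<in> U}" "0 \<in> {w. synth p + w \<in> U}"
      "open {w. synth q + w \<in> V}" "0 \<in> {w. synth q + w \<in> V}"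
    using UV p(2) q(2) open_translation_vimage(1) by auto
  obtain e1 where e1: "e1 > 0" "\<And>c d. weighted_bounded c \<Longrightarrow> weighted_bounded d \<Longrightarrow>
    (\<And>\<alpha>. \<kappa> \<alpha> * norm (c \<alpha> - d \<alpha>) \<le> e1) \<Longrightarrow> synth c - synth d \<in> {w. synth p + w \<in> U}"
    using synth_near[OF nhd(1,2)] by blast
  obtain e2 where e2: "e2 > 0" "\<And>c d. weighted_bounded c \<Longrightarrow> weighted_bounded d \<Longrightarrow>
    (\<And>\<alpha>. \<kappa> \<alpha> * norm (c \<alpha> - d \<alpha>) \<le> e2) \<Longrightarrow> synth c - synth d \<in> {w. synth q + w \<in> V}"
    using synth_near[OF nhd(3,4)] by blast
  obtain M where M: "degree_le M p" "degree_le M q" "\<And>e. e > 0 \<Longrightarrow> \<exists>r>0. \<forall>z. r < norm z \<longrightarrow>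
    (\<exists>w. degree_le M w \<and> (\<forall>\<alpha>. norm (w \<alpha> - p \<alpha>) < e) \<and> (\<forall>\<alpha>. norm (taylor_shift z w \<alpha> - q \<alpha>) < e))"
    using taylor_shift_mixing[OF p(1) q(1)] by metis
  \<comment> \<open>All sequences compared have degree at most \<open>M\<close>, so one unweighted
    tolerance beats the finitely many weights that occur.\<close>
  have "\<exists>e>0. \<forall>\<alpha>\<in>{\<alpha>. total_degree \<alpha> \<le> M}. e \<le> min e1 e2 / \<kappa> \<alpha>"
    using e1(1) e2(1) kappa_pos by (intro finite_uniform_pos) auto
  then obtain e where e: "e > 0" "\<And>\<alpha>. total_degree \<alpha> \<le> M \<Longrightarrow> e \<le> min e1 e2 / \<kappa> \<alpha>" by auto
  have near: "\<kappa> \<alpha> * norm (c \<alpha> - d \<alpha>) \<le> min e1 e2"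
    if "degree_le M c" "degree_le M d" "norm (c \<alpha> - d \<alpha>) < e" for c d :: "('n \<Rightarrow> nat) \<Rightarrow> 'k" and \<alpha>
  proof (cases "total_degree \<alpha> \<le> M")
    case True
    then have "norm (c \<alpha> - d \<alpha>) \<le> min e1 e2 / \<kappa> \<alpha>" using e(2) that(3) by force
    then show ?thesis by (subst (asm) pos_le_divide_eq[OF kappa_pos]) (simp add: mult.commute)
  next
    case False
    then show ?thesis using that e1(1) e2(1) by (simp add: degree_leD)
  qed
  have wb: "weighted_bounded c" if "degree_le M c" for c :: "('n \<Rightarrow> nat) \<Rightarrow> 'k"
  proof (rule weighted_bounded_finite[OF finite_subset[OF _ finite_total_degree_le[of M]]])
    show "{\<alpha>. c \<alpha> \<noteq> 0} \<subseteq> {\<alpha>. total_degree \<alpha> \<le> M}"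
      using degree_leD[OF that] not_le by blast
  qed
  obtain r where r: "r > 0" "\<And>z. r < norm z \<Longrightarrow>
    \<exists>w. degree_le M w \<and> (\<forall>\<alpha>. norm (w \<alpha> - p \<alpha>) < e) \<and> (\<forall>\<alpha>. norm (taylor_shift z w \<alpha> - q \<alpha>) < e)"
    using M(3)[OF e(1)] by blast
  show "\<exists>r>0. \<forall>t. r < norm t \<longrightarrow> shift_op t ` U \<inter> V \<noteq> {}"
  proof (intro exI[of _ r] conjI allI impI r(1))
    fix z :: "'k ^ 'n" assume "r < norm z"
    then obtain w where w: "degree_le M w" "\<And>\<alpha>. norm (w \<alpha> - p \<alpha>) < e"
        "\<And>\<alpha>. norm (taylor_shift z w \<alpha> - q \<alpha>) < e"
      using r(2) by blast
    have w': "degree_le M (taylor_shift z w)" by (rule degree_le_taylor_shift[OF w(1)])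
    have "synth w \<in> U"
      using e1(2)[OF wb[OF w(1)] wb[OF M(1)]] near[OF w(1) M(1) w(2)] by simp
    moreover have "synth (taylor_shift z w) \<in> V"
      using e2(2)[OF wb[OF w'] wb[OF M(2)]] near[OF w' M(2) w(3)] by simp
    ultimately show "shift_op z ` U \<inter> V \<noteq> {}"
      using shift_op_synth[OF wb[OF w(1)], of z] by (metis disjoint_iff imageI)
  qed
qed

text \<open>The universal vector is the synthesis of a universal sequence: its translates approach
  each finitely supported \<open>q\<close> in the weight \<open>\<kappa>\<close>, hence the orbit
  approaches each element of the dense span.\<close>

lemma hereditarily_hypercyclic_shift_op: "hereditarily_hypercyclic shift_op"
  unfolding hereditarily_hypercyclic_def universal_family_def
proof (intro allI impI)
  fix t :: "nat \<Rightarrow> 'k ^ 'n" assume t: "filterlim (\<lambda>n. norm (t n)) at_top sequentially"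
  obtain a where a: "\<And>\<alpha>. \<kappa> \<alpha> * norm (a \<alpha>) \<le> 1" "\<And>q \<epsilon>. finite {\<alpha>. q \<alpha> \<noteq> 0} \<Longrightarrow> 0 < \<epsilon> \<Longrightarrow>
    \<exists>n. \<forall>\<alpha>. \<kappa> \<alpha> * norm (taylor_shift (t n) a \<alpha> - q \<alpha>) < \<epsilon>"
    using exists_universal_sequence[OF t] by blast
  have wb: "weighted_bounded a" using a(1) unfolding weighted_bounded_def by blast
  let ?O = "range (\<lambda>n. shift_op (t n) (synth a))"
  have "span (range y) \<subseteq> closure ?O"
  proof
    fix v assume "v \<in> span (range y)"
    then obtain q where q: "finite {\<alpha>. q \<alpha> \<noteq> 0}" "v = synth q" using span_imp_synth by blast
    show "v \<in> closure ?O"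
      unfolding closure_iff_nhds_not_empty
    proof (intro allI impI)
      fix A V assume V: "V \<subseteq> A" "open V" "v \<in> V"
      obtain e where e: "e > 0" "\<And>c d. weighted_bounded c \<Longrightarrow> weighted_bounded d \<Longrightarrow>
        (\<And>\<alpha>. \<kappa> \<alpha> * norm (c \<alpha> - d \<alpha>) \<le> e) \<Longrightarrow> synth c - synth d \<in> {w. v + w \<in> V}"
        using synth_near[of "{w. v + w \<in> V}"] open_translation_vimage(1)[OF V(2), of v] V(3) by auto
      obtain n where "\<And>\<alpha>. \<kappa> \<alpha> * norm (taylor_shift (t n) a \<alpha> - q \<alpha>) < e"
        using a(2)[OF q(1) e(1)] by blast
      then have "synth (taylor_shift (t n) a) \<in> V"
        using e(2)[OF weighted_bounded_shift[OF wb] weighted_bounded_finite[OF q(1)]] q(2) by (auto simp: less_imp_le)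
      then show "?O \<inter> A \<noteq> {}"
        using V(1) shift_op_synth[OF wb, of "t n"] by (metis disjoint_iff rangeI subsetD)
    qed
  qed
  then have "closure (span (range y)) \<subseteq> closure ?O" by (rule closure_minimal) simp
  then show "\<exists>x. closure (range (\<lambda>n. shift_op (t n) x)) = UNIV"
    using dense by blast
qed

text \<open>Expanding both the synthesis series and the translation gives a double series, and
  exchanging the sums produces one power series valid for all \<open>z\<close>. An expansion at
  \<open>w\<close> is the expansion at 0 for the vector \<open>T_w x\<close>.\<close>

lemma analytic_shift_op:
  assumes f: "f \<in> cont_dual scl"
  shows "analytic_map (\<lambda>z. f (shift_op z x))"
proof -
  obtain \<epsilon> where \<epsilon>: "\<epsilon> > 0" "\<And>d. (\<And>\<alpha>. \<kappa> \<alpha> * norm (d \<alpha>) \<le> \<epsilon>) \<Longrightarrow> synth d \<in> f -` ball 0 1"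
  proof (rule synth_small)
    show "open (f -` ball 0 1)" using f by (intro open_vimage) (auto simp: cont_dual_def)
    show "0 \<in> f -` ball 0 1" using f by (simp add: cont_dual_0)
  qed blast
  \<comment> \<open>Testing continuity of \<open>f\<close> on the single coefficient
    \<open>\<epsilon> / \<kappa> \<beta>\<close>. The growth \<open>\<kappa>\<close> is exactly what
    \<open>tails_summable\<close> tolerates in the double series.\<close>
  have fy: "norm (f (y \<beta>)) \<le> \<kappa> \<beta> / \<epsilon>" for \<beta>
  proof -
    define c :: 'k where "c = of_real (\<epsilon> / \<kappa> \<beta>)"
    have c: "norm c = \<epsilon> / \<kappa> \<beta>"
      unfolding c_def using \<epsilon>(1) kappa_pos[of \<beta>] by (subst norm_of_real) simp
    have "synth (\<lambda>\<alpha>. if \<alpha> = \<beta> then c else 0) = scl c (y \<beta>)"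
      by (rule synth_eqI, rule has_sum_finite_neutralI[of "{\<beta>}"]) auto
    moreover have "synth (\<lambda>\<alpha>. if \<alpha> = \<beta> then c else 0) \<in> f -` ball 0 1"
      using \<epsilon>(1) kappa_pos[of \<beta>] by (intro \<epsilon>(2)) (auto simp: c)
    ultimately have "norm (c * f (y \<beta>)) < 1"
      by (simp add: cont_dual_scale[OF f])
    then have "\<epsilon> / \<kappa> \<beta> * norm (f (y \<beta>)) < 1"
      by (simp add: c norm_mult)
    then show ?thesis using \<epsilon>(1) kappa_pos[of \<beta>] by (simp add: field_simps)
  qed
  have main: "\<exists>C. \<forall>z. ((\<lambda>\<gamma>. C \<gamma> * divided_mon z \<gamma>) has_sum f (shift_op z x)) UNIV" for x
  proof -
    obtain p where p: "dominated p (coords x)" using dominated_coords by blast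
    have p0: "0 \<le> p" by (rule dominated_nonneg[OF p])
    \<comment> \<open>Convergence is available for \<open>\<gamma> \<noteq> 0\<close>; for
      \<open>\<gamma> = 0\<close> this would be the possibly divergent coordinate series of
      \<open>x\<close>, so the constant coefficient is taken to be \<open>f x\<close>.\<close>
    define A where "A \<gamma> = (\<Sum>\<^sub>\<infinity>\<alpha>. coords x (\<alpha> + \<gamma>) * f (y \<alpha>))" for \<gamma>
    have "((\<lambda>\<gamma>. (if \<gamma> = 0 then f x else A \<gamma>) * divided_mon z \<gamma>) has_sum f (shift_op z x)) UNIV" for z
    proof -
      define h where "h = (\<lambda>(\<alpha>, \<gamma>). divided_mon z \<gamma> * coords x (\<alpha> + \<gamma>) * f (y \<alpha>))"
      let ?E = "exp (\<Sum>i\<in>UNIV. norm (z $ i))"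
      have "(\<lambda>i. norm (h i)) summable_on UNIV \<times> -{0}"
      proof (rule Infinite_Sum.abs_summable_on_comparison_test')
        show "(\<lambda>i. ?E * p / \<epsilon> * (case i of (\<alpha>, \<gamma>) \<Rightarrow> \<kappa> \<alpha> * \<eta> (\<alpha> + \<gamma>))) summable_on UNIV \<times> -{0}"
          by (intro summable_on_cmult_right tails_summable)
        fix i :: "('n \<Rightarrow> nat) \<times> ('n \<Rightarrow> nat)"
        obtain \<alpha> \<gamma> where i: "i = (\<alpha>, \<gamma>)" by (cases i)
        have "norm (divided_mon z \<gamma>) * norm (coords x (\<alpha> + \<gamma>)) * norm (f (y \<alpha>)) \<le>
            ?E * (p * \<eta> (\<alpha> + \<gamma>)) * (\<kappa> \<alpha> / \<epsilon>)"
          using p p0 eta_pos by (intro mult_mono norm_divided_mon_le_exp fy) (auto simp: dominated_def less_imp_le)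
        then show "norm (h i) \<le> ?E * p / \<epsilon> * (case i of (\<alpha>, \<gamma>) \<Rightarrow> \<kappa> \<alpha> * \<eta> (\<alpha> + \<gamma>))"
          by (simp add: h_def i norm_mult ac_simps)
      qed
      then have h: "h summable_on UNIV \<times> -{0}" by (rule abs_summable_summable)
      then have h': "(\<lambda>(\<gamma>, \<alpha>). h (\<alpha>, \<gamma>)) summable_on (-{0}) \<times> UNIV"
        by (subst summable_on_swap) (simp add: case_prod_unfold)
      have inner: "(\<Sum>\<^sub>\<infinity>\<alpha>. h (\<alpha>, \<gamma>)) = A \<gamma> * divided_mon z \<gamma>" for \<gamma>
        unfolding h_def A_def by (simp add: mult.assoc infsum_cmult_right')
      have outer: "(\<Sum>\<^sub>\<infinity>\<gamma>\<in>-{0}. h (\<alpha>, \<gamma>)) = (taylor_shift z (coords x) \<alpha> - coords x \<alpha>) * f (y \<alpha>)" for \<alpha>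
        unfolding h_def taylor_shift_diff[OF p] by (simp add: infsum_cmult_left')
      have "(\<lambda>\<gamma>. A \<gamma> * divided_mon z \<gamma>) summable_on -{0}"
        using summable_on_Sigma_banach[OF h'] by (simp add: inner)
      moreover have "(\<Sum>\<^sub>\<infinity>\<gamma>\<in>-{0}. A \<gamma> * divided_mon z \<gamma>) =
          f (synth (\<lambda>\<alpha>. taylor_shift z (coords x) \<alpha> - coords x \<alpha>))"
      proof -
        have "(\<Sum>\<^sub>\<infinity>\<gamma>\<in>-{0}. A \<gamma> * divided_mon z \<gamma>) = (\<Sum>\<^sub>\<infinity>\<gamma>\<in>-{0}. \<Sum>\<^sub>\<infinity>\<alpha>. h (\<alpha>, \<gamma>))"
          by (simp add: inner)
        also have "\<dots> = (\<Sum>\<^sub>\<infinity>\<alpha>. \<Sum>\<^sub>\<infinity>\<gamma>\<in>-{0}. h (\<alpha>, \<gamma>))"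
          by (rule infsum_swap_banach[OF h'])
        also have "\<dots> = (\<Sum>\<^sub>\<infinity>\<alpha>. (taylor_shift z (coords x) \<alpha> - coords x \<alpha>) * f (y \<alpha>))"
          by (simp add: outer)
        also have "\<dots> = f (synth (\<lambda>\<alpha>. taylor_shift z (coords x) \<alpha> - coords x \<alpha>))"
          using has_sum_cont_dual[OF f has_sum_synth[OF weighted_bounded_shift_diff[OF p, of z]]]
          by (intro infsumI) (simp add: cont_dual_scale[OF f])
        finally show ?thesis .
      qed
      ultimately have "((\<lambda>\<gamma>. A \<gamma> * divided_mon z \<gamma>) has_sum
          f (synth (\<lambda>\<alpha>. taylor_shift z (coords x) \<alpha> - coords x \<alpha>))) (-{0})"
        by (simp add: has_sum_iff)
      then have "((\<lambda>\<gamma>. (if \<gamma> = 0 then f x else A \<gamma>) * divided_mon z \<gamma>) has_sum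
          f (synth (\<lambda>\<alpha>. taylor_shift z (coords x) \<alpha> - coords x \<alpha>))) (-{0})"
        by (subst has_sum_cong[where g = "\<lambda>\<gamma>. A \<gamma> * divided_mon z \<gamma>"]) auto
      from has_sum_insert[OF _ this, of 0] show ?thesis
        by (simp add: insert_compl_zero shift_op_def cont_dual_add[OF f])
    qed
    then show ?thesis
      by (intro exI[of _ "\<lambda>\<gamma>. if \<gamma> = 0 then f x else A \<gamma>"]) blast
  qed
  show ?thesis
    unfolding analytic_map_def
  proof
    fix w :: "'k ^ 'n"
    obtain C where C: "\<And>z. ((\<lambda>\<gamma>. C \<gamma> * divided_mon z \<gamma>) has_sum f (shift_op z (shift_op w x))) UNIV"
      using main by blast
    define c where "c \<gamma> = C \<gamma> / (\<Prod>i\<in>UNIV. fact (\<gamma> i))" for \<gamma> :: "'n \<Rightarrow> nat"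
    have "((\<lambda>\<gamma>. c \<gamma> * (\<Prod>i\<in>UNIV. (z $ i - w $ i) ^ \<gamma> i)) has_sum f (shift_op z x)) UNIV" for z
      using C[of "z - w"] by (simp add: shift_op_shift_op divided_mon_def prod_dividef c_def)
    then show "\<exists>r>0. \<exists>c. \<forall>z. norm (z - w) < r \<longrightarrow>
        ((\<lambda>\<gamma>. c \<gamma> * (\<Prod>i\<in>UNIV. (z $ i - w $ i) ^ \<gamma> i)) has_sum f (shift_op z x)) UNIV"
      by (intro exI[of _ 1] conjI exI[of _ c]) auto
  qed
qed

end

subsection \<open>Biorthogonal sequences in spaces of class \<open>\<MM>\<close>\<close>

text \<open>Gaussian elimination on the equations: a pivot \<open>k\<close> for equation
  \<open>j\<close> is removed from the other rows, and its coefficient is then determined by theirs.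
  If equation \<open>j\<close> is trivial, it is dropped.\<close>

lemma exists_nontrivial_combination:
  fixes a :: "'i \<Rightarrow> 'j \<Rightarrow> 'k::field"
  assumes "finite J" "finite I" "card J < card I"
  shows "\<exists>c. (\<exists>i\<in>I. c i \<noteq> 0) \<and> (\<forall>j\<in>J. (\<Sum>i\<in>I. c i * a i j) = 0)"
  using assms
proof (induction J arbitrary: I a rule: finite_induct)
  case empty
  then show ?case by (intro exI[of _ "\<lambda>_. 1"]) (auto simp: card_gt_0_iff)
next
  case (insert j J)
  show ?case
  proof (cases "\<forall>i\<in>I. a i j = 0")
    case True
    then show ?thesis using insert.IH[of I a] insert.hyps insert.prems by auto
  next
    case False
    then obtain k where k: "k \<in> I" "a k j \<noteq> 0" by blast
    define b where "b i l = a i l - a i j / a k j * a k l" for i l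
    have "card J < card (I - {k})"
      using insert.hyps insert.prems k(1) by simp
    then obtain c where c: "\<exists>i\<in>I - {k}. c i \<noteq> 0" "\<And>l. l \<in> J \<Longrightarrow> (\<Sum>i\<in>I - {k}. c i * b i l) = 0"
      using insert.IH[of "I - {k}" b] insert.prems by auto
    define c' where "c' = c(k := - (\<Sum>i\<in>I - {k}. c i * (a i j / a k j)))"
    have "(\<Sum>i\<in>I. c' i * a i l) = (\<Sum>i\<in>I - {k}. c i * b i l)" for l
    proof -
      have "(\<Sum>i\<in>I. c' i * a i l) = c' k * a k l + (\<Sum>i\<in>I - {k}. c' i * a i l)"
        using insert.prems k(1) by (simp add: sum.remove)
      also have "(\<Sum>i\<in>I - {k}. c' i * a i l) = (\<Sum>i\<in>I - {k}. c i * a i l)"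
        by (intro sum.cong) (auto simp: c'_def)
      also have "c' k * a k l + \<dots> = (\<Sum>i\<in>I - {k}. c i * b i l)"
        by (simp add: c'_def b_def right_diff_distrib sum_subtractf sum_distrib_right mult.assoc)
      finally show ?thesis .
    qed
    moreover have "(\<Sum>i\<in>I - {k}. c i * b i j) = 0"
      using k(2) by (simp add: b_def)
    ultimately have "\<forall>l\<in>insert j J. (\<Sum>i\<in>I. c' i * a i l) = 0" using c(2) by auto
    moreover have "\<exists>i\<in>I. c' i \<noteq> 0" using c(1) by (auto simp: c'_def)
    ultimately show ?thesis by blast
  qed
qed

lemma vector_space_mult: "vector_space ((*) :: 'k::field \<Rightarrow> 'k \<Rightarrow> 'k)"
  by unfold_locales (auto simp: algebra_simps)

section \<open>The finer topology of the dense subspace\<close>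

locale dense_F_subspace = tvs scl
  for scl :: "'k::real_normed_field \<Rightarrow> 'a::{topological_ab_group_add,t2_space} \<Rightarrow> 'a" +
  fixes \<tau> :: "'a topology"
  assumes dense: "closure (topspace \<tau>) = UNIV"
    and finer: "openin (top_of_set (topspace \<tau>)) S \<Longrightarrow> openin \<tau> S"
    and F_space: "F_space scl \<tau>"
    and separable: "separable_space \<tau>"
begin

lemma subspace_topspace: "subspace (topspace \<tau>)"
  using F_space by (simp add: F_space_def)

lemma zero_topspace: "0 \<in> topspace \<tau>"
  by (rule subspace_0[OF subspace_topspace])

lemma openin_Int_open: "open S \<Longrightarrow> openin \<tau> (topspace \<tau> \<inter> S)"
  by (intro finer) (auto simp: openin_open)

lemma tau_nhd_add:
  assumes "openin \<tau> W" "0 \<in> W"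
  shows "\<exists>V. openin \<tau> V \<and> 0 \<in> V \<and> (\<forall>x\<in>V. \<forall>y\<in>V. x + y \<in> W)"
proof -
  have "continuous_map (prod_topology \<tau> \<tau>) \<tau> (\<lambda>(x, y). x + y)"
    using F_space by (simp add: F_space_def)
  from openin_continuous_map_preimage[OF this assms(1)]
  have op: "openin (prod_topology \<tau> \<tau>) {p \<in> topspace \<tau> \<times> topspace \<tau>. (case p of (x, y) \<Rightarrow> x + y) \<in> W}"
      (is "openin _ ?S")
    by simp
  have mem: "(0, 0) \<in> ?S"
    using assms(2) zero_topspace by simp
  have "\<exists>A B. openin \<tau> A \<and> openin \<tau> B \<and> 0 \<in> A \<and> 0 \<in> B \<and> A \<times> B \<subseteq> ?S"
    using op mem unfolding openin_prod_topology_alt by blast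
  then obtain A B where AB: "openin \<tau> A" "openin \<tau> B" "0 \<in> A" "0 \<in> B" "A \<times> B \<subseteq> ?S"
    by (elim exE conjE)
  have "x + y \<in> W" if "x \<in> A \<inter> B" "y \<in> A \<inter> B" for x y
    using AB(5) that by auto
  then show ?thesis
    using AB by (intro exI[of _ "A \<inter> B"]) auto
qed

lemma tau_scale:
  assumes "openin \<tau> W" "0 \<in> W" "x \<in> topspace \<tau>"
  shows "\<exists>\<delta>>0. \<forall>c. norm c < \<delta> \<longrightarrow> scl c x \<in> W"
proof -
  have "continuous_map (prod_topology euclidean \<tau>) \<tau> (\<lambda>(c, x). scl c x)"
    using F_space by (simp add: F_space_def)
  from openin_continuous_map_preimage[OF this assms(1)]
  have op: "openin (prod_topology euclidean \<tau>) {p \<in> UNIV \<times> topspace \<tau>. (case p of (c, x) \<Rightarrow> scl c x) \<in> W}"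
      (is "openin _ ?S")
    by simp
  have mem: "(0, x) \<in> ?S"
    using assms by simp
  have "\<exists>A B. openin euclidean A \<and> openin \<tau> B \<and> 0 \<in> A \<and> x \<in> B \<and> A \<times> B \<subseteq> ?S"
    using op mem unfolding openin_prod_topology_alt by blast
  then obtain A B where AB: "open A" "0 \<in> A" "x \<in> B" "A \<times> B \<subseteq> ?S"
    unfolding open_openin[symmetric] by (elim exE conjE)
  then obtain \<delta> where \<delta>: "\<delta> > 0" "ball 0 \<delta> \<subseteq> A"
    using open_contains_ball by blast
  have "scl c x \<in> W" if "norm c < \<delta>" for c
  proof -
    have "c \<in> A" using \<delta>(2) that by (auto simp: subset_iff)
    then have "(c, x) \<in> ?S" using AB(3,4) by blast
    then show ?thesis by simp
  qed
  then show ?thesis using \<delta>(1) by blast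
qed

lemma tau_countable_base:
  "\<exists>B :: nat \<Rightarrow> 'a set. (\<forall>n. openin \<tau> (B n) \<and> 0 \<in> B n) \<and>
    (\<forall>V. openin \<tau> V \<and> 0 \<in> V \<longrightarrow> (\<exists>N. \<forall>n\<ge>N. B n \<subseteq> V))"
proof -
  have "metrizable_space \<tau>"
    using F_space unfolding F_space_def by (elim conjE)
  then obtain M d where Md: "Metric_space M d" "\<tau> = Metric_space.mtopology M d"
    unfolding metrizable_space_def by blast
  interpret Metric_space M d by (rule Md(1))
  have 0: "0 \<in> M" using zero_topspace Md(2) by simp
  show ?thesis
  proof (intro exI[of _ "\<lambda>n. mball 0 (1 / real (Suc n))"] conjI allI impI)
    show "openin \<tau> (mball 0 (1 / real (Suc n)))" for n
      by (simp add: Md(2))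
    show "0 \<in> mball 0 (1 / real (Suc n))" for n using 0 by simp
    fix V assume "openin \<tau> V \<and> 0 \<in> V"
    then have "\<exists>r>0. mball 0 r \<subseteq> V"
      by (simp add: Md(2) openin_mtopology)
    then obtain r where r: "r > 0" "mball 0 r \<subseteq> V"
      by blast
    obtain N where N: "1 / real (Suc N) < r"
      using nat_approx_posE[OF r(1)] by blast
    have "mball 0 (1 / real (Suc n)) \<subseteq> V" if "N \<le> n" for n
    proof -
      have "1 / real (Suc n) \<le> 1 / real (Suc N)" using that by (simp add: frac_le)
      then have "mball 0 (1 / real (Suc n)) \<subseteq> mball 0 r" using N by (intro mball_subset_concentric) simp
      then show ?thesis using r(2) by blast
    qed
    then show "\<exists>N. \<forall>n\<ge>N. mball 0 (1 / real (Suc n)) \<subseteq> V" by blast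
  qed
qed

text \<open>A halving base at zero, used in place of an invariant metric: if the term with index
  \<open>n\<close> lies in \<open>W (n + 1)\<close>, then a finite sum of terms with indices from
  \<open>m\<close> on lies in \<open>W m\<close>.\<close>

definition nhd_chain :: "(nat \<Rightarrow> 'a set) \<Rightarrow> bool"
  where "nhd_chain W \<longleftrightarrow> (\<forall>n. openin \<tau> (W n) \<and> 0 \<in> W n) \<and>
    (\<forall>n. \<forall>x\<in>W (Suc n). \<forall>y\<in>W (Suc n). x + y \<in> W n) \<and>
    (\<forall>V. openin \<tau> V \<and> 0 \<in> V \<longrightarrow> (\<exists>N. \<forall>n\<ge>N. W n \<subseteq> V))"

lemma
  assumes "nhd_chain W"
  shows nhd_chain_openin: "openin \<tau> (W n)"
    and nhd_chain_zero: "0 \<in> W n"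
    and nhd_chain_add: "x \<in> W (Suc n) \<Longrightarrow> y \<in> W (Suc n) \<Longrightarrow> x + y \<in> W n"
    and nhd_chain_base: "openin \<tau> V \<Longrightarrow> 0 \<in> V \<Longrightarrow> \<exists>N. \<forall>n\<ge>N. W n \<subseteq> V"
  using assms unfolding nhd_chain_def by (blast, blast, blast, blast)

lemma exists_nhd_chain: "\<exists>W. nhd_chain W"
proof -
  obtain B :: "nat \<Rightarrow> 'a set" where B: "\<forall>n. openin \<tau> (B n) \<and> 0 \<in> B n"
    "\<forall>V. openin \<tau> V \<and> 0 \<in> V \<longrightarrow> (\<exists>N. \<forall>n\<ge>N. B n \<subseteq> V)"
    using tau_countable_base by (elim exE conjE)
  have "\<exists>W. \<forall>n. (openin \<tau> (W n) \<and> 0 \<in> W n \<and> W n \<subseteq> B n) \<and> (\<forall>x\<in>W (Suc n). \<forall>y\<in>W (Suc n). x + y \<in> W n)"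
  proof (rule dependent_nat_choice)
    show "\<exists>W. openin \<tau> W \<and> 0 \<in> W \<and> W \<subseteq> B 0"
      by (rule exI[of _ "B 0"]) (simp add: B(1))
    fix W n assume W: "openin \<tau> W \<and> 0 \<in> W \<and> W \<subseteq> B n"
    have "openin \<tau> W" "0 \<in> W" using W by simp_all
    from tau_nhd_add[OF this]
    obtain V where V: "openin \<tau> V" "0 \<in> V" "\<forall>x\<in>V. \<forall>y\<in>V. x + y \<in> W"
      by (elim exE conjE)
    show "\<exists>V. (openin \<tau> V \<and> 0 \<in> V \<and> V \<subseteq> B (Suc n)) \<and> (\<forall>x\<in>V. \<forall>y\<in>V. x + y \<in> W)"
      by (rule exI[of _ "V \<inter> B (Suc n)"]) (use V B(1) in \<open>simp add: openin_Int\<close>)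
  qed
  then obtain W where W: "\<forall>n. (openin \<tau> (W n) \<and> 0 \<in> W n \<and> W n \<subseteq> B n) \<and>
      (\<forall>x\<in>W (Suc n). \<forall>y\<in>W (Suc n). x + y \<in> W n)" by (rule exE)
  have "\<exists>N. \<forall>n\<ge>N. W n \<subseteq> V" if V: "openin \<tau> V \<and> 0 \<in> V" for V
  proof -
    obtain N where N: "\<forall>n\<ge>N. B n \<subseteq> V" using B(2) V by blast
    have "W n \<subseteq> V" if "n \<ge> N" for n
      using W[rule_format, of n] N[rule_format, OF that] by blast
    then show ?thesis by blast
  qed
  then have "nhd_chain W"
    unfolding nhd_chain_def using W by simp
  then show ?thesis by blast
qed

lemma tau_dense_sequence:
  "\<exists>v :: nat \<Rightarrow> 'a. (\<forall>m. v m \<in> topspace \<tau>) \<and>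
    (\<forall>S. openin \<tau> S \<and> S \<noteq> {} \<longrightarrow> (\<exists>m. v m \<in> S))"
proof -
  obtain C where C: "countable C" "C \<subseteq> topspace \<tau>" "\<tau> closure_of C = topspace \<tau>"
    using separable by (auto simp: separable_space_def)
  then have meets: "C \<inter> S \<noteq> {}" if "openin \<tau> S" "S \<noteq> {}" for S
    using that unfolding dense_intersects_open by blast
  have "topspace \<tau> \<noteq> {}" using zero_topspace by blast
  then have "C \<noteq> {}" using meets[OF openin_topspace] by blast
  then have range: "range (from_nat_into C) = C" using C(1) by (rule range_from_nat_into)
  show ?thesis
  proof (intro exI[of _ "from_nat_into C"] conjI allI impI)
    show "from_nat_into C m \<in> topspace \<tau>" for m using C(2) range by blast
    show "\<exists>m. from_nat_into C m \<in> S" if "openin \<tau> S \<and> S \<noteq> {}" for S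
    proof -
      have "range (from_nat_into C) \<inter> S \<noteq> {}" using meets that range by simp
      then show ?thesis by blast
    qed
  qed
qed

section \<open>Construction of the biorthogonal sequence\<close>

text \<open>The bound may depend on the functional, which makes the set closed under linear
  combinations; a bound by 1, as in equicontinuity, would not survive the construction. The
  individual bounds are later absorbed by the weights.\<close>

definition bounded_functionals :: "'a set \<Rightarrow> ('a \<Rightarrow> 'k) set"
  where "bounded_functionals U = {g \<in> cont_dual scl. \<exists>C. \<forall>u\<in>U. norm (g u) \<le> C}"

lemma bounded_functionals_scale:
  assumes "g \<in> bounded_functionals U"
  shows "(\<lambda>x. c * g x) \<in> bounded_functionals U"
proof -
  obtain C where C: "\<And>u. u \<in> U \<Longrightarrow> norm (g u) \<le> C" and g: "g \<in> cont_dual scl"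
    using assms by (auto simp: bounded_functionals_def)
  have "norm (c * g u) \<le> norm c * C" if "u \<in> U" for u
    using C[OF that] by (simp add: norm_mult mult_left_mono)
  moreover have "(\<lambda>x. c * g x) \<in> cont_dual scl"
    using g by (auto simp: cont_dual_def Vector_Spaces.linear_iff algebra_simps intro!: continuous_intros)
  ultimately show ?thesis by (auto simp: bounded_functionals_def)
qed

lemma bounded_functionals_sum:
  assumes "\<And>i. i \<in> I \<Longrightarrow> g i \<in> bounded_functionals U"
  shows "(\<lambda>x. \<Sum>i\<in>I. g i x) \<in> bounded_functionals U"
proof -
  have "\<forall>i\<in>I. \<exists>C. \<forall>u\<in>U. norm (g i u) \<le> C"
    using assms by (auto simp: bounded_functionals_def)
  then obtain C where C: "\<And>i u. i \<in> I \<Longrightarrow> u \<in> U \<Longrightarrow> norm (g i u) \<le> C i" by metis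
  have g: "g i \<in> cont_dual scl" if "i \<in> I" for i
    using assms that by (auto simp: bounded_functionals_def)
  have "norm (\<Sum>i\<in>I. g i u) \<le> (\<Sum>i\<in>I. C i)" if "u \<in> U" for u
    using C that by (intro order_trans[OF norm_sum sum_mono]) auto
  moreover have "(\<lambda>x. \<Sum>i\<in>I. g i x) \<in> cont_dual scl"
    using g vector_space_mult by (auto simp: cont_dual_def Vector_Spaces.linear_iff sum.distrib sum_distrib_left vector_space_axioms
      intro!: continuous_intros)
  ultimately show ?thesis by (auto simp: bounded_functionals_def)
qed

text \<open>Among \<open>n + 1\<close> independent functionals some nontrivial combination satisfies
  \<open>n\<close> linear conditions. It is nonzero on the dense subspace, since otherwise
  continuity would make it vanish everywhere.\<close>

lemma exists_functional_vanishing: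
  fixes n :: nat
  assumes f: "range f \<subseteq> bounded_functionals U" "lin_indep_seq f"
  shows "\<exists>h\<in>bounded_functionals U. (\<forall>j<n. h (x j) = 0) \<and> (\<exists>u\<in>topspace \<tau>. h u \<noteq> 0)"
proof -
  obtain c :: "nat \<Rightarrow> 'k" where c: "\<exists>i\<in>{..n}. c i \<noteq> 0" "\<And>j. j < n \<Longrightarrow> (\<Sum>i\<le>n. c i * f i (x j)) = 0"
    using exists_nontrivial_combination[of "{..<n}" "{..n}" "\<lambda>i j. f i (x j)"] by auto
  define h where "h z = (\<Sum>i\<le>n. c i * f i z)" for z
  have h: "h \<in> bounded_functionals U"
    unfolding h_def using f(1) by (intro bounded_functionals_sum bounded_functionals_scale) auto
  have "\<exists>u\<in>topspace \<tau>. h u \<noteq> 0"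
  proof (rule ccontr)
    assume "\<not> ?thesis"
    then have "topspace \<tau> \<subseteq> h -` {0}" by auto
    moreover have "closed (h -` {0})"
      using h by (intro closed_vimage) (auto simp: bounded_functionals_def cont_dual_def)
    ultimately have "closure (topspace \<tau>) \<subseteq> h -` {0}" by (rule closure_minimal)
    then have "(\<Sum>i\<in>{..n}. c i * f i z) = 0" for z using dense by (auto simp: h_def)
    then have "\<forall>i\<in>{..n}. c i = 0"
      using f(2)[unfolded lin_indep_seq_def, THEN spec, THEN spec, of "{..n}" c] by simp
    then show False using c(1) by blast
  qed
  moreover have "\<forall>j<n. h (x j) = 0" using c(2) by (simp add: h_def)
  ultimately show ?thesis using h by blast
qed

text \<open>The next basis vector is the next target vector, made orthogonal to the previous
  functionals and then moved slightly off the kernel of a new functional.\<close>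

lemma biorthogonal_step:
  fixes n :: nat
  assumes f: "range f \<subseteq> bounded_functionals U" "lin_indep_seq f"
    and W: "openin \<tau> W" "0 \<in> W" and v: "v \<in> topspace \<tau>"
    and X: "\<And>j. j < n \<Longrightarrow> X j \<in> topspace \<tau>" and G: "\<And>j. j < n \<Longrightarrow> G j \<in> cont_dual scl"
    and GX: "\<And>i j. i < n \<Longrightarrow> j < n \<Longrightarrow> G i (X j) = (if i = j then 1 else 0)"
  shows "\<exists>x g. x \<in> topspace \<tau> \<and> g \<in> bounded_functionals U \<and> g x = 1 \<and>
    (\<forall>j<n. g (X j) = 0 \<and> G j x = 0) \<and> (\<exists>s\<in>span (X ` {..<n}). v - x - s \<in> W)"
proof -
  from exists_functional_vanishing[OF f, of n X]
  obtain h where h: "h \<in> bounded_functionals U" and "(\<forall>j<n. h (X j) = 0) \<and> (\<exists>u\<in>topspace \<tau>. h u \<noteq> 0)"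
    by (rule bexE)
  then have hX: "\<And>j. j < n \<Longrightarrow> h (X j) = 0" and "\<exists>u\<in>topspace \<tau>. h u \<noteq> 0"
    by auto
  then obtain u0 where u0: "u0 \<in> topspace \<tau>" "h u0 \<noteq> 0"
    by blast
  have hd: "h \<in> cont_dual scl" using h by (simp add: bounded_functionals_def)
  \<comment> \<open>Projection onto the span of the earlier vectors; subtracting it annihilates all
    earlier functionals and does not change \<open>h\<close>.\<close>
  define P where "P z = (\<Sum>j<n. scl (G j z) (X j))" for z
  have P_span: "P z \<in> span (X ` {..<n})" for z
    unfolding P_def by (intro span_sum span_scale span_base) auto
  have P_top: "P z \<in> topspace \<tau>" for z
    unfolding P_def using X by (intro subspace_sum[OF subspace_topspace] subspace_scale[OF subspace_topspace]) auto
  have hP: "h (P z) = 0" for z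
    using hX by (simp add: P_def cont_dual_sum[OF hd] cont_dual_scale[OF hd])
  have GP: "G i (P z) = G i z" if "i < n" for i z
  proof -
    have "G i (P z) = (\<Sum>j<n. G j z * (if i = j then 1 else 0))"
      using GX that by (simp add: P_def cont_dual_sum[OF G[OF that]] cont_dual_scale[OF G[OF that]])
    also have "\<dots> = G i z" using that by (simp add: sum.delta' if_distrib cong: if_cong)
    finally show ?thesis .
  qed
  define u where "u = u0 - P u0"
  define w where "w = v - P v"
  have u: "u \<in> topspace \<tau>" "h u \<noteq> 0" "\<And>i. i < n \<Longrightarrow> G i u = 0"
    using u0 P_top hP GP by (auto simp: u_def cont_dual_diff[OF hd] cont_dual_diff[OF G] intro: subspace_diff[OF subspace_topspace])
  have w: "w \<in> topspace \<tau>" "\<And>i. i < n \<Longrightarrow> G i w = 0"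
    using v P_top GP by (auto simp: w_def cont_dual_diff[OF G] intro: subspace_diff[OF subspace_topspace])
  obtain \<delta> where \<delta>: "\<delta> > 0" "\<And>c. norm c < \<delta> \<Longrightarrow> scl c u \<in> W"
    using tau_scale[OF W u(1)] by blast
  \<comment> \<open>The new functional must not vanish at the new vector: no correction is made
    unless \<open>h w = 0\<close>, when a small multiple of \<open>u\<close> suffices, small enough
    to remain in \<open>W\<close>.\<close>
  have "\<exists>c. norm c < \<delta> \<and> h w + c * h u \<noteq> 0"
  proof (cases "h w = 0")
    case True
    then show ?thesis using \<delta>(1) u(2) by (intro exI[of _ "of_real (\<delta> / 2)"]) (simp add: norm_divide)
  next
    case False
    then show ?thesis using \<delta>(1) by (intro exI[of _ 0]) simp
  qed
  then obtain c where c: "norm c < \<delta>" "h w + c * h u \<noteq> 0" by blast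
  define x where "x = w + scl c u"
  have hx: "h x \<noteq> 0" using c(2) by (simp add: x_def cont_dual_add[OF hd] cont_dual_scale[OF hd])
  show ?thesis
  proof (intro exI[of _ x] exI[of _ "\<lambda>z. inverse (h x) * h z"] conjI allI impI bexI[OF _ P_span[of v]])
    show "x \<in> topspace \<tau>"
      unfolding x_def using u w by (intro subspace_add[OF subspace_topspace] subspace_scale[OF subspace_topspace])
    show "(\<lambda>z. inverse (h x) * h z) \<in> bounded_functionals U"
      by (rule bounded_functionals_scale[OF h])
    show "inverse (h x) * h x = 1" using hx by simp
    show "inverse (h x) * h (X j) = 0" if "j < n" for j using hX that by simp
    show "G j x = 0" if "j < n" for j
      using u(3) w(2) that by (simp add: x_def cont_dual_add[OF G] cont_dual_scale[OF G])
    have "v - x - P v = scl (- c) u" by (simp add: x_def w_def)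
    then show "v - x - P v \<in> W" using \<delta>(2)[of "- c"] c(1) by simp
  qed
qed

text \<open>Each dense vector \<open>v m\<close> is treated at infinitely many stages, with errors
  in the shrinking sets \<open>W n\<close>. So it lies in the closure of the span even though no
  single stage reaches it exactly.\<close>

lemma exists_biorthogonal_sequence:
  assumes f: "range f \<subseteq> bounded_functionals U" "lin_indep_seq f"
  shows "\<exists>x g. (\<forall>n :: nat. x n \<in> topspace \<tau> \<and> g n \<in> bounded_functionals U) \<and>
    (\<forall>m n. g m (x n) = (if m = n then 1 else 0)) \<and> closure (span (range x)) = UNIV"
proof -
  obtain v :: "nat \<Rightarrow> 'a" where v: "\<And>m. v m \<in> topspace \<tau>"
      "\<And>S. openin \<tau> S \<and> S \<noteq> {} \<Longrightarrow> \<exists>m. v m \<in> S"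
    using tau_dense_sequence by blast
  obtain W where W: "nhd_chain W"
    using exists_nhd_chain by blast
  define Q where "Q F n r \<longleftrightarrow> fst r \<in> topspace \<tau> \<and> snd r \<in> bounded_functionals U \<and> snd r (fst r) = 1 \<and>
    (\<forall>j<n. snd r (fst (F j)) = 0 \<and> snd (F j) (fst r) = 0)"
    for F :: "nat \<Rightarrow> 'a \<times> ('a \<Rightarrow> 'k)" and n r
  define P where "P F n r \<longleftrightarrow> Q F n r \<and>
    (\<exists>s\<in>span ((\<lambda>j. fst (F j)) ` {..<n}). v (fst (prod_decode n)) - fst r - s \<in> W n)"
    for F :: "nat \<Rightarrow> 'a \<times> ('a \<Rightarrow> 'k)" and n r
  have orth: "snd (F i) (fst (F j)) = (if i = j then 1 else 0)" if "Q F i (F i)" "Q F j (F j)" for F i j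
  proof (cases i j rule: linorder_cases)
    case less
    then show ?thesis using that(2) by (simp add: Q_def)
  next
    case equal
    then show ?thesis using that(2) by (simp add: Q_def)
  next
    case greater
    then show ?thesis using that(1) by (simp add: Q_def)
  qed
  have "\<exists>F. \<forall>n. P F n (F n)"
  \<comment> \<open>The requirement on stage \<open>n\<close> involves all earlier stages, not just
    the last one, hence recursion along the well-order; its first obligation is that the requirement
    reads the history only below \<open>n\<close>.\<close>
  proof (rule dependent_wellorder_choice)
    show "P F n r = P F' n r" if "\<And>j. j < n \<Longrightarrow> F j = F' j" for r F F' n
    proof -
      have "(\<lambda>j. fst (F j)) ` {..<n} = (\<lambda>j. fst (F' j)) ` {..<n}" using that by auto
      moreover have "Q F n r = Q F' n r" unfolding Q_def using that by simp
      ultimately show ?thesis unfolding P_def by simp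
    qed
    show "\<exists>r. P F n r" if F: "\<And>j. j < n \<Longrightarrow> P F j (F j)" for n F
    proof -
      have OF: "Q F j (F j)" if "j < n" for j
        using F[OF that] unfolding P_def by (rule conjunct1)
      have "\<exists>x g. x \<in> topspace \<tau> \<and> g \<in> bounded_functionals U \<and> g x = 1 \<and>
          (\<forall>j<n. g (fst (F j)) = 0 \<and> snd (F j) x = 0) \<and>
          (\<exists>s\<in>span ((\<lambda>j. fst (F j)) ` {..<n}). v (fst (prod_decode n)) - x - s \<in> W n)"
      proof (rule biorthogonal_step[OF f nhd_chain_openin[OF W] nhd_chain_zero[OF W] v(1)])
        show "fst (F j) \<in> topspace \<tau>" "snd (F j) \<in> cont_dual scl" if "j < n" for j
          using OF[OF that] by (simp_all add: Q_def bounded_functionals_def)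
        show "snd (F i) (fst (F j)) = (if i = j then 1 else 0)" if "i < n" "j < n" for i j
          by (rule orth[OF OF[OF that(1)] OF[OF that(2)]])
      qed
      then obtain x g where "P F n (x, g)" unfolding P_def Q_def by auto
      then show ?thesis ..
    qed
  qed
  then obtain F where F: "\<And>n. P F n (F n)" by blast
  have OF: "Q F n (F n)" for n
    using F[of n] unfolding P_def by (rule conjunct1)
  define x where "x n = fst (F n)" for n
  define g where "g n = snd (F n)" for n
  have "g m (x n) = (if m = n then 1 else 0)" for m n
    unfolding x_def g_def by (rule orth[OF OF OF])
  moreover have "closure (span (range x)) = UNIV"
  proof -
    have v_closure: "v m \<in> closure (span (range x))" for m
      unfolding closure_iff_nhds_not_empty
    proof (intro allI impI)
      fix A S assume S: "S \<subseteq> A" "open S" "v m \<in> S"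
      have "openin \<tau> (topspace \<tau> \<inter> {w. v m - w \<in> S})"
        by (intro openin_Int_open open_translation_vimage(3) S(2))
      then obtain N where N: "\<And>n. n \<ge> N \<Longrightarrow> W n \<subseteq> topspace \<tau> \<inter> {w. v m - w \<in> S}"
        using nhd_chain_base[OF W] S(3) zero_topspace by fastforce
      \<comment> \<open>A stage that treats \<open>v m\<close> and satisfies
        \<open>N \<le> n\<close>, so its error is as small as \<open>S\<close> demands.\<close>
      define n where "n = prod_encode (m, N)"
      obtain s where s: "s \<in> span ((\<lambda>j. fst (F j)) ` {..<n})" "v m - x n - s \<in> W n"
      proof -
        have "fst (prod_decode n) = m" by (simp add: n_def)
        moreover have "\<exists>s\<in>span ((\<lambda>j. fst (F j)) ` {..<n}). v (fst (prod_decode n)) - fst (F n) - s \<in> W n"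
          using F[of n] unfolding P_def by (rule conjunct2)
        ultimately show ?thesis using that unfolding x_def by blast
      qed
      have "span ((\<lambda>j. fst (F j)) ` {..<n}) \<subseteq> span (range x)"
        by (rule span_mono) (auto simp: x_def)
      then have "s \<in> span (range x)" using s(1) by blast
      then have "x n + s \<in> span (range x)"
        by (rule span_add[OF span_base[OF rangeI]])
      moreover have "x n + s \<in> S"
      proof -
        have "N \<le> n" unfolding n_def by (rule le_prod_encode_2)
        then have "v m - (v m - x n - s) \<in> S" using N s(2) by blast
        moreover have "v m - (v m - x n - s) = x n + s" by (simp add: diff_diff_eq2 diff_diff_eq)
        ultimately show ?thesis by simp
      qed
      ultimately show "span (range x) \<inter> A \<noteq> {}" using S(1) by blast
    qed
    have "topspace \<tau> \<subseteq> closure (span (range x))"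
    proof
      fix y assume y: "y \<in> topspace \<tau>"
      show "y \<in> closure (span (range x))"
        unfolding closure_iff_nhds_not_empty
      proof (intro allI impI)
        fix A S assume S: "S \<subseteq> A" "open S" "y \<in> S"
        then obtain m where "v m \<in> S" using v(2)[of "topspace \<tau> \<inter> S"] openin_Int_open[OF S(2)] y by blast
        then show "span (range x) \<inter> A \<noteq> {}"
          using v_closure[of m] S unfolding closure_iff_nhds_not_empty by blast
      qed
    qed
    then have "closure (topspace \<tau>) \<subseteq> closure (span (range x))"
      by (rule closure_minimal) simp
    then show ?thesis using dense by blast
  qed
  moreover have "x n \<in> topspace \<tau> \<and> g n \<in> bounded_functionals U" for n
    using OF[of n] by (simp add: Q_def x_def g_def)
  ultimately show ?thesis
    by (intro exI[of _ x] exI[of _ g] conjI allI) simp_all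
qed

section \<open>Convergence and smallness of the synthesis series\<close>

text \<open>Peeling off the first index: its term and the remaining sum both lie in
  \<open>W (m + 1)\<close>, so their sum lies in \<open>W m\<close>. A missing index is treated as
  the term 0.\<close>

lemma tau_tail_sum:
  assumes W: "nhd_chain W"
    and x: "\<And>c n. norm c \<le> 1 \<Longrightarrow> scl c (x n) \<in> W (Suc n)"
    and a: "\<And>n. norm (a n) \<le> 1" and F: "finite F" "F \<subseteq> {m..}"
  shows "(\<Sum>n\<in>F. scl (a n) (x n)) \<in> W m"
proof -
  have main: "(\<Sum>n\<in>F. scl (a n) (x n)) \<in> W m" if "F \<subseteq> {m..<m + d}" for F m d
    using that
  proof (induction d arbitrary: m F)
    case 0
    then show ?case using nhd_chain_zero[OF W] by simp
  next
    case (Suc d)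
    have fin: "finite F" using Suc.prems finite_subset by blast
    have rest: "(\<Sum>n\<in>F - {m}. scl (a n) (x n)) \<in> W (Suc m)"
      using Suc.prems by (intro Suc.IH) (auto simp: subset_iff Suc_le_eq le_less)
    show ?case
    proof (cases "m \<in> F")
      case True
      then show ?thesis using nhd_chain_add[OF W x[OF a] rest] fin by (simp add: sum.remove)
    next
      case False
      then show ?thesis using nhd_chain_add[OF W nhd_chain_zero[OF W] rest] by simp
    qed
  qed
  obtain N where "\<forall>n\<in>F. n < N" using F(1) finite_nat_set_iff_bounded by blast
  then have "F \<subseteq> {m..<m + N}" using F(2) by force
  then show ?thesis by (rule main)
qed

text \<open>The finite partial sums form a Cauchy filter for \<open>\<tau>\<close>, so completeness
  of the \<open>F\<close>-space gives a limit, which is also a limit in the coarser topology of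
  \<open>X\<close>.\<close>

lemma tau_summable:
  assumes W: "nhd_chain W"
    and x: "\<And>c n. norm c \<le> 1 \<Longrightarrow> scl c (x n) \<in> W (Suc n)" "\<And>n. x n \<in> topspace \<tau>"
    and a: "\<And>n. norm (a n) \<le> 1"
  shows "(\<lambda>n. scl (a n) (x n)) summable_on UNIV"
proof -
  define S where "S F = (\<Sum>n\<in>F. scl (a n) (x n))" for F
  define \<Phi> where "\<Phi> = filtermap S (finite_subsets_at_top UNIV)"
  have "tvs_cauchy_filter \<tau> \<Phi>"
    unfolding tvs_cauchy_filter_def
  proof (intro conjI allI impI)
    show "\<Phi> \<noteq> bot" by (simp add: \<Phi>_def filtermap_bot_iff)
    have "S F \<in> topspace \<tau>" for F
      unfolding S_def using x(2) by (intro subspace_sum[OF subspace_topspace] subspace_scale[OF subspace_topspace])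
    then show "\<Phi> \<le> principal (topspace \<tau>)"
      by (simp add: \<Phi>_def le_principal eventually_filtermap)
    fix V assume V: "openin \<tau> V \<and> 0 \<in> V"
    obtain m where m: "W m \<subseteq> V"
      using nhd_chain_base[OF W conjunct1[OF V] conjunct2[OF V]] by blast
    \<comment> \<open>Two such partial sums differ by two tails starting at \<open>Suc m\<close>;
      each lies in \<open>W (Suc m)\<close>, so the difference lies in \<open>W m\<close>.\<close>
    define A where "A = S ` {F. finite F \<and> {..<Suc m} \<subseteq> F}"
    have "\<forall>\<^sub>F F in finite_subsets_at_top UNIV. finite F \<and> {..<Suc m} \<subseteq> F"
      by (auto simp: eventually_finite_subsets_at_top intro!: exI[of _ "{..<Suc m}"])
    then have "\<forall>\<^sub>F z in \<Phi>. z \<in> A"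
      unfolding \<Phi>_def eventually_filtermap by eventually_elim (auto simp: A_def)
    moreover have "z - z' \<in> V" if "z \<in> A" "z' \<in> A" for z z'
    proof -
      obtain F F' where F: "finite F" "{..<Suc m} \<subseteq> F" "z = S F" and F': "finite F'" "{..<Suc m} \<subseteq> F'" "z' = S F'"
        using \<open>z \<in> A\<close> \<open>z' \<in> A\<close> by (auto simp: A_def)
      have "S F = S (F - {..<Suc m}) + S {..<Suc m}" "S F' = S (F' - {..<Suc m}) + S {..<Suc m}"
        unfolding S_def using F F' by (simp_all add: sum.subset_diff)
      then have "z - z' = (\<Sum>n\<in>F - {..<Suc m}. scl (a n) (x n)) + (\<Sum>n\<in>F' - {..<Suc m}. scl (- a n) (x n))"
        using F(3) F'(3) by (simp add: S_def sum_negf)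
      also have "\<dots> \<in> W m"
        using a F(1) F'(1) by (intro nhd_chain_add[OF W] tau_tail_sum[OF W x(1)]) auto
      finally show ?thesis using m by blast
    qed
    ultimately show "\<exists>A. (\<forall>\<^sub>F z in \<Phi>. z \<in> A) \<and> (\<forall>z\<in>A. \<forall>z'\<in>A. z - z' \<in> V)" by blast
  qed
  then obtain l where l: "limitin \<tau> (\<lambda>z. z) l \<Phi>"
    using F_space unfolding F_space_def tvs_complete_def by blast
  have "(S \<longlongrightarrow> l) (finite_subsets_at_top UNIV)"
  proof (rule topological_tendstoI)
    fix O' assume "open O'" "l \<in> O'"
    then have "\<forall>\<^sub>F z in \<Phi>. z \<in> topspace \<tau> \<inter> O'"
      using l openin_Int_open[of O'] unfolding limitin_def by blast
    then show "\<forall>\<^sub>F F in finite_subsets_at_top UNIV. S F \<in> O'"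
      unfolding \<Phi>_def eventually_filtermap by eventually_elim auto
  qed
  then show ?thesis unfolding summable_on_def has_sum_def S_def by blast
qed

lemma (in tvs) small_finite_sum:
  fixes m :: nat
  assumes "open W" "0 \<in> W"
  shows "\<exists>\<epsilon>>0. \<forall>a. (\<forall>n<m. norm (a n) < \<epsilon>) \<longrightarrow> (\<Sum>n<m. scl (a n) (x n)) \<in> W"
  using assms
proof (induction m arbitrary: W)
  case 0
  then show ?case by (intro exI[of _ 1]) simp
next
  case (Suc m)
  obtain V where V: "open V" "0 \<in> V" "\<And>x y. x \<in> V \<Longrightarrow> y \<in> V \<Longrightarrow> x + y \<in> W"
    using zero_nhd_add[OF Suc.prems] by blast
  obtain \<epsilon> where \<epsilon>: "\<epsilon> > 0" "\<And>a. (\<forall>n<m. norm (a n) < \<epsilon>) \<Longrightarrow> (\<Sum>n<m. scl (a n) (x n)) \<in> V"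
    using Suc.IH[OF V(1,2)] by blast
  obtain \<delta> where \<delta>: "\<delta> > 0" "\<And>c. norm c < \<delta> \<Longrightarrow> scl c (x m) \<in> V"
    using eventually_scale_in[OF V(1,2)] by blast
  show ?case
    using \<epsilon> \<delta> V(3) by (intro exI[of _ "min \<epsilon> \<delta>"]) auto
qed

text \<open>The limit is split into its distance from a large partial sum, a tail lying in
  \<open>W m\<close> because the coefficients are at most 1, and a head of \<open>m\<close> terms
  made small directly. These three pieces are why the neighbourhood is halved twice.\<close>

lemma small_infsum:
  assumes W: "nhd_chain W"
    and x: "\<And>c n. norm c \<le> 1 \<Longrightarrow> scl c (x n) \<in> W (Suc n)" "\<And>n. x n \<in> topspace \<tau>"
    and S: "open S" "0 \<in> S"
  shows "\<exists>\<epsilon>>0. \<forall>a. (\<forall>n. norm (a n) \<le> \<epsilon>) \<longrightarrow> (\<Sum>\<^sub>\<infinity>n. scl (a n) (x n)) \<in> S"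
proof -
  obtain V1 where V1: "open V1" "0 \<in> V1" "\<And>x y. x \<in> V1 \<Longrightarrow> y \<in> V1 \<Longrightarrow> x + y \<in> S"
    using zero_nhd_add[OF S] by blast
  obtain V where V: "open V" "0 \<in> V" "\<And>x y. x \<in> V \<Longrightarrow> y \<in> V \<Longrightarrow> x + y \<in> V1"
    using zero_nhd_add[OF V1(1,2)] by blast
  obtain m where m: "W m \<subseteq> topspace \<tau> \<inter> V"
    using nhd_chain_base[OF W openin_Int_open[OF V(1)]] V(2) zero_topspace by blast
  obtain \<epsilon> where \<epsilon>: "\<epsilon> > 0" "\<And>a. (\<forall>n<m. norm (a n) < \<epsilon>) \<Longrightarrow> (\<Sum>n<m. scl (a n) (x n)) \<in> V"
    using small_finite_sum[OF V(1,2)] by blast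
  have "(\<Sum>\<^sub>\<infinity>n. scl (a n) (x n)) \<in> S" if a: "\<And>n. norm (a n) \<le> min 1 (\<epsilon> / 2)" for a
  proof -
    define l where "l = (\<Sum>\<^sub>\<infinity>n. scl (a n) (x n))"
    have a1: "norm (a n) \<le> 1" and a_small: "norm (a n) < \<epsilon>" for n
      using a[of n] \<epsilon>(1) by auto
    have "((\<lambda>n. scl (a n) (x n)) has_sum l) UNIV"
      unfolding l_def by (intro has_sum_infsum) (rule tau_summable[OF W x a1])
    then have "\<forall>\<^sub>F F in finite_subsets_at_top UNIV. (\<Sum>n\<in>F. scl (a n) (x n)) \<in> {w. l - w \<in> V}"
      unfolding has_sum_def using open_translation_vimage(3)[OF V(1), of l] V(2) by (auto dest: topological_tendstoD)
    then obtain F0 where F0: "finite F0" "\<And>F. finite F \<Longrightarrow> F0 \<subseteq> F \<Longrightarrow> l - (\<Sum>n\<in>F. scl (a n) (x n)) \<in> V"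
      unfolding eventually_finite_subsets_at_top by auto
    define F where "F = F0 \<union> {..<m}"
    have "l - (\<Sum>n\<in>F. scl (a n) (x n)) \<in> V" by (rule F0(2)) (auto simp: F_def F0(1))
    then have "l - (\<Sum>n\<in>F. scl (a n) (x n)) \<in> V1" using V(3)[OF _ V(2)] by simp
    moreover have "(\<Sum>n\<in>F - {..<m}. scl (a n) (x n)) \<in> W m"
      using a1 F0(1) by (intro tau_tail_sum[OF W x(1)]) (auto simp: F_def)
    moreover have "(\<Sum>n<m. scl (a n) (x n)) \<in> V"
      using a_small by (intro \<epsilon>(2)) simp
    moreover have "(\<Sum>n\<in>F. scl (a n) (x n)) = (\<Sum>n\<in>F - {..<m}. scl (a n) (x n)) + (\<Sum>n<m. scl (a n) (x n))"
      using F0(1) by (intro sum.subset_diff) (auto simp: F_def)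
    ultimately have "(l - (\<Sum>n\<in>F. scl (a n) (x n))) + (\<Sum>n\<in>F. scl (a n) (x n)) \<in> S"
      using m V(3) by (intro V1(3)) auto
    then show ?thesis by (simp add: l_def)
  qed
  then show ?thesis using \<epsilon>(1) by (intro exI[of _ "min 1 (\<epsilon> / 2)"]) auto
qed

text \<open>Scaling \<open>x n\<close> by a small nonzero \<open>b n\<close> puts all its multiples
  by scalars of norm at most 1 into \<open>W (n + 1)\<close>; dividing \<open>g n\<close> by
  \<open>b n\<close> restores biorthogonality, and the span does not change.\<close>

lemma exists_synthesis_sequence:
  assumes f: "range f \<subseteq> bounded_functionals U" "lin_indep_seq f"
  shows "\<exists>x g. (\<forall>n. g n \<in> bounded_functionals U) \<and>
    (\<forall>m n. g m (x n) = (if m = n then 1 else 0)) \<and> closure (span (range x)) = UNIV \<and>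
    (\<forall>a. (\<forall>n. norm (a n) \<le> 1) \<longrightarrow> (\<lambda>n :: nat. scl (a n) (x n)) summable_on UNIV) \<and>
    (\<forall>S. open S \<longrightarrow> 0 \<in> S \<longrightarrow>
      (\<exists>\<epsilon>>0. \<forall>a. (\<forall>n. norm (a n) \<le> \<epsilon>) \<longrightarrow> (\<Sum>\<^sub>\<infinity>n :: nat. scl (a n) (x n)) \<in> S))"
proof -
  obtain W where W: "nhd_chain W"
    using exists_nhd_chain by blast
  obtain x g where "\<forall>n :: nat. x n \<in> topspace \<tau> \<and> g n \<in> bounded_functionals U"
    and xg: "\<And>m n. g m (x n) = (if m = n then 1 else 0)" "closure (span (range x)) = UNIV"
    using exists_biorthogonal_sequence[OF f] by blast
  then have xg': "\<And>n. x n \<in> topspace \<tau>" "\<And>n. g n \<in> bounded_functionals U" by auto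
  have "\<exists>\<delta>. \<forall>n. \<delta> n > 0 \<and> (\<forall>c. norm c < \<delta> n \<longrightarrow> scl c (x n) \<in> W (Suc n))"
    using tau_scale[OF nhd_chain_openin[OF W] nhd_chain_zero[OF W] xg'(1)] by (intro choice) blast
  then obtain \<delta> where \<delta>: "\<And>n. \<delta> n > 0" "\<And>n c. norm c < \<delta> n \<Longrightarrow> scl c (x n) \<in> W (Suc n)"
    by blast
  define b :: "nat \<Rightarrow> 'k" where "b n = of_real (\<delta> n / 2)" for n
  have b: "b n \<noteq> 0" "norm (b n) < \<delta> n" for n
    using \<delta>(1)[of n] by (auto simp: b_def norm_divide)
  define x' where "x' n = scl (b n) (x n)" for n
  have x'W: "scl c (x' n) \<in> W (Suc n)" if "norm c \<le> 1" for c n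
  proof -
    have "norm (c * b n) \<le> 1 * norm (b n)"
      unfolding norm_mult using that by (intro mult_right_mono) auto
    then show ?thesis using \<delta>(2)[of "c * b n" n] b(2)[of n] by (simp add: x'_def)
  qed
  have x'_top: "x' n \<in> topspace \<tau>" for n
    unfolding x'_def by (rule subspace_scale[OF subspace_topspace xg'(1)])
  have "range x \<subseteq> span (range x')"
  proof clarify
    fix n
    have "scl (inverse (b n)) (x' n) \<in> span (range x')" by (intro span_scale span_base) auto
    then show "x n \<in> span (range x')" using b(1) by (simp add: x'_def)
  qed
  then have "span (range x) \<subseteq> span (range x')" by (intro span_minimal) auto
  then have dense': "closure (span (range x')) = UNIV"
    using closure_mono xg(2) by blast
  have g: "g n \<in> cont_dual scl" for n using xg'(2)[of n] by (simp add: bounded_functionals_def)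
  show ?thesis
  proof (intro exI[of _ x'] exI[of _ "\<lambda>n z. inverse (b n) * g n z"] conjI allI impI)
    show "(\<lambda>z. inverse (b n) * g n z) \<in> bounded_functionals U" for n
      by (rule bounded_functionals_scale[OF xg'(2)])
    show "inverse (b m) * g m (x' n) = (if m = n then 1 else 0)" for m n
      using b(1) by (simp add: x'_def cont_dual_scale[OF g] xg(1))
    show "closure (span (range x')) = UNIV" by (rule dense')
    show "(\<lambda>n. scl (a n) (x' n)) summable_on UNIV" if "\<forall>n. norm (a n) \<le> 1" for a
      using that by (intro tau_summable[OF W x'W x'_top]) auto
    show "\<exists>\<epsilon>>0. \<forall>a. (\<forall>n. norm (a n) \<le> \<epsilon>) \<longrightarrow> (\<Sum>\<^sub>\<infinity>n :: nat. scl (a n) (x' n)) \<in> S"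
      if "open S" "0 \<in> S" for S
      by (rule small_infsum[OF W x'W x'_top that])
  qed
qed

end

subsection \<open>Choice of the weights\<close>

text \<open>\<open>\<kappa>\<close> depends on the total degree only and grows so fast that the
  terms for a given \<open>\<beta> = \<alpha> + \<gamma>\<close> sum to at most
  \<open>2 ^ (- to_nat \<beta>)\<close>.\<close>

lemma exists_shift_weights:
  fixes C :: "('n::finite \<Rightarrow> nat) \<Rightarrow> real"
  assumes C: "\<And>\<alpha>. 1 \<le> C \<alpha>"
  shows "\<exists>\<kappa>. shift_weights \<kappa> (\<lambda>\<alpha>. C \<alpha> / \<kappa> \<alpha>)"
proof -
  \<comment> \<open>The cardinality pays for the number of pairs with the same sum
    \<open>\<beta>\<close>, the power of 2 for summing over \<open>\<beta>\<close>.\<close>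
  define N where "N \<beta> = real (card {\<alpha>. \<alpha> \<le> \<beta>}) * 2 ^ to_nat \<beta>" for \<beta> :: "'n \<Rightarrow> nat"
  define Q where "Q j = (\<Sum>\<beta> | total_degree \<beta> = j. C \<beta> * N \<beta>)" for j
  define K where "K d = (\<Prod>j\<le>d. 1 + Q j)" for d :: nat
  define \<kappa> where "\<kappa> \<alpha> = K (total_degree \<alpha>)" for \<alpha> :: "'n \<Rightarrow> nat"
  have N: "1 \<le> N \<beta>" for \<beta>
  proof -
    have "\<beta> \<in> {\<alpha>. \<alpha> \<le> \<beta>}" by simp
    then have "1 \<le> card {\<alpha>. \<alpha> \<le> \<beta>}" by (metis One_nat_def Suc_leI card_gt_0_iff empty_iff finite_multi_index_le)
    then have "1 * 1 \<le> real (card {\<alpha>. \<alpha> \<le> \<beta>}) * 2 ^ to_nat \<beta>" by (intro mult_mono) auto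
    then show ?thesis by (simp add: N_def)
  qed
  have CN: "0 \<le> C \<beta> * N \<beta>" for \<beta> using C[of \<beta>] N[of \<beta>] by simp
  have Q: "0 \<le> Q j" for j unfolding Q_def using CN by (intro sum_nonneg) auto
  have K: "1 \<le> K d" for d unfolding K_def using Q by (intro prod_ge_1) auto
  have K_Suc: "K (Suc d) = K d * (1 + Q (Suc d))" for d by (simp add: K_def)
  have K_mono: "K a \<le> K b" if "a \<le> b" for a b
  proof (rule lift_Suc_mono_le[OF _ that])
    show "K d \<le> K (Suc d)" for d
      unfolding K_Suc using mult_left_mono[of 1 "1 + Q (Suc d)" "K d"] Q[of "Suc d"] K[of d] by simp
  qed
  \<comment> \<open>If \<open>\<beta>\<close> has degree \<open>d + 1\<close>, then
    \<open>\<kappa> \<alpha> \<le> K d\<close>, and the additional factor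
    \<open>1 + Q (Suc d)\<close> in \<open>\<kappa> \<beta>\<close> already contains
    \<open>C \<beta> * N \<beta>\<close>.\<close>
  have bound: "\<kappa> \<alpha> * (C \<beta> / \<kappa> \<beta>) \<le> 1 / N \<beta>" if lt: "total_degree \<alpha> < total_degree \<beta>" for \<alpha> \<beta>
  proof -
    obtain d where d: "total_degree \<beta> = Suc d" using lt by (cases "total_degree \<beta>") auto
    have "finite {\<beta>' :: 'n \<Rightarrow> nat. total_degree \<beta>' = Suc d}"
      by (rule finite_subset[OF _ finite_total_degree_le[of "Suc d"]]) auto
    then have "C \<beta> * N \<beta> \<le> Q (Suc d)"
      unfolding Q_def using CN d by (intro member_le_sum) auto
    then have "\<kappa> \<alpha> * (C \<beta> * N \<beta>) \<le> K d * (1 + Q (Suc d))"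
      unfolding \<kappa>_def using lt d K[of d] CN[of \<beta>] by (intro mult_mono K_mono) auto
    then have "\<kappa> \<alpha> * (C \<beta> * N \<beta>) \<le> \<kappa> \<beta>" by (simp add: \<kappa>_def d K_Suc)
    moreover have "0 < \<kappa> \<beta>" "0 < N \<beta>" using K[of "total_degree \<beta>"] N[of \<beta>] by (auto simp: \<kappa>_def)
    ultimately show ?thesis by (simp add: field_simps)
  qed
  have "shift_weights \<kappa> (\<lambda>\<alpha>. C \<alpha> / \<kappa> \<alpha>)"
  proof
    show \<kappa>: "1 \<le> \<kappa> \<alpha>" for \<alpha> by (simp add: \<kappa>_def K)
    show "1 \<le> \<kappa> \<alpha> * (C \<alpha> / \<kappa> \<alpha>)" for \<alpha> using \<kappa>[of \<alpha>] C[of \<alpha>] by simp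
    define B where "B \<beta> = {\<alpha>. \<alpha> \<le> \<beta>} - {\<beta>}" for \<beta> :: "'n \<Rightarrow> nat"
    define f where "f = (\<lambda>(\<beta>, \<alpha>). \<kappa> \<alpha> * (C \<beta> / \<kappa> \<beta>))"
    have B_deg: "total_degree \<alpha> < total_degree \<beta>" if "\<alpha> \<in> B \<beta>" for \<alpha> \<beta>
    proof -
      have "\<alpha> \<le> \<beta>" "\<alpha> \<noteq> \<beta>" using that by (auto simp: B_def)
      then obtain i where "\<alpha> i < \<beta> i" by (metis le_fun_def le_neq_implies_less ext)
      then show ?thesis unfolding total_degree_def using \<open>\<alpha> \<le> \<beta>\<close>
        by (intro sum_strict_mono_ex1) (auto simp: le_fun_def)
    qed
    have f0: "0 \<le> f p" for p
      using order_trans[OF zero_le_one \<kappa>] order_trans[OF zero_le_one C] by (simp add: f_def split: prod.split)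
    have "f summable_on (SIGMA \<beta>:UNIV. B \<beta>)"
    proof (rule summable_on_SigmaI)
      show "((\<lambda>\<alpha>. f (\<beta>, \<alpha>)) has_sum (\<Sum>\<alpha>\<in>B \<beta>. f (\<beta>, \<alpha>))) (B \<beta>)" for \<beta>
        by (intro has_sum_finite) (simp add: B_def)
      show "(\<lambda>\<beta>. \<Sum>\<alpha>\<in>B \<beta>. f (\<beta>, \<alpha>)) summable_on UNIV"
      proof (rule summable_on_comparison_test)
        have "(\<lambda>n. (1/2 :: real) ^ n) summable_on UNIV"
          by (subst summable_on_UNIV_nonneg_real_iff) auto
        then have "(\<lambda>n. (1/2 :: real) ^ n) summable_on range (to_nat :: ('n \<Rightarrow> nat) \<Rightarrow> nat)"
          by (rule summable_on_subset) simp
        then show "(\<lambda>\<beta> :: 'n \<Rightarrow> nat. (1/2 :: real) ^ to_nat \<beta>) summable_on UNIV"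
          by (subst (asm) summable_on_reindex) (auto simp: o_def)
        show "0 \<le> (\<Sum>\<alpha>\<in>B \<beta>. f (\<beta>, \<alpha>))" for \<beta> using f0 by (intro sum_nonneg)
        fix \<beta>
        have "(\<Sum>\<alpha>\<in>B \<beta>. f (\<beta>, \<alpha>)) \<le> real (card (B \<beta>)) * (1 / N \<beta>)"
          using bound B_deg by (intro sum_bounded_above) (simp add: f_def)
        also have "\<dots> \<le> real (card {\<alpha>. \<alpha> \<le> \<beta>}) * (1 / N \<beta>)"
          using N[of \<beta>] by (intro mult_right_mono) (auto simp: B_def intro!: card_mono)
        also have "\<dots> = (1/2) ^ to_nat \<beta>"
        proof -
          have "card {\<alpha>. \<alpha> \<le> \<beta>} \<noteq> 0" using N[of \<beta>] unfolding N_def by (intro notI) simp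
          then show ?thesis by (simp add: N_def power_one_over)
        qed
        finally show "(\<Sum>\<alpha>\<in>B \<beta>. f (\<beta>, \<alpha>)) \<le> (1/2) ^ to_nat \<beta>" .
      qed
    qed (rule f0)
    moreover have "(\<lambda>(\<alpha>, \<gamma>). \<kappa> \<alpha> * (C (\<alpha> + \<gamma>) / \<kappa> (\<alpha> + \<gamma>))) summable_on UNIV \<times> -{0} \<longleftrightarrow>
        f summable_on (SIGMA \<beta>:UNIV. B \<beta>)"
      by (rule summable_on_reindex_bij_witness[where j = "\<lambda>(\<alpha>, \<gamma>). (\<alpha> + \<gamma>, \<alpha>)" and i = "\<lambda>(\<beta>, \<alpha>). (\<alpha>, \<beta> - \<alpha>)"])
        (auto simp: f_def B_def le_fun_def fun_eq_iff, metis le_antisym)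
    ultimately show "(\<lambda>(\<alpha>, \<gamma>). \<kappa> \<alpha> * (C (\<alpha> + \<gamma>) / \<kappa> (\<alpha> + \<gamma>))) summable_on UNIV \<times> -{0}"
      by simp
  qed
  then show ?thesis by blast
qed

lemma exists_multi_index_bij: "\<exists>e :: ('n::finite \<Rightarrow> nat) \<Rightarrow> nat. bij e"
proof -
  have "infinite (UNIV :: ('n \<Rightarrow> nat) set)"
    using finite_fun_UNIVD2[where ?'a='n and ?'b=nat] by auto
  then show ?thesis
    using to_nat_on_infinite[of "UNIV :: ('n \<Rightarrow> nat) set"] by blast
qed

section \<open>Assembly for spaces of class M\<close>

lemma (in tvs) class_M_imp_dense_F_subspace:
  assumes "class_M scl"
  shows "\<exists>\<tau> U f. dense_F_subspace scl \<tau> \<and> open U \<and> 0 \<in> U \<and>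
    range f \<subseteq> dense_F_subspace.bounded_functionals scl U \<and> lin_indep_seq f"
proof -
  obtain Y \<tau> where Y: "closure Y = UNIV" "topspace \<tau> = Y"
      "\<And>U. openin (top_of_set Y) U \<Longrightarrow> openin \<tau> U" "F_space scl \<tau>" "separable_space \<tau>"
    using assms unfolding class_M_def class_M0_def by blast
  interpret dense_F_subspace scl \<tau>
    by unfold_locales (use Y in auto)
  obtain f U where f: "range f \<subseteq> cont_dual scl" "lin_indep_seq f"
      and U: "open U" "0 \<in> U" "\<And>g x. g \<in> range f \<Longrightarrow> x \<in> U \<Longrightarrow> norm (g x) \<le> 1"
    using assms unfolding class_M_def class_M1_def equicontinuous_def by blast
  have "range f \<subseteq> bounded_functionals U"
    using f(1) U(3) unfolding bounded_functionals_def by blast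
  then show ?thesis
    using dense_F_subspace_axioms U(1,2) f(2) by blast
qed

text \<open>With \<open>y\<close> scaled up by \<open>\<kappa>\<close> and \<open>\<phi>\<close>
  scaled down, a coefficient \<open>d \<alpha>\<close> of \<open>y\<close> acts as
  \<open>\<kappa> \<alpha> * d \<alpha>\<close> on the original sequence. Weighted bounds thus
  become plain bounds, and the bounds of the functionals become
  \<open>\<eta> = C / \<kappa>\<close>.\<close>

lemma class_M_imp_shift_system:
  fixes scl :: "'k::{real_normed_field,banach,heine_borel,second_countable_topology} \<Rightarrow>
      'a::{topological_ab_group_add,t2_space} \<Rightarrow> 'a"
  assumes "tvs scl" "class_M scl"
  shows "\<exists>\<kappa> \<eta> y \<phi> U. shift_system scl \<kappa> \<eta> (y :: ('n::finite \<Rightarrow> nat) \<Rightarrow> 'a) \<phi> U"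
proof -
  interpret tvs scl by fact
  obtain \<tau> U f where \<tau>: "dense_F_subspace scl \<tau>" and U: "open U" "0 \<in> U"
    and f: "range f \<subseteq> dense_F_subspace.bounded_functionals scl U" "lin_indep_seq f"
    using class_M_imp_dense_F_subspace[OF assms(2)] by blast
  interpret dense_F_subspace scl \<tau> by fact
  obtain x g where g': "\<forall>n. g n \<in> bounded_functionals U"
    and gx': "\<forall>m n. g m (x n) = (if m = n then 1 else 0)" and dense_x: "closure (span (range x)) = UNIV"
    and summable_x: "\<forall>a. (\<forall>n. norm (a n) \<le> 1) \<longrightarrow> (\<lambda>n :: nat. scl (a n) (x n)) summable_on UNIV"
    and small_x: "\<forall>S. open S \<longrightarrow> 0 \<in> S \<longrightarrow>
      (\<exists>\<epsilon>>0. \<forall>a. (\<forall>n. norm (a n) \<le> \<epsilon>) \<longrightarrow> (\<Sum>\<^sub>\<infinity>n :: nat. scl (a n) (x n)) \<in> S)"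
    using exists_synthesis_sequence[OF f] by (elim exE conjE)
  note g = g'[rule_format] and gx = gx'[rule_format]
  have g_dual: "g n \<in> cont_dual scl" for n using g[of n] by (simp add: bounded_functionals_def)
  obtain e :: "('n \<Rightarrow> nat) \<Rightarrow> nat" where e: "bij e" using exists_multi_index_bij by blast
  have e_inv: "inv e (e \<alpha>) = \<alpha>" "e (inv e n) = n" for \<alpha> n
    using e by (simp_all add: bij_is_inj bij_is_surj surj_f_inv_f)
  have "\<exists>C. \<forall>n. 1 \<le> C n \<and> (\<forall>u\<in>U. norm (g n u) \<le> C n)"
  proof (intro choice allI)
    fix n
    obtain c where "\<forall>u\<in>U. norm (g n u) \<le> c" using g[of n] by (auto simp: bounded_functionals_def)
    then show "\<exists>c. 1 \<le> c \<and> (\<forall>u\<in>U. norm (g n u) \<le> c)" by (intro exI[of _ "max 1 c"]) auto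
  qed
  then obtain C where C: "\<And>n. 1 \<le> C n" "\<And>n u. u \<in> U \<Longrightarrow> norm (g n u) \<le> C n" by blast
  obtain \<kappa> where \<kappa>: "shift_weights \<kappa> (\<lambda>\<alpha>. C (e \<alpha>) / \<kappa> \<alpha>)"
    using exists_shift_weights[of "\<lambda>\<alpha>. C (e \<alpha>)"] C(1) by blast
  interpret shift_weights \<kappa> "\<lambda>\<alpha>. C (e \<alpha>) / \<kappa> \<alpha>" by fact
  define y where "y \<alpha> = scl (of_real (\<kappa> \<alpha>)) (x (e \<alpha>))" for \<alpha>
  define \<phi> where "\<phi> \<alpha> z = inverse (of_real (\<kappa> \<alpha>)) * g (e \<alpha>) z" for \<alpha> z
  have \<kappa>0: "\<kappa> \<alpha> \<noteq> 0" for \<alpha> using kappa_pos[of \<alpha>] by simp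
  define a where "a d n = d (inv e n) * of_real (\<kappa> (inv e n))" for d :: "('n \<Rightarrow> nat) \<Rightarrow> 'k" and n
  have norm_a: "norm (a d n) = \<kappa> (inv e n) * norm (d (inv e n))" for d n
    using kappa_pos[of "inv e n"] by (simp add: a_def norm_mult)
  have y_term: "scl (d \<alpha>) (y \<alpha>) = scl (a d (e \<alpha>)) (x (e \<alpha>))" for d \<alpha>
    by (simp add: y_def a_def e_inv)
  have "shift_system scl \<kappa> (\<lambda>\<alpha>. C (e \<alpha>) / \<kappa> \<alpha>) y \<phi> U"
  proof
    show "\<phi> \<alpha> \<in> cont_dual scl" for \<alpha>
      using bounded_functionals_scale[OF g, of "inverse (of_real (\<kappa> \<alpha>))" "e \<alpha>"]
      unfolding \<phi>_def[abs_def] by (simp add: bounded_functionals_def)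
    show "\<phi> \<alpha> (y \<beta>) = (if \<alpha> = \<beta> then 1 else 0)" for \<alpha> \<beta>
      using e \<kappa>0 by (simp add: \<phi>_def y_def cont_dual_scale[OF g_dual] gx bij_is_inj inj_eq)
    show "open U" "0 \<in> U" by fact+
    show "norm (\<phi> \<alpha> z) \<le> C (e \<alpha>) / \<kappa> \<alpha>" if "z \<in> U" for z \<alpha>
    proof -
      have "norm (\<phi> \<alpha> z) = norm (g (e \<alpha>) z) / \<kappa> \<alpha>"
        unfolding \<phi>_def norm_mult norm_inverse norm_of_real
        using kappa_pos[of \<alpha>] by (simp add: divide_inverse mult.commute)
      then show ?thesis
        using C(2)[OF that, of "e \<alpha>"] kappa_pos[of \<alpha>] by (simp add: divide_right_mono)
    qed
    show "(\<lambda>\<alpha>. scl (d \<alpha>) (y \<alpha>)) summable_on UNIV" if d: "\<And>\<alpha>. \<kappa> \<alpha> * norm (d \<alpha>) \<le> R" for d R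
    proof -
      \<comment> \<open>Convergence is known for coefficients of norm at most 1 only, so the series
        is scaled into that range and back; the maximum makes the divisor positive.\<close>
      define R' where "R' = max 1 R"
      have R': "R' > 0" by (simp add: R'_def)
      have "norm (inverse (of_real R') * a d n) \<le> 1" for n
      proof -
        have "norm (a d n) \<le> R'" using d[of "inv e n"] by (simp add: norm_a R'_def)
        then show ?thesis
          unfolding norm_mult norm_inverse norm_of_real using R' by (simp add: field_simps)
      qed
      then have "(\<lambda>n. scl (inverse (of_real R') * a d n) (x n)) summable_on UNIV"
        by (intro summable_x[rule_format]) simp
      then obtain s where "((\<lambda>n. scl (inverse (of_real R') * a d n) (x n)) has_sum s) UNIV"
        by (auto simp: summable_on_def)
      from has_sum_scale[OF this, of "of_real R'"]
      have "(\<lambda>n. scl (a d n) (x n)) summable_on UNIV"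
        using R' by (auto simp: summable_on_def mult.assoc[symmetric])
      then show ?thesis
        unfolding y_term by (subst summable_on_reindex_bij_betw[OF e]) 
    qed
    show "\<exists>\<epsilon>>0. \<forall>d. (\<forall>\<alpha>. \<kappa> \<alpha> * norm (d \<alpha>) \<le> \<epsilon>) \<longrightarrow> (\<Sum>\<^sub>\<infinity>\<alpha>. scl (d \<alpha>) (y \<alpha>)) \<in> S"
      if S: "open S" "0 \<in> S" for S
    proof -
      obtain \<epsilon> where \<epsilon>: "\<epsilon> > 0" "\<And>a. \<forall>n. norm (a n) \<le> \<epsilon> \<Longrightarrow> (\<Sum>\<^sub>\<infinity>n. scl (a n) (x n)) \<in> S"
        using small_x S by blast
      have "(\<Sum>\<^sub>\<infinity>\<alpha>. scl (d \<alpha>) (y \<alpha>)) \<in> S" if "\<forall>\<alpha>. \<kappa> \<alpha> * norm (d \<alpha>) \<le> \<epsilon>" for d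
        unfolding y_term infsum_reindex_bij_betw[OF e, of "\<lambda>n. scl (a d n) (x n)"]
        by (rule \<epsilon>(2)) (simp add: norm_a that)
      then show ?thesis using \<epsilon>(1) by blast
    qed
    have "range x \<subseteq> span (range y)"
    proof clarify
      fix n
      have "scl (inverse (of_real (\<kappa> (inv e n)))) (y (inv e n)) \<in> span (range y)"
        by (intro span_scale span_base) auto
      then show "x n \<in> span (range y)" using \<kappa>0[of "inv e n"] by (simp add: y_def e_inv)
    qed
    then have "span (range x) \<subseteq> span (range y)" by (intro span_minimal) auto
    then show "closure (span (range y)) = UNIV"
      using closure_mono dense_x by blast
  qed
  then show ?thesis by blast
qed

text \<open>The sorts isolate what is used of the scalar field: completeness for absolutely
  convergent sums, the Heine-Borel property for compact polydiscs, second countability for the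
  countable set of targets. Both real and complex scalars qualify.\<close>

lemma class_M_imp_shift_group:
  fixes scl :: "'k::{real_normed_field,banach,heine_borel,second_countable_topology} \<Rightarrow>
      'a::{topological_ab_group_add,t2_space} \<Rightarrow> 'a"
  assumes "tvs scl" "class_M scl"
  shows "\<exists>T :: 'k ^ 'n \<Rightarrow> 'a \<Rightarrow> 'a. operator_group scl T \<and> uniformly_continuous_group T \<and>
    hereditarily_hypercyclic T \<and> mixing T \<and>
    (\<forall>x. \<forall>f \<in> cont_dual scl. analytic_map (\<lambda>z. f (T z x)))"
proof -
  obtain \<kappa> \<eta> y \<phi> U where "shift_system scl \<kappa> \<eta> (y :: ('n \<Rightarrow> nat) \<Rightarrow> 'a) \<phi> U"
    using class_M_imp_shift_system[OF assms] by blast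
  then interpret shift_system scl \<kappa> \<eta> y \<phi> U .
  show ?thesis
    using operator_group_shift_op uniformly_continuous_shift_op hereditarily_hypercyclic_shift_op
      mixing_shift_op analytic_shift_op by blast
qed

theorem theorem1p4:
  fixes sclR :: "real \<Rightarrow> 'a::{topological_ab_group_add, t2_space} \<Rightarrow> 'a"
    and sclC :: "complex \<Rightarrow> 'b::{topological_ab_group_add, t2_space} \<Rightarrow> 'b"
  shows
    "(tvs sclR \<and> class_M sclR \<longrightarrow>
       (\<exists>T :: real ^ 'n \<Rightarrow> 'a \<Rightarrow> 'a.
          operator_group sclR T \<and> uniformly_continuous_group T \<and>
          hereditarily_hypercyclic T \<and> mixing T \<and>
          (\<forall>x. \<forall>f \<in> cont_dual sclR. analytic_map (\<lambda>z. f (T z x))))) \<and>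
     (tvs sclC \<and> class_M sclC \<longrightarrow>
       (\<exists>T :: complex ^ 'n \<Rightarrow> 'b \<Rightarrow> 'b.
          operator_group sclC T \<and> uniformly_continuous_group T \<and>
          hereditarily_hypercyclic T \<and> mixing T \<and>
          (\<forall>x. \<forall>f \<in> cont_dual sclC. analytic_map (\<lambda>z. f (T z x)))))"
  using class_M_imp_shift_group[of sclR] class_M_imp_shift_group[of sclC] by blast

end
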